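(* Let $M$ be a Turing machine, $r$ a binary string with $M(r)=1$, and $\pi=\langle\varphi_0,\dots,\varphi_n\rangle$ a normal proof of $M(r)=1$. Then the following formula is provable in ZFC: $\forall s\,\big(\mathbf{CK}_{\pi}(\langle\mathbf{T}_{\langle M,s\rangle},\mathbf{AL}\rangle,\pi)=1\to M(s)=1\big)$, where $s$ ranges over binary strings.
   Context: Turing machines $M=(Q,\Gamma,\delta,q_0,q_{halt})$ have tape alphabet $\Gamma=\{0,1,\sqcup,\triangleright\}$. Proofs from a recursive theory: for $\langle T,al\rangle$ with $T$ a set of formulas of set theory and $al$ an algorithm deciding membership in $T$, $\langle T,al\rangle\vdash^{\pi}\varphi$ means $\pi=\langle\varphi_0,\dots,\varphi_n\rangle$, $\varphi_n=\varphi$, and each $\varphi_i$ is (1) a logical axiom, (2) a ZFC axiom, (3) in $T$, (4) obtained by modus ponens: $\varphi_j=(\varphi_k\to\varphi_i)$ for some $j,k<i$, or (5) $\varphi_i=\forall x_k\varphi_j$ for some $j<i$. Adjoint checker: record for each $i$ a justification of $\varphi_i$ of one of kinds (1)–(5) (with indices $j,k$ for (4),(5)). $\mathbf{CK}_\pi$ on input $(\langle U,b\rangle,\sigma)$, $\sigma=\langle\psi_0,\dots,\psi_m\rangle$, returns $0$ if $m\ne n$, and otherwise $1$ iff each recorded justification is valid for $\psi_i$ (kind (3) checked by using $b$ to decide $\psi_i\in U$; kinds (4),(5) with the same indices). Formalization of computations: for binary $s=s_0\dots s_l$, a constant $t$ denotes the computation table of $M$ on $s$, $t_{i,j}\in\Gamma\times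 Q\times\{0,1\}$. $\mathbf{def}_M$ is a fixed finite formula sequence depending only on $M$ asserting $t$ is a table of $M$; $\mathbf{input}_s$ is the sequence $\forall j\,(j>l+1\to t_{0,j}=(\sqcup,q_0,0))$, $t_{0,0}=(\triangleright,q_0,1)$, $t_{0,1}=(s_0,q_0,0)$, …, $t_{0,l+1}=(s_l,q_0,0)$. $\mathbf{T}_{\langle M,s\rangle}$ is $\mathbf{def}_M$ followed by $\mathbf{input}_s$; $\mathbf{AL}$ decides membership in $\mathbf{T}_{\langle M,s\rangle}$ by successive comparison. A normal proof of $M(r)=1$ is a $\pi$ with $\langle\mathbf{T}_{\langle M,r\rangle},\mathbf{AL}\rangle\vdash^{\pi}\exists i\,t_{i,1}=(1,q_{halt},1)$. *)

theory Defs
  imports Main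
begin

section \<open>The language of set theory with a constant for computation tables\<close>

text \<open>
  \<open>Ct\<close> is the constant \<open>t\<close> denoting a computation table.  Formulas in
  which it does not occur are the formulas of the language \<open>{\<in>}\<close>.
\<close>

datatype tm = Var nat | Ct

datatype fm = Eq tm tm | Mem tm tm | Neg fm | Imp fm fm | All nat fm

definition And :: "fm \<Rightarrow> fm \<Rightarrow> fm" where "And a b = Neg (Imp a (Neg b))"
definition Or :: "fm \<Rightarrow> fm \<Rightarrow> fm" where "Or a b = Imp (Neg a) b"
definition Iff :: "fm \<Rightarrow> fm \<Rightarrow> fm" where "Iff a b = And (Imp a b) (Imp b a)"
definition Ex :: "nat \<Rightarrow> fm \<Rightarrow> fm" where "Ex x a = Neg (All x (Neg a))"
definition Bot :: fm where "Bot = Neg (All 0 (Eq (Var 0) (Var 0)))"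

definition Conj :: "fm list \<Rightarrow> fm" where "Conj as = foldr And as (Neg Bot)"
definition Disj :: "fm list \<Rightarrow> fm" where "Disj as = foldr Or as Bot"

primrec fv :: "fm \<Rightarrow> nat set" where
  "fv (Eq s t) = {x. Var x \<in> {s, t}}"
| "fv (Mem s t) = {x. Var x \<in> {s, t}}"
| "fv (Neg a) = fv a"
| "fv (Imp a b) = fv a \<union> fv b"
| "fv (All x a) = fv a - {x}"

primrec t_free :: "fm \<Rightarrow> bool" where
  "t_free (Eq s t) = (Ct \<notin> {s, t})"
| "t_free (Mem s t) = (Ct \<notin> {s, t})"
| "t_free (Neg a) = t_free a"
| "t_free (Imp a b) = (t_free a \<and> t_free b)"
| "t_free (All x a) = t_free a"

definition substt :: "nat \<Rightarrow> tm \<Rightarrow> tm \<Rightarrow> tm" where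
  "substt x u s = (if s = Var x then u else s)"

primrec subst :: "nat \<Rightarrow> tm \<Rightarrow> fm \<Rightarrow> fm" where
  "subst x u (Eq s t) = Eq (substt x u s) (substt x u t)"
| "subst x u (Mem s t) = Mem (substt x u s) (substt x u t)"
| "subst x u (Neg a) = Neg (subst x u a)"
| "subst x u (Imp a b) = Imp (subst x u a) (subst x u b)"
| "subst x u (All y a) = All y (if y = x then a else subst x u a)"

primrec free_for :: "tm \<Rightarrow> nat \<Rightarrow> fm \<Rightarrow> bool" where
  "free_for u x (Eq s t) = True"
| "free_for u x (Mem s t) = True"
| "free_for u x (Neg a) = free_for u x a"
| "free_for u x (Imp a b) = (free_for u x a \<and> free_for u x b)"
| "free_for u x (All y a) = (x \<notin> fv (All y a) \<or> (u \<noteq> Var y \<and> free_for u x a))"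


section \<open>Set-theoretic notions as formulas\<close>

text \<open>
  Quantifiers binding a variable that is fresh for the terms in the list \<open>ps\<close>.  The list has to
  contain every term occurring free in the body, apart from the bound variable itself.
\<close>

primrec idx :: "tm \<Rightarrow> nat" where "idx (Var n) = Suc n" | "idx Ct = 0"

definition fresh :: "tm list \<Rightarrow> nat" where "fresh ps = foldr max (map idx ps) 0"

definition all :: "tm list \<Rightarrow> (tm \<Rightarrow> fm) \<Rightarrow> fm" where
  "all ps F = All (fresh ps) (F (Var (fresh ps)))"

definition ex :: "tm list \<Rightarrow> (tm \<Rightarrow> fm) \<Rightarrow> fm" where
  "ex ps F = Ex (fresh ps) (F (Var (fresh ps)))"

definition all2 :: "tm list \<Rightarrow> (tm \<Rightarrow> tm \<Rightarrow> fm) \<Rightarrow> fm" where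
  "all2 ps F = all ps (\<lambda>x. all (x # ps) (F x))"
definition all3 :: "tm list \<Rightarrow> (tm \<Rightarrow> tm \<Rightarrow> tm \<Rightarrow> fm) \<Rightarrow> fm" where
  "all3 ps F = all ps (\<lambda>x. all2 (x # ps) (F x))"
definition ex2 :: "tm list \<Rightarrow> (tm \<Rightarrow> tm \<Rightarrow> fm) \<Rightarrow> fm" where
  "ex2 ps F = ex ps (\<lambda>x. ex (x # ps) (F x))"
definition ex3 :: "tm list \<Rightarrow> (tm \<Rightarrow> tm \<Rightarrow> tm \<Rightarrow> fm) \<Rightarrow> fm" where
  "ex3 ps F = ex ps (\<lambda>x. ex2 (x # ps) (F x))"
definition ex4 :: "tm list \<Rightarrow> (tm \<Rightarrow> tm \<Rightarrow> tm \<Rightarrow> tm \<Rightarrow> fm) \<Rightarrow> fm" where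
  "ex4 ps F = ex ps (\<lambda>x. ex3 (x # ps) (F x))"

definition ex1 :: "tm list \<Rightarrow> (tm \<Rightarrow> fm) \<Rightarrow> fm" where
  "ex1 ps F = ex ps (\<lambda>y. all (y # ps) (\<lambda>z. Iff (F z) (Eq z y)))"

definition sub_fm :: "tm \<Rightarrow> tm \<Rightarrow> fm" where
  "sub_fm x y = all [x, y] (\<lambda>z. Imp (Mem z x) (Mem z y))"

definition empty_fm :: "tm \<Rightarrow> fm" where
  "empty_fm x = all [x] (\<lambda>z. Neg (Mem z x))"

definition succ_fm :: "tm \<Rightarrow> tm \<Rightarrow> fm" where \<comment> \<open>\<open>y = x \<union> {x}\<close>\<close>
  "succ_fm x y = all [x, y] (\<lambda>z. Iff (Mem z y) (Or (Mem z x) (Eq z x)))"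

definition upair_fm :: "tm \<Rightarrow> tm \<Rightarrow> tm \<Rightarrow> fm" where \<comment> \<open>\<open>p = {x, y}\<close>\<close>
  "upair_fm x y p = all [x, y, p] (\<lambda>z. Iff (Mem z p) (Or (Eq z x) (Eq z y)))"

definition pair_fm :: "tm \<Rightarrow> tm \<Rightarrow> tm \<Rightarrow> fm" where \<comment> \<open>\<open>p = (x, y) = {{x}, {x, y}}\<close>\<close>
  "pair_fm x y p = ex2 [x, y, p] (\<lambda>a b.
     And (upair_fm x x a) (And (upair_fm x y b) (upair_fm a b p)))"

definition inductive_fm :: "tm \<Rightarrow> fm" where
  "inductive_fm w = And
     (ex [w] (\<lambda>z. And (empty_fm z) (Mem z w)))
     (all [w] (\<lambda>x. Imp (Mem x w) (ex [x, w] (\<lambda>y. And (succ_fm x y) (Mem y w)))))"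

definition nat_fm :: "tm \<Rightarrow> fm" where \<comment> \<open>\<open>n \<in> \<omega>\<close>\<close>
  "nat_fm n = all [n] (\<lambda>w. Imp (inductive_fm w) (Mem n w))"

definition app_fm :: "tm \<Rightarrow> tm \<Rightarrow> tm \<Rightarrow> fm" where \<comment> \<open>\<open>f(x) = y\<close>, for a function \<open>f\<close>\<close>
  "app_fm f x y = ex [f, x, y] (\<lambda>p. And (pair_fm x y p) (Mem p f))"

definition seq_fm :: "tm \<Rightarrow> tm \<Rightarrow> fm" where
    \<comment> \<open>\<open>f\<close> is a finite sequence of length \<open>n\<close>, i.e. a function with domain \<open>n \<in> \<omega>\<close>\<close>
  "seq_fm f n = And (nat_fm n) (And
     (all [f, n] (\<lambda>p. Imp (Mem p f) (ex2 [f, n, p] (\<lambda>i y. And (Mem i n) (pair_fm i y p)))))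
     (all [f, n] (\<lambda>i. Imp (Mem i n) (ex1 [f, n, i] (\<lambda>y. app_fm f i y)))))"

text \<open>
  \<open>numv k x y\<close> says that the variable \<open>x\<close> is the \<open>k\<close>-th von Neumann numeral, using only
  \<open>x\<close>, \<open>y\<close> and one further bound variable, so that \<open>numv (Suc k) x y\<close> arises from
  \<open>numv k x y\<close> by filling a fixed context.
\<close>

primrec numv :: "nat \<Rightarrow> nat \<Rightarrow> nat \<Rightarrow> fm" where
  "numv 0 x y = All y (Neg (Mem (Var y) (Var x)))"
| "numv (Suc k) x y = Ex y (And (succ_fm (Var y) (Var x))
                        (Ex x (And (Eq (Var x) (Var y)) (numv k x y))))"

definition num_fm :: "nat \<Rightarrow> tm \<Rightarrow> fm" where \<comment> \<open>\<open>u\<close> is the \<open>k\<close>-th numeral\<close>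
  "num_fm k u = (let x = fresh [u] in Ex x (And (Eq (Var x) u) (numv k x (Suc x))))"

definition one_of_fm :: "nat list \<Rightarrow> tm \<Rightarrow> fm" where
  "one_of_fm ks x = Disj (map (\<lambda>k. num_fm k x) ks)"

primrec add_fm :: "nat \<Rightarrow> tm \<Rightarrow> tm \<Rightarrow> fm" where \<comment> \<open>\<open>m = k + d\<close>\<close>
  "add_fm 0 k m = Eq m k"
| "add_fm (Suc d) k m = ex [k, m] (\<lambda>p. And (add_fm d k p) (succ_fm p m))"

definition entry_fm :: "tm \<Rightarrow> nat \<Rightarrow> tm \<Rightarrow> fm" where \<comment> \<open>the \<open>n\<close>-th entry of \<open>f\<close> is \<open>y\<close>\<close>
  "entry_fm f n y = ex [f, y] (\<lambda>i. And (num_fm n i) (app_fm f i y))"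

definition length_fm :: "tm \<Rightarrow> nat \<Rightarrow> fm" where \<comment> \<open>\<open>f\<close> is a sequence of length \<open>n\<close>\<close>
  "length_fm f n = ex [f] (\<lambda>d. And (num_fm n d) (seq_fm f d))"


section \<open>ZFC and proofs\<close>

inductive logical_axiom :: "fm \<Rightarrow> bool" where
  "logical_axiom (Imp a (Imp b a))"
| "logical_axiom (Imp (Imp a (Imp b c)) (Imp (Imp a b) (Imp a c)))"
| "logical_axiom (Imp (Imp (Neg a) (Neg b)) (Imp b a))"
| "free_for u x a \<Longrightarrow> logical_axiom (Imp (All x a) (subst x u a))"
| "x \<notin> fv a \<Longrightarrow> logical_axiom (Imp (All x (Imp a b)) (Imp a (All x b)))"
| "logical_axiom (Eq s s)"
| "logical_axiom (Imp (Eq s t) (Imp (Eq s u) (Eq t u)))"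
| "logical_axiom (Imp (Eq s t) (Imp (Mem s u) (Mem t u)))"
| "logical_axiom (Imp (Eq s t) (Imp (Mem u s) (Mem u t)))"

definition zfc_single :: "fm list" where
  "zfc_single =
   [\<comment> \<open>extensionality\<close>
    all2 [] (\<lambda>x y. Imp (all [x, y] (\<lambda>z. Iff (Mem z x) (Mem z y))) (Eq x y)),
    \<comment> \<open>pairing\<close>
    all2 [] (\<lambda>x y. ex [x, y] (\<lambda>z. upair_fm x y z)),
    \<comment> \<open>union\<close>
    all [] (\<lambda>x. ex [x] (\<lambda>y. all [x, y] (\<lambda>z.
      Iff (Mem z y) (ex [x, y, z] (\<lambda>w. And (Mem z w) (Mem w x)))))),
    \<comment> \<open>power set\<close>
    all [] (\<lambda>x. ex [x] (\<lambda>y. all [x, y] (\<lambda>z. Iff (Mem z y) (sub_fm z x)))),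
    \<comment> \<open>infinity\<close>
    ex [] inductive_fm,
    \<comment> \<open>foundation\<close>
    all [] (\<lambda>x. Imp (ex [x] (\<lambda>y. Mem y x))
      (ex [x] (\<lambda>y. And (Mem y x) (Neg (ex [x, y] (\<lambda>z. And (Mem z x) (Mem z y))))))),
    \<comment> \<open>choice: a disjoint family of nonempty sets has a transversal\<close>
    all [] (\<lambda>x. Imp
      (And (all [x] (\<lambda>y. Imp (Mem y x) (ex [x, y] (\<lambda>z. Mem z y))))
           (all2 [x] (\<lambda>y z. Imp (And (Mem y x) (And (Mem z x) (Neg (Eq y z))))
              (Neg (ex [x, y, z] (\<lambda>w. And (Mem w y) (Mem w z)))))))
      (ex [x] (\<lambda>c. all [x, c] (\<lambda>y. Imp (Mem y x)
        (ex1 [x, c, y] (\<lambda>z. And (Mem z y) (Mem z c)))))))]"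

text \<open>
  The schemas may have parameters, and, as usual for the theory in the extended language, the
  constant \<open>t\<close> may occur in them.
\<close>

inductive zfc_axiom :: "fm \<Rightarrow> bool" where
  single: "a \<in> set zfc_single \<Longrightarrow> zfc_axiom a"
| separation: "distinct [x, y, z] \<Longrightarrow> y \<notin> fv a \<Longrightarrow>
    zfc_axiom (Ex y (All x (Iff (Mem (Var x) (Var y)) (And (Mem (Var x) (Var z)) a))))"
| replacement: "distinct [x, y, z, u] \<Longrightarrow> u \<notin> fv a \<Longrightarrow>
    zfc_axiom (Imp
      (All x (Imp (Mem (Var x) (Var z)) (Ex u (All y (Imp a (Eq (Var y) (Var u)))))))
      (Ex u (All y (Iff (Mem (Var y) (Var u)) (Ex x (And (Mem (Var x) (Var z)) a))))))"

text \<open>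
  \<open>Gen_J j k\<close> records \<open>\<phi>\<^sub>i = \<forall>x\<^sub>k \<phi>\<^sub>j\<close>; \<open>MP_J j k\<close> records \<open>\<phi>\<^sub>j = (\<phi>\<^sub>k \<rightarrow> \<phi>\<^sub>i)\<close>.
\<close>

datatype justification = Log_J | ZFC_J | Thy_J | MP_J nat nat | Gen_J nat nat

text \<open>A theory with an algorithm deciding membership in it.\<close>

type_synonym rec_theory = "fm set \<times> (fm \<Rightarrow> bool)"

fun justifies :: "rec_theory \<Rightarrow> fm list \<Rightarrow> nat \<Rightarrow> justification \<Rightarrow> bool" where
  "justifies (T, al) \<pi> i Log_J = logical_axiom (\<pi> ! i)"
| "justifies (T, al) \<pi> i ZFC_J = zfc_axiom (\<pi> ! i)"
| "justifies (T, al) \<pi> i Thy_J = (\<pi> ! i \<in> T)"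
| "justifies (T, al) \<pi> i (MP_J j k) = (j < i \<and> k < i \<and> \<pi> ! j = Imp (\<pi> ! k) (\<pi> ! i))"
| "justifies (T, al) \<pi> i (Gen_J j k) = (j < i \<and> \<pi> ! i = All k (\<pi> ! j))"

definition proves :: "rec_theory \<Rightarrow> fm list \<Rightarrow> fm \<Rightarrow> bool" where
  "proves T \<pi> a \<longleftrightarrow> \<pi> \<noteq> [] \<and> last \<pi> = a \<and> (\<forall>i < length \<pi>. \<exists>J. justifies T \<pi> i J)"

definition recorded :: "rec_theory \<Rightarrow> fm list \<Rightarrow> justification list \<Rightarrow> bool" where
  "recorded T \<pi> Js \<longleftrightarrow> length Js = length \<pi> \<and> (\<forall>i < length \<pi>. justifies T \<pi> i (Js ! i))"

text \<open>Provability in ZFC itself, i.e. in the language without the constant \<open>t\<close>.\<close>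

definition zfc_provable :: "fm \<Rightarrow> bool" where
  "zfc_provable a \<longleftrightarrow> (\<exists>\<pi>. proves ({}, \<lambda>_. False) \<pi> a \<and> (\<forall>b \<in> set \<pi>. t_free b))"


section \<open>Turing machines\<close>

datatype sym = Zero | One | Blank | Start
datatype move = Lft | Stay | Rgt

record turing =
  states :: "nat set"
  delta :: "nat \<Rightarrow> sym \<Rightarrow> nat \<times> sym \<times> move"
  init :: nat
  halt :: nat

definition turing_machine :: "turing \<Rightarrow> bool" where
  "turing_machine M \<longleftrightarrow> finite (states M) \<and> init M \<in> states M \<and> halt M \<in> states M \<and>
     (\<forall>q \<in> states M. \<forall>a. fst (delta M q a) \<in> states M)"

definition bit_sym :: "bool \<Rightarrow> sym" where "bit_sym b = (if b then One else Zero)"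

fun new_pos :: "move \<Rightarrow> nat \<Rightarrow> nat" where
  "new_pos Lft j = j - 1"
| "new_pos Stay j = j"
| "new_pos Rgt j = Suc j"

text \<open>Configurations: tape contents, state, head position.\<close>

definition init_config :: "turing \<Rightarrow> bool list \<Rightarrow> (nat \<Rightarrow> sym) \<times> nat \<times> nat" where
  "init_config M s =
     ((\<lambda>j. if j = 0 then Start else if j \<le> length s then bit_sym (s ! (j - 1)) else Blank), init M, 0)"

definition step :: "turing \<Rightarrow> (nat \<Rightarrow> sym) \<times> nat \<times> nat \<Rightarrow> (nat \<Rightarrow> sym) \<times> nat \<times> nat" where
  "step M = (\<lambda>(f, q, j). if q = halt M then (f, q, j)
     else (case delta M q (f j) of (q', a, d) \<Rightarrow> (f(j := a), q', new_pos d j)))"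

definition table :: "turing \<Rightarrow> bool list \<Rightarrow> nat \<Rightarrow> nat \<Rightarrow> sym \<times> nat \<times> bool" where
  "table M s i j = (case (step M ^^ i) (init_config M s) of (f, q, h) \<Rightarrow> (f j, q, j = h))"

definition outputs_1 :: "turing \<Rightarrow> bool list \<Rightarrow> bool" where
  "outputs_1 M s \<longleftrightarrow> (\<exists>i. table M s i 1 = (One, halt M, True))"


section \<open>Formalization of computations\<close>

text \<open>Symbols and states are represented by numerals.\<close>

fun sym_num :: "sym \<Rightarrow> nat" where
  "sym_num Zero = 0" | "sym_num One = 1" | "sym_num Blank = 2" | "sym_num Start = 3"

definition triple_fm :: "tm \<Rightarrow> tm \<Rightarrow> tm \<Rightarrow> tm \<Rightarrow> fm" where \<comment> \<open>\<open>v = (a, q, h)\<close>\<close>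
  "triple_fm a q h v = ex [a, q, h, v] (\<lambda>w. And (pair_fm q h w) (pair_fm a w v))"

definition tab_fm :: "tm \<Rightarrow> tm \<Rightarrow> tm \<Rightarrow> tm \<Rightarrow> fm" where \<comment> \<open>\<open>t\<^sub>i\<^sub>,\<^sub>j = v\<close>\<close>
  "tab_fm t i j v = ex [t, i, j, v] (\<lambda>p. And (pair_fm i j p) (app_fm t p v))"

definition cell_fm :: "tm \<Rightarrow> tm \<Rightarrow> tm \<Rightarrow> tm \<Rightarrow> tm \<Rightarrow> tm \<Rightarrow> fm" where \<comment> \<open>\<open>t\<^sub>i\<^sub>,\<^sub>j = (a, q, h)\<close>\<close>
  "cell_fm t i j a q h =
     ex [t, i, j, a, q, h] (\<lambda>v. And (triple_fm a q h v) (tab_fm t i j v))"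

text \<open>
  As \<open>cell_fm\<close>, with the numerals for a given symbol, state and head flag.
\<close>

definition ncell_fm :: "tm \<Rightarrow> tm \<Rightarrow> tm \<Rightarrow> sym \<Rightarrow> nat \<Rightarrow> nat \<Rightarrow> fm" where
  "ncell_fm t i j a q h = ex3 [t, i, j] (\<lambda>x y z.
     Conj [num_fm (sym_num a) x, num_fm q y, num_fm h z, cell_fm t i j x y z])"

definition value_fm :: "turing \<Rightarrow> tm \<Rightarrow> fm" where \<comment> \<open>\<open>v \<in> \<Gamma> \<times> Q \<times> {0,1}\<close>\<close>
  "value_fm M v = ex3 [v] (\<lambda>a q h. Conj [triple_fm a q h v, one_of_fm [0, 1, 2, 3] a,
     one_of_fm (sorted_list_of_set (states M)) q, one_of_fm [0, 1] h])"

fun move_fm :: "move \<Rightarrow> tm \<Rightarrow> tm \<Rightarrow> fm" where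
  "move_fm Lft j j' = Or (succ_fm j' j) (And (empty_fm j) (empty_fm j'))"
| "move_fm Stay j j' = Eq j' j"
| "move_fm Rgt j j' = succ_fm j j'"

text \<open>
  The transition for state \<open>q \<noteq> q\<^sub>h\<^sub>a\<^sub>l\<^sub>t\<close> and scanned symbol \<open>a\<close>: if the head is at \<open>j\<close> at time
  \<open>i\<close>, with state \<open>q\<close> and symbol \<open>a\<close>, and if cell \<open>k\<close> contains \<open>b\<close> at time \<open>i\<close>, then at time
  \<open>i + 1\<close> it contains \<open>c\<close> (which is \<open>a'\<close> for \<open>k = j\<close>, and \<open>b\<close> otherwise), with the new state, and
  with the flag \<open>g\<close> that says whether \<open>k\<close> is the new head position \<open>j'\<close>.
\<close>

definition trans_fm :: "turing \<Rightarrow> tm \<Rightarrow> nat \<Rightarrow> sym \<Rightarrow> fm" where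
  "trans_fm M t q a = (case delta M q a of (q', a', d) \<Rightarrow>
     all2 [t] (\<lambda>i j. Imp (ncell_fm t i j a q 1)
       (all3 [t, i, j] (\<lambda>i' j' k. all3 [t, i, j, i', j', k] (\<lambda>b p h.
          Imp (Conj [succ_fm i i', move_fm d j j', cell_fm t i k b p h])
            (ex3 [t, i, j, i', j', k, b, p, h] (\<lambda>c r g. Conj
              [Or (And (Eq k j) (num_fm (sym_num a') c)) (And (Neg (Eq k j)) (Eq c b)),
               num_fm q' r,
               Or (And (Eq k j') (num_fm 1 g)) (And (Neg (Eq k j')) (num_fm 0 g)),
               cell_fm t i' k c r g])))))))"

definition halt_fm :: "turing \<Rightarrow> tm \<Rightarrow> sym \<Rightarrow> fm" where
  "halt_fm M t a = all2 [t] (\<lambda>i j. Imp (ncell_fm t i j a (halt M) 1)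
     (all3 [t, i, j] (\<lambda>i' k v. Imp (And (succ_fm i i') (tab_fm t i k v)) (tab_fm t i' k v))))"

text \<open>\<open>t\<close> is a function from \<open>\<omega> \<times> \<omega>\<close> to \<open>\<Gamma> \<times> Q \<times> {0,1}\<close>, and obeys the transitions.\<close>

definition def_fms :: "turing \<Rightarrow> tm \<Rightarrow> fm list" where
  "def_fms M t =
   [all [t] (\<lambda>e. Imp (Mem e t) (ex4 [t, e] (\<lambda>i j v p. Conj
      [nat_fm i, nat_fm j, value_fm M v, pair_fm i j p, pair_fm p v e]))),
    all2 [t] (\<lambda>i j. Imp (And (nat_fm i) (nat_fm j)) (ex1 [t, i, j] (\<lambda>v. tab_fm t i j v)))] @
   map (halt_fm M t) [Zero, One, Blank, Start] @
   concat (map (\<lambda>q. map (trans_fm M t q) [Zero, One, Blank, Start])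
     (sorted_list_of_set (states M - {halt M})))"

definition init_cell_fm :: "turing \<Rightarrow> tm \<Rightarrow> tm \<Rightarrow> sym \<Rightarrow> nat \<Rightarrow> fm" where
    \<comment> \<open>\<open>t\<^sub>0\<^sub>,\<^sub>j = (a, q\<^sub>0, h)\<close>\<close>
  "init_cell_fm M t j a h = ex [t, j] (\<lambda>z. And (num_fm 0 z) (ncell_fm t z j a (init M) h))"

definition blank_fm :: "turing \<Rightarrow> tm \<Rightarrow> tm \<Rightarrow> fm" where
    \<comment> \<open>\<open>\<forall>j (j > l \<rightarrow> t\<^sub>0\<^sub>,\<^sub>j = (\<squnion>, q\<^sub>0, 0))\<close>\<close>
  "blank_fm M t l = all [t, l] (\<lambda>j.
     Imp (And (nat_fm j) (Mem l j)) (init_cell_fm M t j Blank 0))"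

text \<open>
  The formulas of the input sequence mention exactly one numeral that depends on the input; it
  is introduced as the value of the variable \<open>x\<^sub>0\<close> by an outermost existential quantifier.
\<close>

definition with_num :: "nat \<Rightarrow> fm \<Rightarrow> fm" where
  "with_num k a = Ex 0 (And (numv k 0 1) a)"

definition input_fms :: "turing \<Rightarrow> tm \<Rightarrow> bool list \<Rightarrow> fm list" where
  "input_fms M t s =
     [with_num (length s) (blank_fm M t (Var 0)),
      with_num 0 (init_cell_fm M t (Var 0) Start 1)] @
     map (\<lambda>k. with_num (Suc k) (init_cell_fm M t (Var 0) (bit_sym (s ! k)) 0)) [0..<length s]"

definition Thy :: "turing \<Rightarrow> bool list \<Rightarrow> fm list" where
  "Thy M s = def_fms M Ct @ input_fms M Ct s"

primrec AL :: "fm list \<Rightarrow> fm \<Rightarrow> bool" where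
  "AL [] a = False"
| "AL (b # bs) a = (if b = a then True else AL bs a)"

lemma AL_iff: "AL bs a \<longleftrightarrow> a \<in> set bs"
  by (induction bs) auto

definition Thy_AL :: "turing \<Rightarrow> bool list \<Rightarrow> rec_theory" where
  "Thy_AL M s = (set (Thy M s), AL (Thy M s))"

definition out_fm :: "turing \<Rightarrow> tm \<Rightarrow> fm" where \<comment> \<open>\<open>\<exists>i. t\<^sub>i\<^sub>,\<^sub>1 = (1, q\<^sub>h\<^sub>a\<^sub>l\<^sub>t, 1)\<close>\<close>
  "out_fm M t = ex2 [t] (\<lambda>i j. Conj [nat_fm i, num_fm 1 j, ncell_fm t i j One (halt M) 1])"

definition normal_proof :: "turing \<Rightarrow> bool list \<Rightarrow> fm list \<Rightarrow> bool" where
  "normal_proof M r \<pi> \<longleftrightarrow> proves (Thy_AL M r) \<pi> (out_fm M Ct)"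


section \<open>Syntax inside set theory\<close>

text \<open>
  Terms and formulas are coded by sets: \<open>x\<^sub>n\<close> by \<open>(0, n)\<close>, the constant \<open>t\<close> by \<open>(1, 0)\<close>, and
  equations, membership, negation, implication and quantification by pairs with first component
  \<open>0, \<dots>, 4\<close>.  In all of the following, the last argument is the code.
\<close>

definition tag_fm :: "nat \<Rightarrow> tm \<Rightarrow> tm \<Rightarrow> fm" where
  "tag_fm k a c = ex [a, c] (\<lambda>z. And (num_fm k z) (pair_fm z a c))"

definition tag2_fm :: "nat \<Rightarrow> tm \<Rightarrow> tm \<Rightarrow> tm \<Rightarrow> fm" where
  "tag2_fm k a b c = ex [a, b, c] (\<lambda>p. And (pair_fm a b p) (tag_fm k p c))"

definition cVar :: "tm \<Rightarrow> tm \<Rightarrow> fm" where "cVar n c = tag_fm 0 n c"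
definition cCt :: "tm \<Rightarrow> fm" where "cCt c = ex [c] (\<lambda>z. And (num_fm 0 z) (tag_fm 1 z c))"
definition cEq :: "tm \<Rightarrow> tm \<Rightarrow> tm \<Rightarrow> fm" where "cEq = tag2_fm 0"
definition cMem :: "tm \<Rightarrow> tm \<Rightarrow> tm \<Rightarrow> fm" where "cMem = tag2_fm 1"
definition cNeg :: "tm \<Rightarrow> tm \<Rightarrow> fm" where "cNeg = tag_fm 2"
definition cImp :: "tm \<Rightarrow> tm \<Rightarrow> tm \<Rightarrow> fm" where "cImp = tag2_fm 3"
definition cAll :: "tm \<Rightarrow> tm \<Rightarrow> tm \<Rightarrow> fm" where "cAll = tag2_fm 4"

text \<open>\<open>code_fm a c\<close>: \<open>c\<close> is the code of the given formula \<open>a\<close>.\<close>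

primrec code_tm :: "tm \<Rightarrow> tm \<Rightarrow> fm" where
  "code_tm (Var n) c = ex [c] (\<lambda>x. And (num_fm n x) (cVar x c))"
| "code_tm Ct c = cCt c"

primrec code_fm :: "fm \<Rightarrow> tm \<Rightarrow> fm" where
  "code_fm (Eq s t) c = ex2 [c] (\<lambda>x y. Conj [code_tm s x, code_tm t y, cEq x y c])"
| "code_fm (Mem s t) c = ex2 [c] (\<lambda>x y. Conj [code_tm s x, code_tm t y, cMem x y c])"
| "code_fm (Neg a) c = ex [c] (\<lambda>x. And (code_fm a x) (cNeg x c))"
| "code_fm (Imp a b) c = ex2 [c] (\<lambda>x y. Conj [code_fm a x, code_fm b y, cImp x y c])"
| "code_fm (All n a) c = ex2 [c] (\<lambda>x y. Conj [num_fm n x, code_fm a y, cAll x y c])"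

text \<open>
  Formula schemes, with metavariables \<open>FH k\<close> for formulas, \<open>TH k\<close> for terms and \<open>VH k\<close> for
  variables; the first argument of \<open>PAll\<close> is the number of a metavariable for variables.
  \<open>scheme_fm Fs Vs Ts p c\<close> says that \<open>c\<close> is the code of the instance of \<open>p\<close> given by the codes
  of formulas \<open>Fs\<close>, the indices of variables \<open>Vs\<close> and the codes of terms \<open>Ts\<close>.
\<close>

datatype stm = TH nat | VH nat
datatype scheme = FH nat | PFm fm | PEq stm stm | PMem stm stm | PNeg scheme
  | PImp scheme scheme | PAll nat scheme

definition "PAnd p q = PNeg (PImp p (PNeg q))"
definition "PIff p q = PAnd (PImp p q) (PImp q p)"
definition "PEx v p = PNeg (PAll v (PNeg p))"

fun scheme_tm :: "tm list \<Rightarrow> tm list \<Rightarrow> stm \<Rightarrow> tm \<Rightarrow> fm" where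
  "scheme_tm Vs Ts (TH k) c = Eq c (Ts ! k)"
| "scheme_tm Vs Ts (VH k) c = cVar (Vs ! k) c"

primrec scheme_fm :: "tm list \<Rightarrow> tm list \<Rightarrow> tm list \<Rightarrow> scheme \<Rightarrow> tm \<Rightarrow> fm" where
  "scheme_fm Fs Vs Ts (FH k) c = Eq c (Fs ! k)"
| "scheme_fm Fs Vs Ts (PFm a) c = code_fm a c"
| "scheme_fm Fs Vs Ts (PEq s t) c = ex2 (c # Fs @ Vs @ Ts) (\<lambda>x y.
     Conj [scheme_tm Vs Ts s x, scheme_tm Vs Ts t y, cEq x y c])"
| "scheme_fm Fs Vs Ts (PMem s t) c = ex2 (c # Fs @ Vs @ Ts) (\<lambda>x y.
     Conj [scheme_tm Vs Ts s x, scheme_tm Vs Ts t y, cMem x y c])"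
| "scheme_fm Fs Vs Ts (PNeg p) c = ex (c # Fs @ Vs @ Ts) (\<lambda>x.
     And (scheme_fm Fs Vs Ts p x) (cNeg x c))"
| "scheme_fm Fs Vs Ts (PImp p q) c = ex2 (c # Fs @ Vs @ Ts) (\<lambda>x y.
     Conj [scheme_fm Fs Vs Ts p x, scheme_fm Fs Vs Ts q y, cImp x y c])"
| "scheme_fm Fs Vs Ts (PAll k p) c = ex (c # Fs @ Vs @ Ts) (\<lambda>x.
     And (scheme_fm Fs Vs Ts p x) (cAll (Vs ! k) x c))"

text \<open>
  Inductive definitions: \<open>x\<close> is the last entry of a finite sequence \<open>f\<close>, every entry \<open>y = f(i)\<close>
  of which satisfies \<open>F f i y\<close>.  The parameters occurring in \<open>F\<close> are listed in \<open>ps\<close>.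
\<close>

definition deriv_fm :: "tm list \<Rightarrow> (tm \<Rightarrow> tm \<Rightarrow> tm \<Rightarrow> fm) \<Rightarrow> tm \<Rightarrow> fm" where
  "deriv_fm ps F x = ex3 (x # ps) (\<lambda>n m f. Conj
     [succ_fm n m, seq_fm f m, app_fm f n x,
      all2 (n # m # f # x # ps) (\<lambda>i y. Imp (And (Mem i m) (app_fm f i y)) (F f i y))])"

definition prev_fm :: "tm \<Rightarrow> tm \<Rightarrow> tm \<Rightarrow> fm" where
  "prev_fm f i y = ex [f, i, y] (\<lambda>j. And (Mem j i) (app_fm f j y))"

definition is_tm_fm :: "tm \<Rightarrow> fm" where
  "is_tm_fm c = Or (ex [c] (\<lambda>n. And (nat_fm n) (cVar n c))) (cCt c)"

definition is_fm_fm :: "tm \<Rightarrow> fm" where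
  "is_fm_fm = deriv_fm [] (\<lambda>f i y. Disj
    [ex2 [f, i, y] (\<lambda>a b. Conj [is_tm_fm a, is_tm_fm b, Or (cEq a b y) (cMem a b y)]),
     ex [f, i, y] (\<lambda>a. And (prev_fm f i a) (cNeg a y)),
     ex2 [f, i, y] (\<lambda>a b. Conj [prev_fm f i a, prev_fm f i b, cImp a b y]),
     ex2 [f, i, y] (\<lambda>n a. Conj [nat_fm n, prev_fm f i a, cAll n a y])])"

definition not_free_fm :: "tm \<Rightarrow> tm \<Rightarrow> fm" where \<comment> \<open>\<open>x\<^sub>v\<close> is not free in the formula \<open>c\<close>\<close>
  "not_free_fm v = deriv_fm [v] (\<lambda>f i y. Disj
    [ex2 [v, f, i, y] (\<lambda>a b. Conj [is_tm_fm a, is_tm_fm b, Neg (cVar v a), Neg (cVar v b),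
       Or (cEq a b y) (cMem a b y)]),
     ex [v, f, i, y] (\<lambda>a. And (prev_fm f i a) (cNeg a y)),
     ex2 [v, f, i, y] (\<lambda>a b. Conj [prev_fm f i a, prev_fm f i b, cImp a b y]),
     ex2 [v, f, i, y] (\<lambda>n a. Conj [nat_fm n, prev_fm f i a, cAll n a y]),
     ex [v, f, i, y] (\<lambda>a. And (is_fm_fm a) (cAll v a y))])"

definition subst_tm_fm :: "tm \<Rightarrow> tm \<Rightarrow> tm \<Rightarrow> tm \<Rightarrow> fm" where
  "subst_tm_fm v u a b = And (is_tm_fm a)
     (Or (And (cVar v a) (Eq b u)) (And (Neg (cVar v a)) (Eq b a)))"

text \<open>
  \<open>b\<close> is the result of substituting the term \<open>u\<close> for \<open>x\<^sub>v\<close> in the formula \<open>a\<close>, and \<open>u\<close> is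
  free for \<open>x\<^sub>v\<close> in \<open>a\<close>.  The entries of the derivation are pairs \<open>(a, b)\<close>.
\<close>

definition subst_fm :: "tm \<Rightarrow> tm \<Rightarrow> tm \<Rightarrow> tm \<Rightarrow> fm" where
  "subst_fm v u a b = ex [v, u, a, b] (\<lambda>c. And (pair_fm a b c) (deriv_fm [v, u] (\<lambda>f i y.
     ex2 [v, u, f, i, y] (\<lambda>a b. And (pair_fm a b y) (Disj
      [ex4 [v, u, f, i, a, b] (\<lambda>a1 a2 b1 b2. Conj
         [subst_tm_fm v u a1 b1, subst_tm_fm v u a2 b2,
          Or (And (cEq a1 a2 a) (cEq b1 b2 b)) (And (cMem a1 a2 a) (cMem b1 b2 b))]),
       ex3 [v, u, f, i, a, b] (\<lambda>a1 b1 p. Conj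
         [pair_fm a1 b1 p, prev_fm f i p, cNeg a1 a, cNeg b1 b]),
       ex4 [v, u, f, i, a, b] (\<lambda>a1 a2 b1 b2. ex2 [v, u, f, i, a, b, a1, a2, b1, b2] (\<lambda>p q. Conj
         [pair_fm a1 b1 p, prev_fm f i p, pair_fm a2 b2 q, prev_fm f i q,
          cImp a1 a2 a, cImp b1 b2 b])),
       And (not_free_fm v a) (Eq b a),
       ex4 [v, u, f, i, a, b] (\<lambda>n a1 b1 p. Conj
         [nat_fm n, Neg (Eq n v), Neg (cVar n u), pair_fm a1 b1 p, prev_fm f i p,
          cAll n a1 a, cAll n b1 b])]))) c))"

definition prop_schemes :: "scheme list" where
  "prop_schemes =
   [PImp (FH 0) (PImp (FH 1) (FH 0)),
    PImp (PImp (FH 0) (PImp (FH 1) (FH 2))) (PImp (PImp (FH 0) (FH 1)) (PImp (FH 0) (FH 2))),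
    PImp (PImp (PNeg (FH 0)) (PNeg (FH 1))) (PImp (FH 1) (FH 0))]"

definition eq_schemes :: "scheme list" where
  "eq_schemes =
   [PEq (TH 0) (TH 0),
    PImp (PEq (TH 0) (TH 1)) (PImp (PEq (TH 0) (TH 2)) (PEq (TH 1) (TH 2))),
    PImp (PEq (TH 0) (TH 1)) (PImp (PMem (TH 0) (TH 2)) (PMem (TH 1) (TH 2))),
    PImp (PEq (TH 0) (TH 1)) (PImp (PMem (TH 2) (TH 0)) (PMem (TH 2) (TH 1)))]"

definition logical_axiom_fm :: "tm \<Rightarrow> fm" where
  "logical_axiom_fm x = Disj (
     map (\<lambda>p. ex3 [x] (\<lambda>a b c. Conj
       [is_fm_fm a, is_fm_fm b, is_fm_fm c, scheme_fm [a, b, c] [] [] p x])) prop_schemes @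
     map (\<lambda>p. ex3 [x] (\<lambda>s t u. Conj
       [is_tm_fm s, is_tm_fm t, is_tm_fm u, scheme_fm [] [] [s, t, u] p x])) eq_schemes @
     [ex4 [x] (\<lambda>v u a b. Conj
       [nat_fm v, is_tm_fm u, is_fm_fm a, subst_fm v u a b,
        scheme_fm [a, b] [v] [] (PImp (PAll 0 (FH 0)) (FH 1)) x]),
      ex3 [x] (\<lambda>v a b. Conj
       [nat_fm v, is_fm_fm a, is_fm_fm b, not_free_fm v a,
        scheme_fm [a, b] [v] []
          (PImp (PAll 0 (PImp (FH 0) (FH 1))) (PImp (FH 0) (PAll 0 (FH 1)))) x])])"

definition separation_scheme :: scheme where
  "separation_scheme = PEx 1 (PAll 0 (PIff (PMem (VH 0) (VH 1)) (PAnd (PMem (VH 0) (VH 2)) (FH 0))))"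

definition replacement_scheme :: scheme where
  "replacement_scheme = PImp
     (PAll 0 (PImp (PMem (VH 0) (VH 2)) (PEx 3 (PAll 1 (PImp (FH 0) (PEq (VH 1) (VH 3)))))))
     (PEx 3 (PAll 1 (PIff (PMem (VH 1) (VH 3)) (PEx 0 (PAnd (PMem (VH 0) (VH 2)) (FH 0))))))"

definition zfc_axiom_fm :: "tm \<Rightarrow> fm" where
  "zfc_axiom_fm c = Disj (
     map (\<lambda>a. code_fm a c) zfc_single @
     [ex4 [c] (\<lambda>a x y z. Conj
       [is_fm_fm a, nat_fm x, nat_fm y, nat_fm z,
        Neg (Eq x y), Neg (Eq x z), Neg (Eq y z), not_free_fm y a,
        scheme_fm [a] [x, y, z] [] separation_scheme c]),
      ex4 [c] (\<lambda>a x y z. ex [c, a, x, y, z] (\<lambda>u. Conj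
       [is_fm_fm a, nat_fm x, nat_fm y, nat_fm z, nat_fm u,
        Neg (Eq x y), Neg (Eq x z), Neg (Eq y z), Neg (Eq x u), Neg (Eq y u), Neg (Eq z u),
        not_free_fm u a, scheme_fm [a] [x, y, z, u] [] replacement_scheme c]))])"


section \<open>The theories, the checker and the machine inside set theory\<close>

definition bool_val_fm :: "fm \<Rightarrow> tm \<Rightarrow> fm" where \<comment> \<open>\<open>v\<close> is \<open>1\<close> if \<open>a\<close> holds, and \<open>0\<close> otherwise\<close>
  "bool_val_fm a v = Or (And a (num_fm 1 v)) (And (Neg a) (num_fm 0 v))"

text \<open>
  \<open>AL_fm U y v\<close>: searching the finite sequence \<open>U\<close> for \<open>y\<close>, by comparison with the entries,
  returns \<open>v\<close>.
\<close>

definition AL_fm :: "tm \<Rightarrow> tm \<Rightarrow> tm \<Rightarrow> fm" where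
  "AL_fm U y v = bool_val_fm (ex [U, y] (\<lambda>k. app_fm U k y)) v"

text \<open>
  \<open>b U y v\<close> stands for: the algorithm \<open>b\<close>, asked whether \<open>y \<in> U\<close>, returns \<open>v\<close>.
\<close>

definition valid_fm ::
  "(tm \<Rightarrow> tm \<Rightarrow> tm \<Rightarrow> fm) \<Rightarrow> tm \<Rightarrow> tm \<Rightarrow> nat \<Rightarrow> justification \<Rightarrow> fm" where
  "valid_fm b U \<sigma> i J = ex [U, \<sigma>] (\<lambda>y. And (entry_fm \<sigma> i y) (case J of
     Log_J \<Rightarrow> logical_axiom_fm y
   | ZFC_J \<Rightarrow> zfc_axiom_fm y
   | Thy_J \<Rightarrow> ex [U, \<sigma>, y] (\<lambda>v. And (num_fm 1 v) (b U y v))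
   | MP_J j k \<Rightarrow> ex2 [U, \<sigma>, y] (\<lambda>c a. Conj [entry_fm \<sigma> j c, entry_fm \<sigma> k a, cImp a y c])
   | Gen_J j k \<Rightarrow> ex2 [U, \<sigma>, y] (\<lambda>a x. Conj [entry_fm \<sigma> j a, num_fm k x, cAll x a y])))"

text \<open>
  \<open>CK_fm Js b U \<sigma> v\<close>: the checker given by the recorded justifications \<open>Js\<close> returns \<open>v\<close> on
  input \<open>(\<langle>U, b\<rangle>, \<sigma>)\<close>.
\<close>

definition CK_fm ::
  "justification list \<Rightarrow> (tm \<Rightarrow> tm \<Rightarrow> tm \<Rightarrow> fm) \<Rightarrow> tm \<Rightarrow> tm \<Rightarrow> tm \<Rightarrow> fm" where
  "CK_fm Js b U \<sigma> v = bool_val_fm (And (length_fm \<sigma> (length Js))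
     (Conj (map (\<lambda>i. valid_fm b U \<sigma> i (Js ! i)) [0..<length Js]))) v"

definition code_seq_fm :: "fm list \<Rightarrow> tm \<Rightarrow> fm" where
  "code_seq_fm \<pi> p = And (length_fm p (length \<pi>))
     (Conj (map (\<lambda>i. ex [p] (\<lambda>y. And (entry_fm p i y) (code_fm (\<pi> ! i) y))) [0..<length \<pi>]))"

definition binary_fm :: "tm \<Rightarrow> tm \<Rightarrow> fm" where \<comment> \<open>\<open>s\<close> is a binary string of length \<open>l\<close>\<close>
  "binary_fm s l = And (seq_fm s l)
     (all2 [s, l] (\<lambda>k y. Imp (app_fm s k y) (one_of_fm [0, 1] y)))"

text \<open>\<open>num_code_fm k c\<close>: \<open>c\<close> is the code of \<open>numv k 0 1\<close>, where \<open>k\<close> is now a set.\<close>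

definition num_code_fm :: "tm \<Rightarrow> tm \<Rightarrow> fm" where
  "num_code_fm k c = ex2 [k, c] (\<lambda>m f. Conj
     [succ_fm k m, seq_fm f m, app_fm f k c,
      all2 [k, c, m, f] (\<lambda>i y. Imp (And (Mem i m) (app_fm f i y)) (Or
        (And (empty_fm i) (code_fm (numv 0 0 1) y))
        (ex4 [m, f, i, y] (\<lambda>j a x0 x1. Conj
          [succ_fm j i, app_fm f j a, num_fm 0 x0, num_fm 1 x1,
           scheme_fm [a] [x0, x1] []
             (PEx 1 (PAnd (PFm (succ_fm (Var 1) (Var 0)))
                (PEx 0 (PAnd (PFm (Eq (Var 0) (Var 1))) (FH 0))))) y]))))])"

text \<open>\<open>with_num_code_fm k a c\<close>: \<open>c\<close> is the code of \<open>with_num k a\<close>, where \<open>k\<close> is now a set.\<close>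

definition with_num_code_fm :: "tm \<Rightarrow> fm \<Rightarrow> tm \<Rightarrow> fm" where
  "with_num_code_fm k a c = ex2 [k, c] (\<lambda>d x0. Conj
     [num_code_fm k d, num_fm 0 x0, scheme_fm [d] [x0] [] (PEx 0 (PAnd (FH 0) (PFm a))) c])"

text \<open>
  \<open>U\<close> is the finite sequence of the codes of the formulas of \<open>Thy M s\<close>, where \<open>s\<close> is now a set.
\<close>

definition Thy_fm :: "turing \<Rightarrow> tm \<Rightarrow> tm \<Rightarrow> fm" where
  "Thy_fm M s U = (let D = length (def_fms M Ct) in ex2 [s, U] (\<lambda>l d. Conj
     [binary_fm s l, add_fm (D + 2) l d, seq_fm U d,
      Conj (map (\<lambda>i. ex [U] (\<lambda>y. And (entry_fm U i y) (code_fm (def_fms M Ct ! i) y))) [0..<D]),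
      ex [U, l] (\<lambda>y. And (entry_fm U D y) (with_num_code_fm l (blank_fm M Ct (Var 0)) y)),
      ex [U] (\<lambda>y. And (entry_fm U (D + 1) y)
        (code_fm (with_num 0 (init_cell_fm M Ct (Var 0) Start 1)) y)),
      all [s, U, l] (\<lambda>k. Imp (Mem k l) (ex4 [s, U, l, k] (\<lambda>i y k' a. Conj
        [add_fm (D + 2) k i, app_fm U i y, succ_fm k k', app_fm s k a,
         Or (And (num_fm 0 a) (with_num_code_fm k' (init_cell_fm M Ct (Var 0) Zero 0) y))
            (And (num_fm 1 a) (with_num_code_fm k' (init_cell_fm M Ct (Var 0) One 0) y))])))]))"

text \<open>\<open>t\<close> is the computation table of \<open>M\<close> on the binary string \<open>s\<close>.\<close>

definition table_fm :: "turing \<Rightarrow> tm \<Rightarrow> tm \<Rightarrow> fm" where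
  "table_fm M s t = And (Conj (def_fms M t)) (ex [s, t] (\<lambda>l. Conj
     [binary_fm s l, blank_fm M t l,
      ex [t] (\<lambda>j. And (num_fm 0 j) (init_cell_fm M t j Start 1)),
      all3 [s, t, l] (\<lambda>k a j. Imp (Conj [Mem k l, app_fm s k a, succ_fm k j])
        (Or (And (num_fm 0 a) (init_cell_fm M t j Zero 0))
            (And (num_fm 1 a) (init_cell_fm M t j One 0))))]))"

definition outputs_1_fm :: "turing \<Rightarrow> tm \<Rightarrow> fm" where \<comment> \<open>\<open>M(s) = 1\<close>\<close>
  "outputs_1_fm M s = ex [s] (\<lambda>t. And (table_fm M s t) (out_fm M t))"

text \<open>\<open>\<forall>s (CK\<^sub>\<pi>(\<langle>T\<^sub>\<langle>\<^sub>M\<^sub>,\<^sub>s\<^sub>\<rangle>, AL\<rangle>, \<pi>) = 1 \<rightarrow> M(s) = 1)\<close>, \<open>s\<close> ranging over binary strings.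
  The theory, the proof and the output of the checker are defined objects, whose definitions are
  \<open>Thy_fm\<close>, \<open>code_seq_fm\<close> and \<open>CK_fm\<close>.\<close>

definition checker_formula :: "turing \<Rightarrow> fm list \<Rightarrow> justification list \<Rightarrow> fm" where
  "checker_formula M \<pi> Js = all [] (\<lambda>s. Imp (ex [s] (\<lambda>l. binary_fm s l))
     (Imp (ex3 [s] (\<lambda>U p v. Conj
            [Thy_fm M s U, code_seq_fm \<pi> p, CK_fm Js AL_fm U p v, num_fm 1 v]))
       (outputs_1_fm M s)))"

end

theory Submission
  imports Defs "HOL-Library.Countable_Set" "HOL-Library.Nat_Bijection"
begin

text \<open>
  By the completeness theorem it suffices to show that the formula holds in every model of ZFC.  Let
  \<open>s\<close> be a binary string of such a model (possibly of nonstandard length) on which the checker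
  accepts.  The model contains a computation table \<open>t\<close> of \<open>M\<close> on \<open>s\<close>: the least relation that contains
  the initial cells and is closed under the transitions.  Interpreting the constant by \<open>t\<close>, all
  formulas of the standard proof \<open>\<pi>\<close> become true, by induction along \<open>\<pi>\<close>: logical and ZFC axioms and
  the rules are sound, and a formula of \<open>\<pi>\<close> that was justified by the theory for \<open>r\<close> has, as the
  checker accepts, its code in the theory for \<open>s\<close> of the model; since coding is injective, it is a
  formula about standard numerals that is true of \<open>t\<close>.  The last formula of \<open>\<pi>\<close> then says that \<open>M\<close>
  outputs \<open>1\<close> on \<open>s\<close>.
\<close>


section \<open>Semantics\<close>

primrec val :: "'a \<Rightarrow> (nat \<Rightarrow> 'a) \<Rightarrow> tm \<Rightarrow> 'a" where
  "val c e (Var n) = e n"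
| "val c e Ct = c"

text \<open>The equality symbol is interpreted by an arbitrary relation \<open>Q\<close>, so that terms can be the
  elements of a model without passing to a quotient.\<close>

primrec eval ::
  "('a \<Rightarrow> 'a \<Rightarrow> bool) \<Rightarrow> ('a \<Rightarrow> 'a \<Rightarrow> bool) \<Rightarrow> 'a \<Rightarrow> (nat \<Rightarrow> 'a) \<Rightarrow> fm \<Rightarrow> bool" where
  "eval Q E c e (Eq s t) \<longleftrightarrow> Q (val c e s) (val c e t)"
| "eval Q E c e (Mem s t) \<longleftrightarrow> E (val c e s) (val c e t)"
| "eval Q E c e (Neg a) \<longleftrightarrow> \<not> eval Q E c e a"
| "eval Q E c e (Imp a b) \<longleftrightarrow> (eval Q E c e a \<longrightarrow> eval Q E c e b)"
| "eval Q E c e (All x a) \<longleftrightarrow> (\<forall>d. eval Q E c (e(x := d)) a)"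

lemma eval_connectives [simp]:
  "eval Q E c e (And a b) \<longleftrightarrow> eval Q E c e a \<and> eval Q E c e b"
  "eval Q E c e (Or a b) \<longleftrightarrow> eval Q E c e a \<or> eval Q E c e b"
  "eval Q E c e (Iff a b) \<longleftrightarrow> (eval Q E c e a \<longleftrightarrow> eval Q E c e b)"
  "eval Q E c e (Ex x a) \<longleftrightarrow> (\<exists>d. eval Q E c (e(x := d)) a)"
  by (auto simp: And_def Or_def Iff_def Ex_def)

lemma val_Ct_Var [simp]: "val Ct Var u = u"
  by (cases u) auto

lemma fresh_neq [simp]:
  assumes "Var n \<in> set ps"
  shows "n \<noteq> fresh ps" "fresh ps \<noteq> n"
proof -
  have "idx u \<le> fresh ps" if "u \<in> set ps" for u
    using that unfolding fresh_def by (induction ps) auto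
  from this[OF assms] show "n \<noteq> fresh ps" "fresh ps \<noteq> n" by simp_all
qed

lemma val_fresh [simp]: "u \<in> set ps \<Longrightarrow> val c (e(fresh ps := d)) u = val c e u"
  by (cases u) auto

lemma eval_all [simp]:
  "eval Q E c e (all ps F) \<longleftrightarrow> (\<forall>d. eval Q E c (e(fresh ps := d)) (F (Var (fresh ps))))"
  by (simp add: all_def)

lemma eval_ex [simp]:
  "eval Q E c e (ex ps F) \<longleftrightarrow> (\<exists>d. eval Q E c (e(fresh ps := d)) (F (Var (fresh ps))))"
  by (simp add: ex_def)

lemmas iterated_quantifier_defs = all2_def all3_def ex2_def ex3_def ex4_def ex1_def

primrec bound_vars :: "fm \<Rightarrow> nat set" where
  "bound_vars (Eq s t) = {}"
| "bound_vars (Mem s t) = {}"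
| "bound_vars (Neg a) = bound_vars a"
| "bound_vars (Imp a b) = bound_vars a \<union> bound_vars b"
| "bound_vars (All x a) = insert x (bound_vars a)"

abbreviation vars :: "fm \<Rightarrow> nat set" where
  "vars a \<equiv> fv a \<union> bound_vars a"

lemma finite_fv [simp]: "finite (fv a)"
proof -
  have "finite {x. Var x \<in> S}" if "finite S" for S
    using finite_vimageI[OF that, of Var] by (simp add: inj_def vimage_def)
  then show ?thesis
    by (induction a) (simp_all del: insert_iff)
qed

lemma finite_bound_vars [simp]: "finite (bound_vars a)"
  by (induction a) auto

lemma ex_notin_finite: "finite S \<Longrightarrow> \<exists>y::nat. y \<notin> S"
  using ex_new_if_finite infinite_UNIV_nat by blast

lemma val_cong: "(\<And>x. s = Var x \<Longrightarrow> e x = e' x) \<Longrightarrow> val c e s = val c e' s"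
  by (cases s) auto

lemma eval_cong: "(\<And>x. x \<in> fv a \<Longrightarrow> e x = e' x) \<Longrightarrow> eval Q E c e a \<longleftrightarrow> eval Q E c e' a"
proof (induction a arbitrary: e e')
  case (Eq s t)
  then show ?case using val_cong[of s e e' c] val_cong[of t e e' c] by simp
next
  case (Mem s t)
  then show ?case using val_cong[of s e e' c] val_cong[of t e e' c] by simp
next
  case (Neg a)
  have "eval Q E c e a \<longleftrightarrow> eval Q E c e' a"
    using Neg.prems by (intro Neg.IH) simp
  then show ?case by simp
next
  case (Imp a b)
  have "eval Q E c e a \<longleftrightarrow> eval Q E c e' a" "eval Q E c e b \<longleftrightarrow> eval Q E c e' b"
    using Imp.prems by (intro Imp.IH; simp)+
  then show ?case by simp
next
  case (All x a)
  have "eval Q E c (e(x := d)) a \<longleftrightarrow> eval Q E c (e'(x := d)) a" for d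
    using All.prems by (intro All.IH) auto
  then show ?case by simp
qed

lemma eval_fun_upd_notin_fv [simp]: "x \<notin> fv a \<Longrightarrow> eval Q E c (e(x := d)) a \<longleftrightarrow> eval Q E c e a"
  by (rule eval_cong) auto

lemma val_substt [simp]: "val c e (substt x u s) = val c (e(x := val c e u)) s"
  by (cases s) (auto simp: substt_def)

lemma subst_notin_fv: "x \<notin> fv a \<Longrightarrow> subst x u a = a"
  by (induction a) (auto simp: substt_def)

lemma eval_subst:
  "free_for u x a \<Longrightarrow> eval Q E c e (subst x u a) \<longleftrightarrow> eval Q E c (e(x := val c e u)) a"
proof (induction a arbitrary: e)
  case (All y a)
  show ?case
  proof (cases "x \<in> fv (All y a)")
    case True
    then have capture_free: "u \<noteq> Var y" "free_for u x a" "y \<noteq> x" using All.prems by auto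
    have "eval Q E c (e(y := d)) (subst x u a) \<longleftrightarrow> eval Q E c (e(x := val c e u, y := d)) a" for d
    proof -
      have "val c (e(y := d)) u = val c e u" using capture_free(1) by (cases u) auto
      then show ?thesis
        using All.IH[OF capture_free(2), of "e(y := d)"] capture_free(3)
        by (simp only: fun_upd_twist)
    qed
    then show ?thesis using capture_free(3) by (simp del: fun_upd_apply)
  next
    case False
    then show ?thesis
      by (simp only: subst_notin_fv eval_fun_upd_notin_fv not_False_eq_True)
  qed
qed auto

lemma size_subst [simp]: "size (subst x u a) = size a"
  by (induction a) auto

lemma free_for_notin_bound_vars: "y \<notin> bound_vars a \<Longrightarrow> free_for (Var y) x a"
  by (induction a) auto

lemma free_for_Ct [simp]: "free_for Ct x a"
  by (induction a) auto

lemma free_for_self: "free_for (Var x) x a"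
  by (induction a) auto

lemma subst_self [simp]: "subst x (Var x) a = a"
  by (induction a) (auto simp: substt_def)

lemma subst_subst_back: "y \<notin> vars a \<Longrightarrow> subst y (Var x) (subst x (Var y) a) = a"
  by (induction a) (auto simp: substt_def subst_notin_fv)

lemma free_for_subst_back: "y \<notin> vars a \<Longrightarrow> free_for (Var x) y (subst x (Var y) a)"
  by (induction a) auto

lemma notin_fv_subst: "x \<noteq> y \<Longrightarrow> x \<notin> fv (subst x (Var y) a)"
  by (induction a) (auto simp: substt_def)

lemma eval_foldr_All:
  "eval Q E c e (foldr All xs a) \<Longrightarrow> (\<And>x. x \<notin> set xs \<Longrightarrow> e' x = e x) \<Longrightarrow> eval Q E c e' a"
proof (induction xs arbitrary: e)
  case Nil
  then have "e' = e" by auto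
  then show ?case using Nil by simp
next
  case (Cons x xs)
  have "eval Q E c (e(x := e' x)) (foldr All xs a)" using Cons.prems(1) by simp
  then show ?case by (rule Cons.IH) (use Cons.prems(2) in auto)
qed

lemma eval_rename_bound:
  assumes "y \<notin> vars a"
  shows "eval Q E c e (All y (subst x (Var y) a)) \<longleftrightarrow> eval Q E c e (All x a)"
proof -
  have "eval Q E c (e(y := d)) (subst x (Var y) a) \<longleftrightarrow> eval Q E c (e(x := d)) a" for d
  proof -
    have "eval Q E c (e(y := d)) (subst x (Var y) a) \<longleftrightarrow> eval Q E c (e(y := d, x := d)) a"
      using assms by (simp add: eval_subst free_for_notin_bound_vars)
    also have "\<dots> \<longleftrightarrow> eval Q E c (e(x := d)) a"
      using assms by (intro eval_cong) auto
    finally show ?thesis .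
  qed
  then show ?thesis by simp
qed

lemma logical_axiom_valid: "logical_axiom a \<Longrightarrow> eval (=) E c e a"
  by (induction rule: logical_axiom.induct) (auto simp: eval_subst)


section \<open>The Hilbert calculus of ZFC\<close>

inductive entails :: "fm set \<Rightarrow> fm \<Rightarrow> bool" (infix "\<turnstile>" 50) where
  hyp: "a \<in> \<Gamma> \<Longrightarrow> \<Gamma> \<turnstile> a"
| logical: "logical_axiom a \<Longrightarrow> \<Gamma> \<turnstile> a"
| zfc: "zfc_axiom a \<Longrightarrow> \<Gamma> \<turnstile> a"
| mp: "\<Gamma> \<turnstile> Imp a b \<Longrightarrow> \<Gamma> \<turnstile> a \<Longrightarrow> \<Gamma> \<turnstile> b"
| gen: "{} \<turnstile> a \<Longrightarrow> \<Gamma> \<turnstile> All x a"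

lemma entails_mono: "\<Gamma> \<turnstile> a \<Longrightarrow> \<Gamma> \<subseteq> \<Gamma>' \<Longrightarrow> \<Gamma>' \<turnstile> a"
  by (induction rule: entails.induct) (auto intro: entails.intros)

lemma entails_finite: "\<Gamma> \<turnstile> a \<Longrightarrow> \<exists>\<Gamma>'. finite \<Gamma>' \<and> \<Gamma>' \<subseteq> \<Gamma> \<and> \<Gamma>' \<turnstile> a"
proof (induction rule: entails.induct)
  case (hyp a \<Gamma>)
  then show ?case by (intro exI[of _ "{a}"]) (auto intro: entails.hyp)
next
  case (mp \<Gamma> a b)
  then obtain \<Gamma>1 \<Gamma>2 where "finite \<Gamma>1" "\<Gamma>1 \<subseteq> \<Gamma>" "\<Gamma>1 \<turnstile> Imp a b" "finite \<Gamma>2" "\<Gamma>2 \<subseteq> \<Gamma>" "\<Gamma>2 \<turnstile> a"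
    by blast
  moreover from this have "\<Gamma>1 \<union> \<Gamma>2 \<turnstile> b"
    by (meson entails.mp entails_mono sup_ge1 sup_ge2)
  ultimately show ?case by (intro exI[of _ "\<Gamma>1 \<union> \<Gamma>2"]) auto
qed (auto intro: exI[of _ "{}"] entails.intros)

lemma entails_K: "\<Gamma> \<turnstile> Imp a (Imp b a)"
  by (intro entails.logical logical_axiom.intros)

lemma entails_S: "\<Gamma> \<turnstile> Imp (Imp a (Imp b c)) (Imp (Imp a b) (Imp a c))"
  by (intro entails.logical logical_axiom.intros)

lemma entails_contrapos: "\<Gamma> \<turnstile> Imp (Imp (Neg a) (Neg b)) (Imp b a)"
  by (intro entails.logical logical_axiom.intros)

lemma entails_ImpI: "insert b \<Gamma> \<turnstile> a \<Longrightarrow> \<Gamma> \<turnstile> Imp b a"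
proof (induction "insert b \<Gamma>" a rule: entails.induct)
  case (hyp a)
  show ?case
  proof (cases "a = b")
    case True
    have "\<Gamma> \<turnstile> Imp b b"
      by (rule entails.mp[OF entails.mp[OF entails_S entails_K] entails_K[of \<Gamma> b b]])
    with True show ?thesis by simp
  next
    case False
    then have "\<Gamma> \<turnstile> a" using hyp by (auto intro: entails.hyp)
    then show ?thesis by (rule entails.mp[OF entails_K])
  qed
next
  case (mp a c)
  then show ?case by (blast intro: entails.mp[OF entails.mp[OF entails_S]])
qed (auto intro: entails.mp[OF entails_K] entails.intros)

lemma entails_Imp_iff: "\<Gamma> \<turnstile> Imp b a \<longleftrightarrow> insert b \<Gamma> \<turnstile> a"
proof
  assume "\<Gamma> \<turnstile> Imp b a"
  then have "insert b \<Gamma> \<turnstile> Imp b a" by (rule entails_mono) auto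
  then show "insert b \<Gamma> \<turnstile> a" by (rule entails.mp) (simp add: entails.hyp)
qed (rule entails_ImpI)

lemma entails_cut: "\<Gamma> \<turnstile> a \<Longrightarrow> insert a \<Gamma> \<turnstile> b \<Longrightarrow> \<Gamma> \<turnstile> b"
  using entails_Imp_iff entails.mp by blast

lemma entails_trans: "\<Gamma> \<turnstile> a \<Longrightarrow> {a} \<turnstile> b \<Longrightarrow> \<Gamma> \<turnstile> b"
  by (rule entails_cut) (auto elim: entails_mono)

definition consistent :: "fm set \<Rightarrow> bool" where
  "consistent \<Gamma> \<longleftrightarrow> \<not> \<Gamma> \<turnstile> Bot"

lemma entails_exfalso: "\<Gamma> \<turnstile> Neg a \<Longrightarrow> \<Gamma> \<turnstile> a \<Longrightarrow> \<Gamma> \<turnstile> b"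
  by (rule entails.mp[OF entails.mp[OF entails_contrapos entails.mp[OF entails_K]]])

lemma entails_ccontr: "\<not> consistent (insert (Neg a) \<Gamma>) \<Longrightarrow> \<Gamma> \<turnstile> a"
proof -
  assume "\<not> consistent (insert (Neg a) \<Gamma>)"
  then have "\<Gamma> \<turnstile> Imp (Neg a) Bot" by (simp add: consistent_def entails_ImpI)
  moreover have "\<Gamma> \<turnstile> All 0 (Eq (Var 0) (Var 0))"
    by (intro entails.gen entails.logical logical_axiom.intros)
  ultimately show "\<Gamma> \<turnstile> a"
    unfolding Bot_def using entails.mp[OF entails_contrapos] entails.mp by blast
qed

lemma entails_NegI: "\<not> consistent (insert a \<Gamma>) \<Longrightarrow> \<Gamma> \<turnstile> Neg a"
proof (rule entails_ccontr)
  let ?\<Gamma> = "insert (Neg (Neg a)) \<Gamma>"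
  assume "\<not> consistent (insert a \<Gamma>)"
  then have "?\<Gamma> \<turnstile> Imp a Bot"
    unfolding consistent_def not_not by (intro entails_mono[OF entails_ImpI]) auto
  moreover have "?\<Gamma> \<turnstile> a"
    by (rule entails_ccontr)
      (auto simp: consistent_def intro: entails_exfalso[of _ "Neg a"] entails.hyp)
  ultimately show "\<not> consistent ?\<Gamma>"
    unfolding consistent_def not_not by (rule entails.mp)
qed

lemma entails_gen:
  assumes "finite \<Gamma>" "\<Gamma> \<turnstile> a" "\<And>b. b \<in> \<Gamma> \<Longrightarrow> x \<notin> fv b"
  shows "\<Gamma> \<turnstile> All x a"
  using assms
proof (induction \<Gamma> arbitrary: a rule: finite_induct)
  case empty
  then show ?case by (auto intro: entails.gen)
next
  case (insert b \<Gamma>)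
  then have "\<Gamma> \<turnstile> All x (Imp b a)" by (simp add: entails_Imp_iff)
  moreover have "\<Gamma> \<turnstile> Imp (All x (Imp b a)) (Imp b (All x a))"
    using insert.prems by (intro entails.logical logical_axiom.intros) simp
  ultimately show ?case unfolding entails_Imp_iff[symmetric] by (rule entails.mp[rotated])
qed

lemma entails_inst: "\<Gamma> \<turnstile> All x a \<Longrightarrow> free_for u x a \<Longrightarrow> \<Gamma> \<turnstile> subst x u a"
  by (rule entails.mp[OF entails.logical[OF logical_axiom.intros(4)]])

lemma entails_Neg_antimono: "{a} \<turnstile> b \<Longrightarrow> {Neg b} \<turnstile> Neg a"
proof (rule entails_NegI)
  assume "{a} \<turnstile> b"
  then have "{a, Neg b} \<turnstile> b" by (rule entails_mono) auto
  then show "\<not> consistent {a, Neg b}"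
    unfolding consistent_def not_not by (rule entails_exfalso[rotated]) (simp add: entails.hyp)
qed

lemma entails_Imp_mono: "{a'} \<turnstile> a \<Longrightarrow> {b} \<turnstile> b' \<Longrightarrow> {Imp a b} \<turnstile> Imp a' b'"
proof (rule entails_ImpI)
  assume "{a'} \<turnstile> a" "{b} \<turnstile> b'"
  let ?\<Gamma> = "{a', Imp a b}"
  have "?\<Gamma> \<turnstile> a" using \<open>{a'} \<turnstile> a\<close> by (rule entails_mono) auto
  then have "?\<Gamma> \<turnstile> b" by (rule entails.mp[rotated]) (simp add: entails.hyp)
  then show "?\<Gamma> \<turnstile> b'" using \<open>{b} \<turnstile> b'\<close> by (rule entails_trans)
qed

lemma entails_All_mono: "{a} \<turnstile> b \<Longrightarrow> {All x a} \<turnstile> All x b"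
proof (rule entails_gen)
  assume "{a} \<turnstile> b"
  have "{All x a} \<turnstile> a"
    using entails_inst[of "{All x a}" x a "Var x"] free_for_self by (simp add: entails.hyp)
  then show "{All x a} \<turnstile> b" using \<open>{a} \<turnstile> b\<close> by (rule entails_trans)
qed auto

lemma entails_rename_bound:
  assumes "y \<notin> vars a"
  shows "{All x a} \<turnstile> All y (subst x (Var y) a)" and "{All y (subst x (Var y) a)} \<turnstile> All x a"
proof -
  let ?b = "subst x (Var y) a"
  have "{All x a} \<turnstile> ?b"
    using assms by (intro entails_inst entails.hyp free_for_notin_bound_vars) auto
  then show "{All x a} \<turnstile> All y ?b" using assms by (intro entails_gen) auto
  have "{All y ?b} \<turnstile> subst y (Var x) ?b"
    using assms by (intro entails_inst entails.hyp free_for_subst_back) auto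
  then have "{All y ?b} \<turnstile> a" using assms by (simp add: subst_subst_back)
  then show "{All y ?b} \<turnstile> All x a"
    by (intro entails_gen) (use notin_fv_subst in auto)
qed


section \<open>Renaming of bound variables\<close>

inductive alpha_eq :: "fm \<Rightarrow> fm \<Rightarrow> bool" where
  refl: "alpha_eq a a"
| trans: "alpha_eq a b \<Longrightarrow> alpha_eq b d \<Longrightarrow> alpha_eq a d"
| Neg: "alpha_eq a b \<Longrightarrow> alpha_eq (Neg a) (Neg b)"
| Imp: "alpha_eq a a' \<Longrightarrow> alpha_eq b b' \<Longrightarrow> alpha_eq (Imp a b) (Imp a' b')"
| All: "alpha_eq a b \<Longrightarrow> alpha_eq (All x a) (All x b)"
| rename: "y \<notin> vars a \<Longrightarrow> alpha_eq (All x a) (All y (subst x (Var y) a))"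

lemma alpha_eq_size: "alpha_eq a b \<Longrightarrow> size b = size a"
  by (induction rule: alpha_eq.induct) auto

lemma alpha_eq_eval: "alpha_eq a b \<Longrightarrow> eval Q E c e b \<longleftrightarrow> eval Q E c e a"
proof (induction arbitrary: e rule: alpha_eq.induct)
  case (rename y a x)
  then show ?case by (rule eval_rename_bound)
qed simp_all

lemma alpha_eq_entails: "alpha_eq a b \<Longrightarrow> {a} \<turnstile> b \<and> {b} \<turnstile> a"
proof (induction rule: alpha_eq.induct)
  case (trans a b d)
  then show ?case using entails_trans by blast
next
  case (rename y a x)
  then show ?case using entails_rename_bound by blast
qed (simp_all add: entails.hyp entails_Neg_antimono entails_Imp_mono entails_All_mono)

lemma ex_alpha_eq_notin_bound_vars: "\<exists>a'. alpha_eq a a' \<and> v \<notin> bound_vars a'"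
proof (induction "size a" arbitrary: a rule: less_induct)
  case less
  show ?case
  proof (cases a)
    case (Neg b)
    then show ?thesis using less[of b] by (auto intro: alpha_eq.Neg)
  next
    case (Imp b d)
    obtain b' d' where "alpha_eq b b'" "v \<notin> bound_vars b'" "alpha_eq d d'" "v \<notin> bound_vars d'"
      using less[of b] less[of d] Imp by auto
    then show ?thesis using Imp by (intro exI[of _ "Imp b' d'"]) (auto intro: alpha_eq.Imp)
  next
    case (All y b)
    obtain w where w_fresh: "w \<notin> insert v (vars b)"
      using ex_notin_finite[of "insert v (vars b)"] by auto
    then obtain b' where renamed: "alpha_eq (subst y (Var w) b) b'" "v \<notin> bound_vars b'"
      using less[of "subst y (Var w) b"] All by auto
    have "alpha_eq a (All w b')"
      using alpha_eq.trans[OF alpha_eq.rename alpha_eq.All] renamed(1) w_fresh All by blast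
    then show ?thesis using w_fresh renamed(2) by (intro exI[of _ "All w b'"]) auto
  qed (auto intro: alpha_eq.refl)
qed

lemma ex_alpha_eq_free_for: "\<exists>a'. alpha_eq a a' \<and> free_for u x a'"
proof (cases u)
  case (Var v)
  then show ?thesis using ex_alpha_eq_notin_bound_vars[of a v] free_for_notin_bound_vars by blast
qed (use alpha_eq.refl in auto)


section \<open>Completeness\<close>

instance tm :: countable by countable_datatype
instance fm :: countable by countable_datatype

locale henkin =
  fixes \<Delta> :: "fm set"
  assumes consistent: "consistent \<Delta>"
    and complete: "a \<in> \<Delta> \<or> Neg a \<in> \<Delta>"
    and witnessed: "Neg (All x b) \<in> \<Delta> \<Longrightarrow> \<exists>y. y \<notin> vars b \<and> Neg (subst x (Var y) b) \<in> \<Delta>"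
begin

lemma Neg_mem_iff: "Neg a \<in> \<Delta> \<longleftrightarrow> a \<notin> \<Delta>"
  using complete consistent entails_exfalso[OF entails.hyp entails.hyp]
  unfolding consistent_def by blast

lemma entails_iff_mem: "\<Delta> \<turnstile> a \<longleftrightarrow> a \<in> \<Delta>"
proof
  assume "\<Delta> \<turnstile> a"
  show "a \<in> \<Delta>"
  proof (rule ccontr)
    assume "a \<notin> \<Delta>"
    then have "\<Delta> \<turnstile> Neg a" by (simp add: Neg_mem_iff entails.hyp)
    then show False using \<open>\<Delta> \<turnstile> a\<close> consistent entails_exfalso unfolding consistent_def by blast
  qed
qed (rule entails.hyp)

lemma Imp_mem_iff: "Imp a b \<in> \<Delta> \<longleftrightarrow> (a \<in> \<Delta> \<longrightarrow> b \<in> \<Delta>)"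
proof
  assume "Imp a b \<in> \<Delta>"
  then show "a \<in> \<Delta> \<longrightarrow> b \<in> \<Delta>" using entails.mp entails_iff_mem by blast
next
  assume imp: "a \<in> \<Delta> \<longrightarrow> b \<in> \<Delta>"
  have "insert a \<Delta> \<turnstile> b"
  proof (cases "b \<in> \<Delta>")
    case True
    then show ?thesis by (simp add: entails.hyp)
  next
    case False
    with imp have "Neg a \<in> \<Delta>" by (simp add: Neg_mem_iff)
    then show ?thesis by (auto intro: entails_exfalso[OF entails.hyp entails.hyp])
  qed
  then show "Imp a b \<in> \<Delta>" using entails_ImpI entails_iff_mem by blast
qed

abbreviation term_eval :: "(nat \<Rightarrow> tm) \<Rightarrow> fm \<Rightarrow> bool" where
  "term_eval \<equiv> eval (\<lambda>s t. Eq s t \<in> \<Delta>) (\<lambda>s t. Mem s t \<in> \<Delta>) Ct"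

lemma term_eval_instance:
  assumes "All x b \<in> \<Delta>" and "\<And>a. size a = size b \<Longrightarrow> term_eval Var a \<longleftrightarrow> a \<in> \<Delta>"
  shows "term_eval (Var(x := u)) b"
proof -
  obtain b' where renamed: "alpha_eq b b'" "free_for u x b'" using ex_alpha_eq_free_for by blast
  have "{All x b} \<turnstile> All x b'"
    using alpha_eq_entails[OF renamed(1)] by (blast intro: entails_All_mono)
  then have "\<Delta> \<turnstile> All x b'" using assms(1) by (auto intro: entails_trans entails.hyp)
  then have "subst x u b' \<in> \<Delta>" using renamed(2) entails_inst entails_iff_mem by blast
  then have "term_eval Var (subst x u b')"
    using assms(2) alpha_eq_size[OF renamed(1)] by simp
  then show ?thesis unfolding eval_subst[OF renamed(2)] alpha_eq_eval[OF renamed(1)] by simp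
qed

lemma term_eval_iff_mem: "term_eval Var a \<longleftrightarrow> a \<in> \<Delta>"
proof (induction "size a" arbitrary: a rule: less_induct)
  case less
  show ?case
  proof (cases a)
    case (Neg b)
    then show ?thesis using less[of b] Neg_mem_iff by simp
  next
    case (Imp b d)
    then show ?thesis using less[of b] less[of d] Imp_mem_iff by simp
  next
    case (All x b)
    show ?thesis
    proof
      assume "a \<in> \<Delta>"
      then show "term_eval Var a"
        using term_eval_instance[of x b] less All by simp
    next
      assume true: "term_eval Var a"
      show "a \<in> \<Delta>"
      proof (rule ccontr)
        assume "a \<notin> \<Delta>"
        then obtain y where witness: "y \<notin> vars b" "Neg (subst x (Var y) b) \<in> \<Delta>"
          using witnessed Neg_mem_iff All by blast
        then have "\<not> term_eval Var (subst x (Var y) b)"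
          using less[of "subst x (Var y) b"] All Neg_mem_iff by simp
        then show False
          using true witness(1) All by (simp add: eval_subst free_for_notin_bound_vars)
      qed
    qed
  qed auto
qed

lemma term_eval_theorem:
  assumes "{} \<turnstile> a"
  shows "term_eval e a"
proof -
  let ?xs = "sorted_list_of_set (fv a)"
  have "{} \<turnstile> foldr All xs a" for xs
    by (induction xs) (auto intro: assms entails.gen)
  then have "term_eval Var (foldr All ?xs a)"
    using term_eval_iff_mem entails_iff_mem entails_mono[of "{}"] by blast
  then have "term_eval (\<lambda>x. if x \<in> fv a then e x else Var x) a"
    by (rule eval_foldr_All) simp
  moreover have "term_eval (\<lambda>x. if x \<in> fv a then e x else Var x) a \<longleftrightarrow> term_eval e a"
    by (rule eval_cong) simp
  ultimately show ?thesis by simp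
qed

end

text \<open>Only finitely many formulas are added before each stage, so that a variable that does not
  occur in them can serve as a witness, and no new constants are needed.\<close>

definition fresh_witness :: "fm set \<Rightarrow> fm \<Rightarrow> fm set" where
  "fresh_witness \<Gamma> a = (case a of
     Neg (All x b) \<Rightarrow> {Neg (subst x (Var (SOME y. y \<notin> \<Union> (vars ` insert a \<Gamma>))) b)} | _ \<Rightarrow> {})"

primrec henkin_stage :: "fm set \<Rightarrow> nat \<Rightarrow> fm set" where
  "henkin_stage \<Gamma> 0 = \<Gamma>"
| "henkin_stage \<Gamma> (Suc n) = (let \<Gamma>' = henkin_stage \<Gamma> n; a = from_nat n in
     if consistent (insert a \<Gamma>') then insert a \<Gamma>' \<union> fresh_witness \<Gamma>' a else \<Gamma>')"

definition henkin_extension :: "fm set \<Rightarrow> fm set" where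
  "henkin_extension \<Gamma> = (\<Union>n. henkin_stage \<Gamma> n)"

lemma fresh_witness_Neg_All:
  assumes "finite \<Gamma>"
  obtains y where "y \<notin> vars b" "y \<noteq> x" "\<And>d. d \<in> \<Gamma> \<Longrightarrow> y \<notin> vars d"
    "fresh_witness \<Gamma> (Neg (All x b)) = {Neg (subst x (Var y) b)}"
proof -
  let ?S = "\<Union> (vars ` insert (Neg (All x b)) \<Gamma>)"
  have "(SOME y. y \<notin> ?S) \<notin> ?S"
    using assms by (intro someI_ex[of "\<lambda>y. y \<notin> ?S"] ex_notin_finite) auto
  then show thesis by (intro that[of "SOME y. y \<notin> ?S"]) (auto simp: fresh_witness_def)
qed

lemma consistent_fresh_witness:
  assumes "finite \<Gamma>" "consistent (insert a \<Gamma>)"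
  shows "consistent (insert a \<Gamma> \<union> fresh_witness \<Gamma> a)"
proof (cases "\<exists>x b. a = Neg (All x b)")
  case True
  then obtain x b where a_eq: "a = Neg (All x b)" by blast
  obtain y where y_fresh: "y \<notin> vars b" "y \<noteq> x" "\<And>d. d \<in> \<Gamma> \<Longrightarrow> y \<notin> vars d"
    and witness: "fresh_witness \<Gamma> a = {Neg (subst x (Var y) b)}"
    using fresh_witness_Neg_All[OF assms(1), of b x] a_eq by metis
  show ?thesis
  proof (rule ccontr)
    assume "\<not> ?thesis"
    then have "insert a \<Gamma> \<turnstile> subst x (Var y) b"
      unfolding witness by (intro entails_ccontr) simp
    then have "insert a \<Gamma> \<turnstile> All y (subst x (Var y) b)"
      by (rule entails_gen[rotated]) (use assms(1) y_fresh a_eq in auto)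
    then have "insert a \<Gamma> \<turnstile> All x b"
      using entails_rename_bound(2)[OF y_fresh(1)] by (rule entails_trans)
    moreover have "insert a \<Gamma> \<turnstile> Neg (All x b)" using a_eq by (simp add: entails.hyp)
    ultimately show False using assms(2) entails_exfalso unfolding consistent_def by blast
  qed
next
  case False
  then have "fresh_witness \<Gamma> a = {}" by (auto simp: fresh_witness_def split: fm.splits)
  then show ?thesis using assms by simp
qed

lemma finite_henkin_stage:
  assumes "finite \<Gamma>"
  shows "finite (henkin_stage \<Gamma> n)"
proof -
  have "finite (fresh_witness \<Gamma>' a)" for \<Gamma>' a
    by (auto simp: fresh_witness_def split: fm.splits)
  then show ?thesis using assms by (induction n) (auto simp: Let_def)
qed

lemma henkin_stage_mono: "m \<le> n \<Longrightarrow> henkin_stage \<Gamma> m \<subseteq> henkin_stage \<Gamma> n"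
proof (rule lift_Suc_mono_le[of "henkin_stage \<Gamma>"])
  show "henkin_stage \<Gamma> n \<subseteq> henkin_stage \<Gamma> (Suc n)" for n by (auto simp: Let_def)
qed

lemma consistent_henkin_stage:
  assumes "finite \<Gamma>" "consistent \<Gamma>"
  shows "consistent (henkin_stage \<Gamma> n)"
proof (induction n)
  case (Suc n)
  then show ?case
    using consistent_fresh_witness[OF finite_henkin_stage[OF assms(1)]] by (simp add: Let_def)
qed (simp add: assms(2))

lemma henkin_stage_subset: "henkin_stage \<Gamma> n \<subseteq> henkin_extension \<Gamma>"
  by (auto simp: henkin_extension_def)

lemma consistent_henkin_extension:
  assumes "finite \<Gamma>" "consistent \<Gamma>"
  shows "consistent (henkin_extension \<Gamma>)"
  unfolding consistent_def
proof
  assume "henkin_extension \<Gamma> \<turnstile> Bot"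
  then obtain G where inconsistent: "finite G" "G \<subseteq> henkin_extension \<Gamma>" "G \<turnstile> Bot"
    using entails_finite by blast
  moreover have "henkin_stage \<Gamma> m \<subseteq> henkin_stage \<Gamma> n \<or> henkin_stage \<Gamma> n \<subseteq> henkin_stage \<Gamma> m" for m n
    using henkin_stage_mono nat_le_linear by metis
  then have "subset.chain UNIV (range (henkin_stage \<Gamma>))"
    by (auto simp: subset_chain_def)
  ultimately obtain n where "G \<subseteq> henkin_stage \<Gamma> n"
    using finite_subset_Union_chain[of G "range (henkin_stage \<Gamma>)" UNIV]
    unfolding henkin_extension_def by blast
  then show False
    using consistent_henkin_stage[OF assms] entails_mono[OF inconsistent(3)]
    unfolding consistent_def by blast
qed

lemma henkin_henkin_extension:
  assumes "finite \<Gamma>" "consistent \<Gamma>"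
  shows "henkin (henkin_extension \<Gamma>)"
proof
  let ?\<Delta> = "henkin_extension \<Gamma>"
  show cons: "consistent ?\<Delta>" by (rule consistent_henkin_extension[OF assms])
  have stage_Suc: "insert a \<Gamma>' \<union> fresh_witness \<Gamma>' a \<subseteq> ?\<Delta>"
    if "\<Gamma>' = henkin_stage \<Gamma> (to_nat a)" "consistent (insert a \<Gamma>')" for a \<Gamma>'
    using henkin_stage_subset[of \<Gamma> "Suc (to_nat a)"] that by (simp add: Let_def)
  have entails_Neg: "?\<Delta> \<turnstile> Neg a" if "a \<notin> ?\<Delta>" for a
  proof -
    have "\<not> consistent (insert a (henkin_stage \<Gamma> (to_nat a)))" using that stage_Suc by blast
    then show ?thesis using entails_mono[OF entails_NegI henkin_stage_subset] by blast
  qed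
  show "a \<in> ?\<Delta> \<or> Neg a \<in> ?\<Delta>" for a
    using cons entails_Neg[of a] entails_Neg[of "Neg a"] entails_exfalso
    unfolding consistent_def by blast
  show "\<exists>y. y \<notin> vars b \<and> Neg (subst x (Var y) b) \<in> ?\<Delta>" if mem: "Neg (All x b) \<in> ?\<Delta>" for x b
  proof -
    let ?\<Gamma> = "henkin_stage \<Gamma> (to_nat (Neg (All x b)))"
    have "insert (Neg (All x b)) ?\<Gamma> \<subseteq> ?\<Delta>" using mem henkin_stage_subset by simp
    then have "consistent (insert (Neg (All x b)) ?\<Gamma>)"
      using cons entails_mono unfolding consistent_def by blast
    then have "fresh_witness ?\<Gamma> (Neg (All x b)) \<subseteq> ?\<Delta>" using stage_Suc by blast
    moreover obtain y where "y \<notin> vars b"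
      "fresh_witness ?\<Gamma> (Neg (All x b)) = {Neg (subst x (Var y) b)}"
      using fresh_witness_Neg_All[OF finite_henkin_stage[OF assms(1)]] by metis
    ultimately show ?thesis by blast
  qed
qed


section \<open>Countable models of ZFC\<close>

locale zfc_model =
  fixes Q E :: "'a \<Rightarrow> 'a \<Rightarrow> bool" and c :: 'a
  assumes theorem_true: "{} \<turnstile> a \<Longrightarrow> eval Q E c e a"
begin

lemma zfc_single_true: "a \<in> set zfc_single \<Longrightarrow> eval Q E c e a"
  by (intro theorem_true entails.zfc zfc_axiom.single)

lemma Q_refl: "Q x x"
  using theorem_true[of "Eq (Var 0) (Var 0)" "\<lambda>_. x"]
  by (simp add: entails.logical logical_axiom.intros)

lemma Q_euclid: "Q x y \<Longrightarrow> Q x z \<Longrightarrow> Q y z"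
  using theorem_true[of "Imp (Eq (Var 0) (Var 1)) (Imp (Eq (Var 0) (Var 2)) (Eq (Var 1) (Var 2)))"
      "(\<lambda>_. x)(1 := y, 2 := z)"]
  by (simp add: entails.logical logical_axiom.intros)

lemma Q_sym: "Q x y \<Longrightarrow> Q y x"
  using Q_euclid Q_refl by blast

lemma E_cong:
  assumes "Q x x'" "Q y y'" "E x y"
  shows "E x' y'"
proof -
  have "E x' y"
    using assms(1,3) theorem_true[of
        "Imp (Eq (Var 0) (Var 1)) (Imp (Mem (Var 0) (Var 2)) (Mem (Var 1) (Var 2)))"
        "(\<lambda>_. x)(1 := x', 2 := y)"]
    by (simp add: entails.logical logical_axiom.intros)
  then show ?thesis
    using assms(2) theorem_true[of
        "Imp (Eq (Var 0) (Var 1)) (Imp (Mem (Var 2) (Var 0)) (Mem (Var 2) (Var 1)))"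
        "(\<lambda>_. x')(0 := y, 1 := y')"]
    by (simp add: entails.logical logical_axiom.intros)
qed

lemma pairing: "\<exists>p. \<forall>z. E z p \<longleftrightarrow> Q z x \<or> Q z y"
  using zfc_single_true[of "zfc_single ! 1" "\<lambda>_. c"]
  by (simp add: zfc_single_def all2_def upair_fm_def)

lemma union: "\<exists>u. \<forall>z. E z u \<longleftrightarrow> (\<exists>w. E z w \<and> E w x)"
  using zfc_single_true[of "zfc_single ! 2" "\<lambda>_. c"] by (simp add: zfc_single_def)

lemma no_universal_set: "\<exists>x. \<not> E x u"
proof (rule ccontr)
  assume universal: "\<nexists>x. \<not> E x u"
  have "{} \<turnstile> Ex 1 (All 0 (Iff (Mem (Var 0) (Var 1))
    (And (Mem (Var 0) (Var 2)) (Neg (Mem (Var 0) (Var 0))))))"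
    by (intro entails.zfc zfc_axiom.separation) auto
  from theorem_true[OF this, of "\<lambda>_. u"] show False using universal by auto
qed

lemma finite_covered: "finite F \<Longrightarrow> \<exists>u. \<forall>x \<in> F. E x u"
proof (induction rule: finite_induct)
  case (insert x F)
  then obtain u where covers: "\<forall>y \<in> F. E y u" by blast
  obtain s where mem_s: "\<forall>z. E z s \<longleftrightarrow> Q z x \<or> Q z x" using pairing by blast
  obtain p where mem_p: "\<forall>z. E z p \<longleftrightarrow> Q z s \<or> Q z u" using pairing by blast
  obtain v where mem_v: "\<forall>z. E z v \<longleftrightarrow> (\<exists>w. E z w \<and> E w p)" using union by blast
  have "E x s" "E s p" "E u p" using mem_s mem_p Q_refl by simp_all
  then have "\<forall>y \<in> insert x F. E y v" using covers mem_v by auto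
  then show ?case by blast
qed simp

lemma infinite_classes: "infinite (range Q)"
proof
  assume "finite (range Q)"
  then obtain F where "finite F" and F_image: "range Q = Q ` F"
    using finite_subset_image[of "range Q" Q UNIV] by blast
  then obtain u where covers: "\<forall>x \<in> F. E x u" using finite_covered by blast
  have "E x u" for x
  proof -
    obtain y where same_class: "y \<in> F" "Q x = Q y" using F_image by blast
    then have "Q y x" using Q_refl[of x] by simp
    then show ?thesis using E_cong[OF _ Q_refl] covers same_class(1) by blast
  qed
  then show False using no_universal_set by blast
qed

end

lemma zfc_model_if_axioms_true:
  assumes "\<And>a e. zfc_axiom a \<Longrightarrow> eval (=) E c e a"
  shows "zfc_model (=) E c"
proof
  show "eval (=) E c e a" if "{} \<turnstile> a" for a e
    using that
    by (induction "{} :: fm set" a arbitrary: e rule: entails.induct)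
      (auto intro: assms logical_axiom_valid)
qed

lemma eval_quotient:
  assumes "surj h" "\<And>x y. h x = h y \<longleftrightarrow> Q x y" "\<And>x y. E' (h x) (h y) \<longleftrightarrow> E x y"
  shows "eval Q E c e a \<longleftrightarrow> eval (=) E' (h c) (h \<circ> e) a"
proof (induction a arbitrary: e)
  have val: "val (h c) (\<lambda>x. h (e x)) u = h (val c e u)" for u e by (cases u) auto
  {
    case (Eq s t)
    then show ?case using assms(2) by (simp add: val)
  next
    case (Mem s t)
    then show ?case using assms(3) by (simp add: val)
  next
    case (All x a)
    have "eval Q E c e (All x a) \<longleftrightarrow> (\<forall>d. eval (=) E' (h c) ((h \<circ> e)(x := h d)) a)"
      by (simp only: eval.simps All fun_upd_comp)
    also have "\<dots> \<longleftrightarrow> (\<forall>d. eval (=) E' (h c) ((h \<circ> e)(x := d)) a)"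
      using assms(1) by (metis surjD)
    finally show ?case by (simp only: eval.simps)
  }
qed simp_all

lemma zfc_model_nat:
  fixes c :: "'a :: countable"
  assumes "zfc_model Q E c"
  obtains h :: "'a \<Rightarrow> nat" and E' where "zfc_model (=) E' (h c)"
    "\<And>e a. eval Q E c e a \<longleftrightarrow> eval (=) E' (h c) (h \<circ> e) a"
proof -
  interpret zfc_model Q E c by (rule assms)
  define h where "h x = to_nat_on (range Q) (Q x)" for x
  define E' where "E' m n \<longleftrightarrow> E (inv h m) (inv h n)" for m n
  have bij: "bij_betw (to_nat_on (range Q)) (range Q) UNIV"
    by (intro to_nat_on_infinite infinite_classes) simp
  have surj: "surj h"
    using bij unfolding h_def bij_betw_def by (metis image_image)
  have "Q x = Q y" if "Q x y" for x y
    using that Q_sym Q_euclid by blast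
  then have "Q x = Q y \<longleftrightarrow> Q x y" for x y
    using Q_refl by metis
  then have h_eq: "h x = h y \<longleftrightarrow> Q x y" for x y
    unfolding h_def using inj_on_eq_iff[OF bij_betw_imp_inj_on[OF bij]] by blast
  have "Q (inv h (h x)) x" for x using h_eq surj by (metis surj_f_inv_f)
  then have "E' (h x) (h y) \<longleftrightarrow> E x y" for x y
    unfolding E'_def using E_cong Q_sym by metis
  then have eval_iff: "eval Q E c e a \<longleftrightarrow> eval (=) E' (h c) (h \<circ> e) a" for e a
    by (rule eval_quotient[OF surj h_eq])
  have "zfc_model (=) E' (h c)"
  proof
    fix a e assume "{} \<turnstile> a"
    have "h \<circ> (inv h \<circ> e) = e" for e :: "nat \<Rightarrow> nat" using surj by (auto simp: surj_f_inv_f)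
    then show "eval (=) E' (h c) e a"
      using eval_iff[of "inv h \<circ> e" a] theorem_true[OF \<open>{} \<turnstile> a\<close>, of "inv h \<circ> e"] by (simp only:)
  qed
  then show thesis using eval_iff that by blast
qed

theorem completeness:
  assumes "\<And>(E :: nat \<Rightarrow> nat \<Rightarrow> bool) c e. zfc_model (=) E c \<Longrightarrow> eval (=) E c e a"
  shows "{} \<turnstile> a"
proof (rule entails_ccontr, rule notI)
  assume "consistent {Neg a}"
  let ?\<Delta> = "henkin_extension {Neg a}"
  interpret henkin ?\<Delta> using \<open>consistent {Neg a}\<close> by (intro henkin_henkin_extension) simp
  have "zfc_model (\<lambda>s t. Eq s t \<in> ?\<Delta>) (\<lambda>s t. Mem s t \<in> ?\<Delta>) Ct"
    by unfold_locales (rule term_eval_theorem)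
  then obtain h :: "tm \<Rightarrow> nat" and E' where model: "zfc_model (=) E' (h Ct)"
    and eval_iff: "\<And>e a. term_eval e a \<longleftrightarrow> eval (=) E' (h Ct) (h \<circ> e) a"
    by (rule zfc_model_nat) blast
  have "Neg a \<in> ?\<Delta>" using henkin_stage_subset[of "{Neg a}" 0] by simp
  then have "\<not> term_eval Var a" using term_eval_iff_mem Neg_mem_iff by blast
  then show False using assms[OF model] eval_iff by blast
qed


section \<open>Eliminating the constant\<close>

primrec replace_Ct_tm :: "nat \<Rightarrow> tm \<Rightarrow> tm" where
  "replace_Ct_tm z (Var n) = Var n"
| "replace_Ct_tm z Ct = Var z"

primrec replace_Ct :: "nat \<Rightarrow> fm \<Rightarrow> fm" where
  "replace_Ct z (Eq s t) = Eq (replace_Ct_tm z s) (replace_Ct_tm z t)"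
| "replace_Ct z (Mem s t) = Mem (replace_Ct_tm z s) (replace_Ct_tm z t)"
| "replace_Ct z (Neg a) = Neg (replace_Ct z a)"
| "replace_Ct z (Imp a b) = Imp (replace_Ct z a) (replace_Ct z b)"
| "replace_Ct z (All x a) = All x (replace_Ct z a)"

lemma replace_Ct_connectives [simp]:
  "replace_Ct z (And a b) = And (replace_Ct z a) (replace_Ct z b)"
  "replace_Ct z (Iff a b) = Iff (replace_Ct z a) (replace_Ct z b)"
  "replace_Ct z (Ex x a) = Ex x (replace_Ct z a)"
  by (auto simp: And_def Iff_def Ex_def)

lemma fv_connectives [simp]:
  "fv (And a b) = fv a \<union> fv b" "fv (Iff a b) = fv a \<union> fv b" "fv (Ex x a) = fv a - {x}"
  by (auto simp: And_def Iff_def Ex_def)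

lemma bound_vars_connectives [simp]:
  "bound_vars (And a b) = bound_vars a \<union> bound_vars b"
  "bound_vars (Iff a b) = bound_vars a \<union> bound_vars b"
  "bound_vars (Ex x a) = insert x (bound_vars a)"
  by (auto simp: And_def Iff_def Ex_def)

lemma t_free_connectives [simp]:
  "t_free (And a b) \<longleftrightarrow> t_free a \<and> t_free b"
  "t_free (Or a b) \<longleftrightarrow> t_free a \<and> t_free b"
  "t_free (Iff a b) \<longleftrightarrow> t_free a \<and> t_free b"
  "t_free (Ex x a) \<longleftrightarrow> t_free a"
  "t_free Bot"
  by (auto simp: And_def Or_def Iff_def Ex_def Bot_def)

lemma replace_Ct_tm_neq_Ct [simp]: "replace_Ct_tm z s \<noteq> Ct" "Ct \<noteq> replace_Ct_tm z s"
  by (cases s; simp)+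

lemma Var_eq_replace_Ct_tm_iff: "Var x = replace_Ct_tm z s \<longleftrightarrow> s = Var x \<or> s = Ct \<and> x = z"
  by (cases s) auto

lemma t_free_replace_Ct [simp]: "t_free (replace_Ct z a)"
  by (induction a) auto

lemma replace_Ct_t_free: "t_free a \<Longrightarrow> replace_Ct z a = a"
proof -
  have "s \<noteq> Ct \<Longrightarrow> replace_Ct_tm z s = s" for s by (cases s) auto
  then show "t_free a \<Longrightarrow> replace_Ct z a = a" by (induction a) auto
qed

lemma bound_vars_replace_Ct [simp]: "bound_vars (replace_Ct z a) = bound_vars a"
  by (induction a) auto

lemma fv_replace_Ct: "fv (replace_Ct z a) \<subseteq> insert z (fv a)"
  by (induction a) (auto simp: Var_eq_replace_Ct_tm_iff)

lemma eval_replace_Ct: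
  "z \<notin> bound_vars a \<Longrightarrow> eval Q E c e (replace_Ct z a) \<longleftrightarrow> eval Q E (e z) e a"
proof (induction a arbitrary: e)
  have val: "val c e (replace_Ct_tm z u) = val (e z) e u" for u e by (cases u) auto
  {
    case (Eq s t)
    then show ?case by (simp add: val)
  next
    case (Mem s t)
    then show ?case by (simp add: val)
  }
qed auto

lemma replace_Ct_subst:
  assumes "x \<noteq> z"
  shows "replace_Ct z (subst x u a) = subst x (replace_Ct_tm z u) (replace_Ct z a)"
proof -
  have "replace_Ct_tm z (substt x u s) = substt x (replace_Ct_tm z u) (replace_Ct_tm z s)" for s
    using assms by (cases s) (auto simp: substt_def)
  then show ?thesis by (induction a) auto
qed

lemma free_for_replace_Ct:
  assumes "free_for u x a" "z \<notin> bound_vars a" "x \<noteq> z"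
  shows "free_for (replace_Ct_tm z u) x (replace_Ct z a)"
proof (cases u)
  case (Var v)
  then show ?thesis
    using assms(1,2) fv_replace_Ct[of z] assms(3) by (induction a) auto
next
  case Ct
  then show ?thesis using assms(2) by (simp add: free_for_notin_bound_vars)
qed

lemma logical_axiom_replace_Ct:
  "logical_axiom a \<Longrightarrow> z \<notin> vars a \<Longrightarrow> logical_axiom (replace_Ct z a)"
proof (induction rule: logical_axiom.induct)
  case (4 u x a)
  then show ?case by (simp add: replace_Ct_subst free_for_replace_Ct logical_axiom.intros)
next
  case (5 x a b)
  then have "x \<notin> fv (replace_Ct z a)" using fv_replace_Ct[of z a] by auto
  then show ?case by (simp add: logical_axiom.intros)
qed (auto intro: logical_axiom.intros)

lemma t_free_zfc_single: "a \<in> set zfc_single \<Longrightarrow> t_free a"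
  by (auto simp: zfc_single_def iterated_quantifier_defs all_def ex_def upair_fm_def sub_fm_def
      inductive_fm_def empty_fm_def succ_fm_def)

lemma zfc_axiom_replace_Ct: "zfc_axiom a \<Longrightarrow> z \<notin> vars a \<Longrightarrow> zfc_axiom (replace_Ct z a)"
proof (induction rule: zfc_axiom.induct)
  case (single a)
  then show ?case using t_free_zfc_single replace_Ct_t_free zfc_axiom.single by metis
next
  case (separation x y w a)
  then have "y \<notin> fv (replace_Ct z a)" using fv_replace_Ct[of z a] by auto
  then show ?case using separation by (simp add: zfc_axiom.separation)
next
  case (replacement x y w u a)
  then have "u \<notin> fv (replace_Ct z a)" using fv_replace_Ct[of z a] by auto
  then show ?case using replacement by (simp add: zfc_axiom.replacement)
qed

lemma zfc_model_any_constant: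
  assumes "zfc_model (=) E c"
  shows "zfc_model (=) E t"
proof (rule zfc_model_if_axioms_true)
  interpret zfc_model "(=)" E c by (rule assms)
  fix a e assume "zfc_axiom a"
  obtain z where z_fresh: "z \<notin> vars a" using ex_notin_finite[of "vars a"] by auto
  have "eval (=) E c (e(z := t)) (replace_Ct z a)"
    using z_fresh \<open>zfc_axiom a\<close> by (intro theorem_true entails.zfc zfc_axiom_replace_Ct) simp_all
  then show "eval (=) E t e a" using z_fresh by (simp add: eval_replace_Ct)
qed

abbreviation ZFC :: rec_theory where
  "ZFC \<equiv> ({}, \<lambda>_. False)"

definition derivation :: "fm list \<Rightarrow> bool" where
  "derivation \<pi> \<longleftrightarrow> (\<forall>i < length \<pi>. \<exists>J. justifies ZFC \<pi> i J)"

lemma proves_ZFC_iff: "proves ZFC \<pi> a \<longleftrightarrow> derivation \<pi> \<and> \<pi> \<noteq> [] \<and> last \<pi> = a"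
  by (auto simp: proves_def derivation_def)

lemma proves_ZFC_mem: "proves ZFC \<pi> a \<Longrightarrow> derivation \<pi> \<and> a \<in> set \<pi>"
  by (auto simp: proves_ZFC_iff)

lemma justifies_append_left:
  "i < length \<pi> \<Longrightarrow> justifies ZFC \<pi> i J \<Longrightarrow> justifies ZFC (\<pi> @ \<sigma>) i J"
  by (cases J) (auto simp: nth_append)

lemma justifies_append_right:
  assumes "i < length \<sigma>" "justifies ZFC \<sigma> i J"
  shows "\<exists>J. justifies ZFC (\<pi> @ \<sigma>) (length \<pi> + i) J"
proof (cases J)
  case (MP_J j k)
  then have "justifies ZFC (\<pi> @ \<sigma>) (length \<pi> + i) (MP_J (length \<pi> + j) (length \<pi> + k))"
    using assms by (auto simp: nth_append)
  then show ?thesis ..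
next
  case (Gen_J j k)
  then have "justifies ZFC (\<pi> @ \<sigma>) (length \<pi> + i) (Gen_J (length \<pi> + j) k)"
    using assms by (auto simp: nth_append)
  then show ?thesis ..
qed (use assms in \<open>auto intro: exI[of _ Log_J] exI[of _ ZFC_J]\<close>)

lemma derivation_append:
  assumes "derivation \<pi>" "derivation \<sigma>"
  shows "derivation (\<pi> @ \<sigma>)"
  unfolding derivation_def
proof (intro allI impI)
  fix i assume i: "i < length (\<pi> @ \<sigma>)"
  show "\<exists>J. justifies ZFC (\<pi> @ \<sigma>) i J"
  proof (cases "i < length \<pi>")
    case True
    then show ?thesis using assms(1) justifies_append_left unfolding derivation_def by blast
  next
    case False
    then have "i - length \<pi> < length \<sigma>" "i = length \<pi> + (i - length \<pi>)" using i by auto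
    then show ?thesis using assms(2) justifies_append_right unfolding derivation_def by metis
  qed
qed

lemma proves_snoc:
  assumes "derivation \<pi>" "justifies ZFC (\<pi> @ [a]) (length \<pi>) J"
  shows "proves ZFC (\<pi> @ [a]) a"
  using assms justifies_append_left
  by (auto simp: proves_ZFC_iff derivation_def less_Suc_eq) blast

lemma entails_proves: "{} \<turnstile> a \<Longrightarrow> \<exists>\<pi>. proves ZFC \<pi> a"
proof (induction "{} :: fm set" a rule: entails.induct)
  case (logical a)
  then show ?case using proves_snoc[of "[]" a Log_J] by (auto simp: derivation_def)
next
  case (zfc a)
  then show ?case using proves_snoc[of "[]" a ZFC_J] by (auto simp: derivation_def)
next
  case (mp a b)
  then obtain \<pi> \<sigma> where "proves ZFC \<pi> (Imp a b)" "proves ZFC \<sigma> a" by blast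
  then have "derivation (\<pi> @ \<sigma>)" "Imp a b \<in> set (\<pi> @ \<sigma>)" "a \<in> set (\<pi> @ \<sigma>)"
    using proves_ZFC_mem derivation_append by fastforce+
  moreover from this obtain j k where
    "j < length (\<pi> @ \<sigma>)" "(\<pi> @ \<sigma>) ! j = Imp a b" "k < length (\<pi> @ \<sigma>)" "(\<pi> @ \<sigma>) ! k = a"
    by (metis in_set_conv_nth)
  then have "justifies ZFC ((\<pi> @ \<sigma>) @ [b]) (length (\<pi> @ \<sigma>)) (MP_J j k)"
    by (simp add: nth_append del: append_assoc)
  ultimately show ?case using proves_snoc by blast
next
  case (gen a x)
  then obtain \<pi> where "proves ZFC \<pi> a" by blast
  then have "derivation \<pi>" "a \<in> set \<pi>" using proves_ZFC_mem by blast+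
  moreover from this obtain j where "j < length \<pi>" "\<pi> ! j = a" by (metis in_set_conv_nth)
  then have "justifies ZFC (\<pi> @ [All x a]) (length \<pi>) (Gen_J j x)" by (simp add: nth_append)
  ultimately show ?case using proves_snoc by blast
qed simp

lemma justifies_replace_Ct:
  assumes "justifies ZFC \<pi> i J" "i < length \<pi>" "\<And>b. b \<in> set \<pi> \<Longrightarrow> z \<notin> vars b"
  shows "justifies ZFC (map (replace_Ct z) \<pi>) i J"
  using assms by (cases J) (auto simp: logical_axiom_replace_Ct zfc_axiom_replace_Ct)

theorem zfc_provable_if_entails:
  assumes "{} \<turnstile> a" "t_free a"
  shows "zfc_provable a"
proof -
  obtain \<pi> where \<pi>: "derivation \<pi>" "\<pi> \<noteq> []" "last \<pi> = a"
    using entails_proves[OF assms(1)] by (auto simp: proves_ZFC_iff)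
  obtain z where "z \<notin> \<Union> (vars ` set \<pi>)" using ex_notin_finite[of "\<Union> (vars ` set \<pi>)"] by auto
  then have "derivation (map (replace_Ct z) \<pi>)"
    using \<pi>(1) justifies_replace_Ct[of \<pi> _ _ z] unfolding derivation_def by fastforce
  then have "proves ZFC (map (replace_Ct z) \<pi>) a"
    using \<pi>(2,3) replace_Ct_t_free[OF assms(2)] by (simp add: proves_ZFC_iff last_map)
  then show ?thesis unfolding zfc_provable_def
    by (intro exI[of _ "map (replace_Ct z) \<pi>"]) auto
qed


section \<open>Definable predicates in a model\<close>

primrec rename_tm :: "(nat \<Rightarrow> nat) \<Rightarrow> tm \<Rightarrow> tm" where
  "rename_tm f (Var n) = Var (f n)"
| "rename_tm f Ct = Ct"

primrec rename :: "(nat \<Rightarrow> nat) \<Rightarrow> fm \<Rightarrow> fm" where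
  "rename f (Eq s t) = Eq (rename_tm f s) (rename_tm f t)"
| "rename f (Mem s t) = Mem (rename_tm f s) (rename_tm f t)"
| "rename f (Neg a) = Neg (rename f a)"
| "rename f (Imp a b) = Imp (rename f a) (rename f b)"
| "rename f (All x a) = All (f x) (rename f a)"

lemma eval_rename:
  assumes "inj f"
  shows "eval Q E c e (rename f a) \<longleftrightarrow> eval Q E c (e \<circ> f) a"
proof (induction a arbitrary: e)
  have val: "val c e (rename_tm f s) = val c (\<lambda>n. e (f n)) s" for s e by (cases s) auto
  {
    case (Eq s t)
    then show ?case by (simp add: val)
  next
    case (Mem s t)
    then show ?case by (simp add: val)
  next
    case (All x a)
    have "e(f x := d) \<circ> f = (e \<circ> f)(x := d)" for e :: "nat \<Rightarrow> 'a" and d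
      using assms by (auto simp: fun_eq_iff dest: injD)
    then show ?case by (simp only: rename.simps eval.simps All)
  }
qed simp_all

locale zf = zfc_model "(=)" E c0
  for E :: "'a \<Rightarrow> 'a \<Rightarrow> bool" (infix "\<epsilon>" 50) and c0 :: 'a
begin

abbreviation sat :: "'a \<Rightarrow> (nat \<Rightarrow> 'a) \<Rightarrow> fm \<Rightarrow> bool" where
  "sat \<equiv> eval (=) E"

text \<open>Environments are indexed by de Bruijn indices, so that the closure rules apply to HOL formulas
  without a choice of variable names.  In the defining formula, the even variables denote the
  environment and the odd variables denote parameters.\<close>

definition join :: "(nat \<Rightarrow> 'a) \<Rightarrow> (nat \<Rightarrow> 'a) \<Rightarrow> nat \<Rightarrow> 'a" where
  "join e p = case_sum e p \<circ> sum_decode"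

definition definable :: "((nat \<Rightarrow> 'a) \<Rightarrow> bool) \<Rightarrow> bool" where
  "definable P \<longleftrightarrow> (\<exists>a p. \<forall>e. P e \<longleftrightarrow> sat c0 (join e p) a)"

lemma join_upd_0: "(join e p)(0 := x) = join (e(0 := x)) p"
  by (auto simp: join_def fun_eq_iff sum_decode_def elim: evenE)

lemma definableI:
  assumes "inj f" "\<And>e. P e \<longleftrightarrow> sat c0 (join e p \<circ> f) a"
  shows "definable P"
  unfolding definable_def using assms by (metis eval_rename)

lemma definable_sat: "definable (\<lambda>e. sat c0 e a)"
proof (rule definableI)
  show "inj (\<lambda>n. sum_encode (Inl n))" by (simp add: inj_def sum_encode_eq)
  show "sat c0 e a \<longleftrightarrow> sat c0 (join e (\<lambda>_. c0) \<circ> (\<lambda>n. sum_encode (Inl n))) a" for e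
    by (simp add: join_def comp_def)
qed

lemma definable_rename:
  assumes "definable P" "inj v"
  shows "definable (\<lambda>e. P (\<lambda>n. e (v n)))"
proof -
  obtain a p where P_iff: "\<And>e. P e \<longleftrightarrow> sat c0 (join e p) a"
    using assms(1) unfolding definable_def by blast
  let ?f = "sum_encode \<circ> map_sum v id \<circ> sum_decode"
  show ?thesis
  proof (rule definableI)
    show "inj ?f"
      using assms(2) by (intro inj_compose inj_sum_encode inj_sum_decode sum.inj_map) simp_all
    have "join (\<lambda>n. e (v n)) p = join e p \<circ> ?f" for e
      by (auto simp: join_def fun_eq_iff split: sum.split)
    then show "P (\<lambda>n. e (v n)) \<longleftrightarrow> sat c0 (join e p \<circ> ?f) a" for e unfolding P_iff by simp
  qed
qed

lemma definable_not: "definable P \<Longrightarrow> definable (\<lambda>e. \<not> P e)"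
  unfolding definable_def by (metis eval.simps(3))

lemma definable_imp:
  assumes "definable P" "definable P'"
  shows "definable (\<lambda>e. P e \<longrightarrow> P' e)"
proof -
  obtain a p where P_iff: "\<And>e. P e \<longleftrightarrow> sat c0 (join e p) a"
    using assms(1) unfolding definable_def by blast
  obtain a' p' where P'_iff: "\<And>e. P' e \<longleftrightarrow> sat c0 (join e p') a'"
    using assms(2) unfolding definable_def by blast
  let ?params = "\<lambda>inj. sum_encode \<circ> map_sum id (sum_encode \<circ> inj) \<circ> sum_decode"
  have inj: "inj (?params i)" if "inj i" for i
    using that by (intro inj_compose inj_sum_encode inj_sum_decode sum.inj_map) simp_all
  have "join e (join p p') \<circ> ?params Inl = join e p"
    "join e (join p p') \<circ> ?params Inr = join e p'" for e
    by (auto simp: join_def fun_eq_iff split: sum.split)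
  then have "P e \<longleftrightarrow> sat c0 (join e (join p p')) (rename (?params Inl) a)"
    "P' e \<longleftrightarrow> sat c0 (join e (join p p')) (rename (?params Inr) a')" for e
    by (simp_all only: P_iff P'_iff eval_rename inj inj_Inl inj_Inr)
  then show ?thesis unfolding definable_def
    by (intro exI[of _ "Imp (rename (?params Inl) a) (rename (?params Inr) a')"]
        exI[of _ "join p p'"]) simp
qed

lemma definable_All_case_nat:
  assumes "definable P"
  shows "definable (\<lambda>e. \<forall>x. P (case_nat x e))"
proof -
  obtain a p where P_iff: "\<And>e. P e \<longleftrightarrow> sat c0 (join e p) a"
    using assms unfolding definable_def by blast
  let ?g = "case_sum (case_nat (Inr 0) Inl) (\<lambda>n. Inr (Suc n))"
  let ?f = "sum_encode \<circ> ?g \<circ> sum_decode"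
  have "inj ?g" by (intro injI) (auto split: sum.splits nat.splits)
  then have inj_f: "inj ?f" by (intro inj_compose inj_sum_encode inj_sum_decode)
  have "join (case_nat x e) p = (join e (case_nat c0 p))(sum_encode (Inr 0) := x) \<circ> ?f" for e x
    by (auto simp: join_def fun_eq_iff sum_encode_eq split: sum.split nat.split)
  then have "(\<forall>x. P (case_nat x e)) \<longleftrightarrow>
      sat c0 (join e (case_nat c0 p)) (All (sum_encode (Inr 0)) (rename ?f a))" for e
    by (simp add: P_iff eval_rename[OF inj_f] del: fun_upd_apply)
  then show ?thesis unfolding definable_def by blast
qed

lemma definable_all:
  "definable (\<lambda>e. P (\<lambda>n. e (Suc n)) (e 0)) \<Longrightarrow> definable (\<lambda>e. \<forall>x. P e x)"
  using definable_All_case_nat[of "\<lambda>e. P (\<lambda>n. e (Suc n)) (e 0)"] by simp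

lemma definable_conj: "definable P \<Longrightarrow> definable P' \<Longrightarrow> definable (\<lambda>e. P e \<and> P' e)"
  using definable_not[OF definable_imp[OF _ definable_not, of P P']] by simp

lemma definable_disj: "definable P \<Longrightarrow> definable P' \<Longrightarrow> definable (\<lambda>e. P e \<or> P' e)"
  using definable_imp[OF definable_not, of P P'] by (simp add: disj_imp)

lemma definable_iff: "definable P \<Longrightarrow> definable P' \<Longrightarrow> definable (\<lambda>e. P e \<longleftrightarrow> P' e)"
  using definable_conj[OF definable_imp definable_imp, of P P' P' P]
  by (simp add: iff_conv_conj_imp)

lemma definable_ex:
  "definable (\<lambda>e. P (\<lambda>n. e (Suc n)) (e 0)) \<Longrightarrow> definable (\<lambda>e. \<exists>x. P e x)"
  using definable_not[OF definable_all[of "\<lambda>e x. \<not> P e x", OF definable_not]] by simp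

lemma definable_const: "definable (\<lambda>e. p)"
proof -
  have "definable (\<lambda>e. True)" using definable_sat[of "Eq (Var 0) (Var 0)"] by simp
  then show ?thesis using definable_not[of "\<lambda>e. True"] by (cases p) auto
qed

lemma definable_finite_bex:
  "finite S \<Longrightarrow> (\<And>n. n \<in> S \<Longrightarrow> definable (P n)) \<Longrightarrow> definable (\<lambda>e. \<exists>n \<in> S. P n e)"
proof (induction S rule: finite_induct)
  case empty
  show ?case using definable_const[of False] by simp
next
  case (insert n S)
  then have "definable (\<lambda>e. P n e \<or> (\<exists>n \<in> S. P n e))" by (intro definable_disj) simp_all
  then show ?case by simp
qed

definition definable_fun :: "((nat \<Rightarrow> 'a) \<Rightarrow> 'a) \<Rightarrow> bool" where
  "definable_fun f \<longleftrightarrow> definable (\<lambda>e. e 0 = f (\<lambda>n. e (Suc n)))"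

lemma definable_fun_var: "definable_fun (\<lambda>e. e n)"
  unfolding definable_fun_def using definable_sat[of "Eq (Var 0) (Var (Suc n))"] by simp

lemma definable_fun_const: "definable_fun (\<lambda>e. c)"
  unfolding definable_fun_def definable_def
  by (intro exI[of _ "Eq (Var (sum_encode (Inl 0))) (Var (sum_encode (Inr 0)))"] exI[of _ "\<lambda>_. c"])
    (simp add: join_def)

lemma definable_fun_shift:
  assumes "definable_fun f"
  shows "definable_fun (\<lambda>e. f (\<lambda>n. e (Suc n)))"
  unfolding definable_fun_def
  using definable_rename[OF assms[unfolded definable_fun_def], of "case_nat 0 (\<lambda>n. Suc (Suc n))"]
  by (simp add: inj_def split: nat.split)

lemma definable_subst:
  assumes "definable (\<lambda>e. P (\<lambda>n. e (Suc n)) (e 0))" "definable_fun f"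
  shows "definable (\<lambda>e. P e (f e))"
proof -
  have "definable (\<lambda>e. \<exists>x. x = f e \<and> P e x)"
    by (rule definable_ex, rule definable_conj) (use assms in \<open>simp_all add: definable_fun_def\<close>)
  then show ?thesis by simp
qed

lemma definable_subst2:
  assumes "definable (\<lambda>e. P (\<lambda>n. e (Suc (Suc n))) (e 0) (e 1))" "definable_fun f" "definable_fun g"
  shows "definable (\<lambda>e. P e (f e) (g e))"
proof -
  have "definable (\<lambda>e. P (\<lambda>n. e (Suc (Suc n))) (e 1) (e 0))"
    using definable_rename[OF assms(1), of "\<lambda>n. if n = 0 then 1 else if n = 1 then 0 else n"]
    by (simp add: inj_def)
  then have "definable (\<lambda>e. P (\<lambda>n. e (Suc n)) (e 0) (g (\<lambda>n. e (Suc n))))"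
    using definable_subst[of "\<lambda>e. P (\<lambda>n. e (Suc n)) (e 0)" "\<lambda>e. g (\<lambda>n. e (Suc n))"]
      definable_fun_shift[OF assms(3)] by simp
  then show ?thesis using definable_subst[of "\<lambda>e x. P e x (g e)", OF _ assms(2)] by simp
qed

lemma definable_fun_subst2:
  assumes "definable (\<lambda>e. e 2 = F (e 0) (e 1))" "definable_fun f" "definable_fun g"
  shows "definable_fun (\<lambda>e. F (f e) (g e))"
  unfolding definable_fun_def
proof (rule definable_subst2[of "\<lambda>e x y. e 0 = F x y"])
  show "definable (\<lambda>e. e (Suc (Suc 0)) = F (e 0) (e 1))"
    using assms(1) by (simp only: numeral_2_eq_2)
qed (intro definable_fun_shift assms(2,3))+

lemma definable_eq: "definable_fun f \<Longrightarrow> definable_fun g \<Longrightarrow> definable (\<lambda>e. f e = g e)"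
  by (rule definable_subst2) (use definable_sat[of "Eq (Var 0) (Var 1)"] in simp_all)

lemma definable_mem: "definable_fun f \<Longrightarrow> definable_fun g \<Longrightarrow> definable (\<lambda>e. f e \<epsilon> g e)"
  by (rule definable_subst2) (use definable_sat[of "Mem (Var 0) (Var 1)"] in simp_all)

lemma separation:
  assumes "definable (\<lambda>e. P (e 0))"
  obtains y where "\<And>x. x \<epsilon> y \<longleftrightarrow> x \<epsilon> z \<and> P x"
proof -
  obtain a p where P_iff: "\<And>e. P (e 0) \<longleftrightarrow> sat c0 (join e p) a"
    using assms unfolding definable_def by blast
  obtain y' where y'_fresh: "y' \<notin> insert 0 (fv a)"
    using ex_notin_finite[of "insert 0 (fv a)"] by auto
  obtain z' where z'_fresh: "z' \<notin> {0, y'} \<union> fv a"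
    using ex_notin_finite[of "{0, y'} \<union> fv a"] by auto
  have "{} \<turnstile> Ex y' (All 0 (Iff (Mem (Var 0) (Var y')) (And (Mem (Var 0) (Var z')) a)))"
    by (intro entails.zfc zfc_axiom.separation) (use y'_fresh z'_fresh in auto)
  from theorem_true[OF this, of "(join (\<lambda>_. c0) p)(z' := z)"] obtain y where
    mem_y: "\<And>x. x \<epsilon> y \<longleftrightarrow> x \<epsilon> z \<and> sat c0 ((join (\<lambda>_. c0) p)(z' := z, y' := y, 0 := x)) a"
    using y'_fresh z'_fresh by auto
  have "sat c0 ((join (\<lambda>_. c0) p)(z' := z, y' := y, 0 := x)) a \<longleftrightarrow> P x" for x
  proof -
    have "sat c0 ((join (\<lambda>_. c0) p)(z' := z, y' := y, 0 := x)) a \<longleftrightarrow>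
        sat c0 ((join (\<lambda>_. c0) p)(0 := x)) a"
      using y'_fresh z'_fresh by (intro eval_cong) auto
    then show ?thesis using P_iff[of "(\<lambda>_. c0)(0 := x)"] by (simp only: join_upd_0 fun_upd_same)
  qed
  then show thesis using that mem_y by blast
qed

end


section \<open>Set theory in a model\<close>

context zf
begin

lemma extensionality: "(\<And>z. z \<epsilon> x \<longleftrightarrow> z \<epsilon> y) \<Longrightarrow> x = y"
  using zfc_single_true[of "zfc_single ! 0" "\<lambda>_. c0"]
  by (simp add: zfc_single_def iterated_quantifier_defs)

lemma sat_Bot [simp]: "\<not> sat t e Bot"
  by (simp add: Bot_def)

lemma sat_Conj [simp]: "sat t e (Conj as) \<longleftrightarrow> (\<forall>a \<in> set as. sat t e a)"
  unfolding Conj_def by (induction as) auto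

lemma sat_Disj [simp]: "sat t e (Disj as) \<longleftrightarrow> (\<exists>a \<in> set as. sat t e a)"
  unfolding Disj_def by (induction as) auto

definition the_set :: "('a \<Rightarrow> bool) \<Rightarrow> 'a" where
  "the_set P = (THE y. \<forall>x. x \<epsilon> y \<longleftrightarrow> P x)"

lemma the_set:
  assumes "\<exists>y. \<forall>x. x \<epsilon> y \<longleftrightarrow> P x"
  shows mem_the_set: "x \<epsilon> the_set P \<longleftrightarrow> P x"
    and eq_the_set_iff: "(\<forall>x. x \<epsilon> y \<longleftrightarrow> P x) \<longleftrightarrow> y = the_set P"
proof -
  have "\<exists>!y. \<forall>x. x \<epsilon> y \<longleftrightarrow> P x" using assms extensionality by (simp add: Ex1_def) metis
  from theI'[OF this] have mem: "\<forall>x. x \<epsilon> the_set P \<longleftrightarrow> P x" unfolding the_set_def .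
  then show "x \<epsilon> the_set P \<longleftrightarrow> P x" ..
  show "(\<forall>x. x \<epsilon> y \<longleftrightarrow> P x) \<longleftrightarrow> y = the_set P"
    using mem extensionality[of y "the_set P"] by auto
qed

definition emp :: "'a" where
  "emp = the_set (\<lambda>z. False)"

definition upair :: "'a \<Rightarrow> 'a \<Rightarrow> 'a" where
  "upair x y = the_set (\<lambda>z. z = x \<or> z = y)"

definition bigunion :: "'a \<Rightarrow> 'a" where
  "bigunion x = the_set (\<lambda>z. \<exists>w. z \<epsilon> w \<and> w \<epsilon> x)"

definition pow :: "'a \<Rightarrow> 'a" where
  "pow x = the_set (\<lambda>z. \<forall>w. w \<epsilon> z \<longrightarrow> w \<epsilon> x)"

definition suc :: "'a \<Rightarrow> 'a" where
  "suc x = the_set (\<lambda>z. z \<epsilon> x \<or> z = x)"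

definition pair :: "'a \<Rightarrow> 'a \<Rightarrow> 'a" where
  "pair x y = upair (upair x x) (upair x y)"

lemma ex_emp: "\<exists>y. \<forall>z. z \<epsilon> y \<longleftrightarrow> False"
  by (rule separation[of "\<lambda>_. False"]) (use definable_const in auto)

lemmas mem_emp [simp] = mem_the_set[OF ex_emp, folded emp_def, simplified]
lemmas eq_emp_iff = eq_the_set_iff[OF ex_emp, folded emp_def, simplified]

lemmas mem_upair [simp] = mem_the_set[OF pairing, folded upair_def]
lemmas eq_upair_iff = eq_the_set_iff[OF pairing, folded upair_def]

lemmas mem_bigunion [simp] = mem_the_set[OF union, folded bigunion_def]

lemma power_set: "\<exists>p. \<forall>z. z \<epsilon> p \<longleftrightarrow> (\<forall>w. w \<epsilon> z \<longrightarrow> w \<epsilon> x)"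
  using zfc_single_true[of "zfc_single ! 3" "\<lambda>_. c0"] by (simp add: zfc_single_def sub_fm_def)

lemmas mem_pow [simp] = mem_the_set[OF power_set, folded pow_def]

lemma ex_suc: "\<exists>y. \<forall>z. z \<epsilon> y \<longleftrightarrow> z \<epsilon> x \<or> z = x"
  by (rule exI[of _ "bigunion (upair x (upair x x))"])
    (auto simp: conj_disj_distribL ex_disj_distrib)

lemmas mem_suc [simp] = mem_the_set[OF ex_suc, folded suc_def]
lemmas eq_suc_iff = eq_the_set_iff[OF ex_suc, folded suc_def]

lemma upair_eq_iff: "upair x y = upair u v \<longleftrightarrow> x = u \<and> y = v \<or> x = v \<and> y = u"
proof
  assume "upair x y = upair u v"
  then have "z = x \<or> z = y \<longleftrightarrow> z = u \<or> z = v" for z using mem_upair by metis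
  then show "x = u \<and> y = v \<or> x = v \<and> y = u" by metis
qed (auto intro: extensionality)

lemma pair_eq_iff [simp]: "pair x y = pair u v \<longleftrightarrow> x = u \<and> y = v"
  unfolding pair_def upair_eq_iff by auto

lemma suc_neq_emp [simp]: "suc x \<noteq> emp" "emp \<noteq> suc x"
  using mem_suc[of x x] mem_emp[of x] by metis+

lemma sat_empty [simp]: "sat t e (empty_fm u) \<longleftrightarrow> val t e u = emp"
  by (simp add: empty_fm_def eq_emp_iff)

lemma sat_succ [simp]: "sat t e (succ_fm u v) \<longleftrightarrow> val t e v = suc (val t e u)"
  by (simp add: succ_fm_def eq_suc_iff)

lemma sat_upair [simp]: "sat t e (upair_fm u v p) \<longleftrightarrow> val t e p = upair (val t e u) (val t e v)"
  by (simp add: upair_fm_def eq_upair_iff)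

lemma sat_pair [simp]: "sat t e (pair_fm u v p) \<longleftrightarrow> val t e p = pair (val t e u) (val t e v)"
  by (simp add: pair_fm_def pair_def iterated_quantifier_defs)

lemma definable_fun_pair:
  "definable_fun f \<Longrightarrow> definable_fun g \<Longrightarrow> definable_fun (\<lambda>e. pair (f e) (g e))"
  by (rule definable_fun_subst2)
    (use definable_sat[of "pair_fm (Var 0) (Var 1) (Var 2)"] in simp_all)

lemma definable_fun_suc: "definable_fun f \<Longrightarrow> definable_fun (\<lambda>e. suc (f e))"
  by (rule definable_fun_subst2[of "\<lambda>x y. suc x"])
    (use definable_sat[of "succ_fm (Var 0) (Var 2)"] in simp_all)

lemmas definable_intros = definable_conj definable_disj definable_iff definable_imp definable_not
  definable_all definable_ex definable_eq definable_mem definable_fun_var definable_fun_const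
  definable_fun_pair definable_fun_suc

definition is_inductive :: "'a \<Rightarrow> bool" where
  "is_inductive w \<longleftrightarrow> emp \<epsilon> w \<and> (\<forall>x. x \<epsilon> w \<longrightarrow> suc x \<epsilon> w)"

definition omega :: "'a" where
  "omega = the_set (\<lambda>n. \<forall>w. is_inductive w \<longrightarrow> n \<epsilon> w)"

lemma sat_inductive [simp]: "sat t e (inductive_fm w) \<longleftrightarrow> is_inductive (val t e w)"
  by (simp add: inductive_fm_def is_inductive_def)

lemma ex_omega: "\<exists>y. \<forall>n. n \<epsilon> y \<longleftrightarrow> (\<forall>w. is_inductive w \<longrightarrow> n \<epsilon> w)"
proof -
  obtain w where w_inductive: "is_inductive w"
    using zfc_single_true[of "zfc_single ! 4" "\<lambda>_. c0"] by (auto simp: zfc_single_def)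
  have "definable (\<lambda>e. \<forall>w. is_inductive w \<longrightarrow> e 0 \<epsilon> w)"
    using definable_sat[of "nat_fm (Var 0)"] by (simp add: nat_fm_def)
  then show ?thesis by (rule separation[where z = w]) (use w_inductive in blast)
qed

lemmas mem_omega_iff = mem_the_set[OF ex_omega, folded omega_def]

lemma sat_nat [simp]: "sat t e (nat_fm u) \<longleftrightarrow> val t e u \<epsilon> omega"
  by (simp add: nat_fm_def mem_omega_iff)

lemma emp_omega [simp]: "emp \<epsilon> omega"
  by (simp add: mem_omega_iff is_inductive_def)

lemma suc_omega [intro]: "n \<epsilon> omega \<Longrightarrow> suc n \<epsilon> omega"
  unfolding mem_omega_iff by (metis is_inductive_def)

lemma omega_induct [consumes 1, case_names definable emp suc]:
  assumes "n \<epsilon> omega" "definable (\<lambda>e. P (e 0))" "P emp" "\<And>n. n \<epsilon> omega \<Longrightarrow> P n \<Longrightarrow> P (suc n)"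
  shows "P n"
proof -
  obtain y where mem_y: "\<And>x. x \<epsilon> y \<longleftrightarrow> x \<epsilon> omega \<and> P x" by (rule separation[OF assms(2)]) blast
  then have "is_inductive y" unfolding is_inductive_def using assms(3,4) suc_omega by auto
  then have "n \<epsilon> y" using assms(1) mem_omega_iff by simp
  then show ?thesis using mem_y by simp
qed

lemma omega_mem:
  assumes "n \<epsilon> omega"
  shows "i \<epsilon> n \<Longrightarrow> i \<epsilon> omega"
proof -
  have "\<forall>i. i \<epsilon> n \<longrightarrow> i \<epsilon> omega"
    using assms by (induction rule: omega_induct) (intro definable_intros | auto)+
  then show "i \<epsilon> n \<Longrightarrow> i \<epsilon> omega" by blast
qed

lemma omega_trans:
  assumes "n \<epsilon> omega"
  shows "i \<epsilon> n \<Longrightarrow> j \<epsilon> i \<Longrightarrow> j \<epsilon> n"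
proof -
  have "\<forall>i j. i \<epsilon> n \<longrightarrow> j \<epsilon> i \<longrightarrow> j \<epsilon> n"
    using assms by (induction rule: omega_induct) (intro definable_intros | auto)+
  then show "i \<epsilon> n \<Longrightarrow> j \<epsilon> i \<Longrightarrow> j \<epsilon> n" by blast
qed

lemma omega_irrefl: "n \<epsilon> omega \<Longrightarrow> \<not> n \<epsilon> n"
proof (induction rule: omega_induct)
  case (suc n)
  have "n \<epsilon> suc n" by simp
  then show ?case using suc omega_trans by (metis mem_suc)
qed (intro definable_intros, simp)

lemma suc_inj:
  assumes "m \<epsilon> omega" "n \<epsilon> omega" "suc m = suc n"
  shows "m = n"
proof (rule ccontr)
  assume "m \<noteq> n"
  then have "m \<epsilon> n" "n \<epsilon> m" using assms(3) mem_suc by metis+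
  then show False using omega_trans omega_irrefl assms(1) by blast
qed

lemma omega_cases:
  assumes "n \<epsilon> omega"
  obtains (emp) "n = emp" | (suc) m where "m \<epsilon> omega" "n = suc m"
proof -
  have "n = emp \<or> (\<exists>m. m \<epsilon> omega \<and> n = suc m)"
    using assms by (induction rule: omega_induct) (intro definable_intros | auto)+
  then show thesis using that by blast
qed

lemma mem_suc_cases:
  assumes "n \<epsilon> omega" "k \<epsilon> suc n"
  obtains (emp) "k = emp" | (suc) i where "i \<epsilon> n" "k = suc i"
proof -
  have "\<forall>k. k \<epsilon> suc n \<longrightarrow> k = emp \<or> (\<exists>i. i \<epsilon> n \<and> k = suc i)"
    using assms(1) by (induction rule: omega_induct) (intro definable_intros | auto)+
  then show thesis using assms(2) that by blast
qed

lemma suc_mem_or_eq: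
  assumes "n \<epsilon> omega"
  shows "k \<epsilon> n \<Longrightarrow> suc k \<epsilon> n \<or> suc k = n"
proof -
  have "\<forall>k. k \<epsilon> n \<longrightarrow> suc k \<epsilon> n \<or> suc k = n"
    using assms by (induction rule: omega_induct) (intro definable_intros | auto)+
  then show "k \<epsilon> n \<Longrightarrow> suc k \<epsilon> n \<or> suc k = n" by blast
qed

lemma emp_mem_or_eq: "n \<epsilon> omega \<Longrightarrow> n = emp \<or> emp \<epsilon> n"
  by (induction rule: omega_induct) (intro definable_intros | auto)+

definition num :: "nat \<Rightarrow> 'a" where
  "num k = (suc ^^ k) emp"

lemma num_0: "num 0 = emp"
  by (simp add: num_def)

lemma num_Suc: "num (Suc k) = suc (num k)"
  by (simp add: num_def)

lemma num_omega [simp]: "num k \<epsilon> omega"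
  by (induction k) (auto simp: num_0 num_Suc)

lemma num_eq_iff [simp]: "num m = num n \<longleftrightarrow> m = n"
proof (induction m arbitrary: n)
  case 0
  then show ?case by (cases n) (simp_all add: num_0 num_Suc)
next
  case (Suc m)
  then show ?case using suc_inj[OF num_omega num_omega] by (cases n) (auto simp: num_0 num_Suc)
qed

definition cart :: "'a \<Rightarrow> 'a \<Rightarrow> 'a" where
  "cart x y = the_set (\<lambda>z. \<exists>a b. a \<epsilon> x \<and> b \<epsilon> y \<and> z = pair a b)"

lemma ex_cart: "\<exists>p. \<forall>z. z \<epsilon> p \<longleftrightarrow> (\<exists>a b. a \<epsilon> x \<and> b \<epsilon> y \<and> z = pair a b)"
proof -
  let ?P = "\<lambda>z. \<exists>a b. a \<epsilon> x \<and> b \<epsilon> y \<and> z = pair a b"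
  have "definable (\<lambda>e. ?P (e 0))" by (intro definable_intros)
  then obtain p where "\<And>z. z \<epsilon> p \<longleftrightarrow> z \<epsilon> pow (pow (bigunion (upair x y))) \<and> ?P z"
    by (rule separation) blast
  moreover have "?P z \<Longrightarrow> z \<epsilon> pow (pow (bigunion (upair x y)))" for z
    by (auto simp: pair_def conj_disj_distribL ex_disj_distrib)
  ultimately show ?thesis by blast
qed

lemmas mem_cart_iff = mem_the_set[OF ex_cart, folded cart_def]

lemma pair_mem_cart [simp]: "pair a b \<epsilon> cart x y \<longleftrightarrow> a \<epsilon> x \<and> b \<epsilon> y"
  by (auto simp: mem_cart_iff)
end


section \<open>Computations in a model\<close>

context zf
begin

definition is_seq :: "'a \<Rightarrow> 'a \<Rightarrow> bool" where
  "is_seq f n \<longleftrightarrow> n \<epsilon> omega \<and> (\<forall>p. p \<epsilon> f \<longrightarrow> (\<exists>i y. i \<epsilon> n \<and> p = pair i y)) \<and>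
    (\<forall>i. i \<epsilon> n \<longrightarrow> (\<exists>y. \<forall>z. pair i z \<epsilon> f \<longleftrightarrow> z = y))"

lemma sat_app [simp]: "sat t e (app_fm f x y) \<longleftrightarrow> pair (val t e x) (val t e y) \<epsilon> val t e f"
  by (simp add: app_fm_def)

lemma sat_seq [simp]: "sat t e (seq_fm f n) \<longleftrightarrow> is_seq (val t e f) (val t e n)"
  by (simp add: seq_fm_def is_seq_def iterated_quantifier_defs)

lemma is_seq_omega: "is_seq f n \<Longrightarrow> n \<epsilon> omega"
  by (simp add: is_seq_def)

lemma is_seq_dom: "is_seq f n \<Longrightarrow> pair i y \<epsilon> f \<Longrightarrow> i \<epsilon> n"
  unfolding is_seq_def by auto

lemma is_seq_ex: "is_seq f n \<Longrightarrow> i \<epsilon> n \<Longrightarrow> \<exists>y. \<forall>z. pair i z \<epsilon> f \<longleftrightarrow> z = y"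
  by (simp add: is_seq_def)

lemma is_seq_unique: "is_seq f n \<Longrightarrow> pair i y \<epsilon> f \<Longrightarrow> pair i z \<epsilon> f \<Longrightarrow> y = z"
  using is_seq_ex[OF _ is_seq_dom] by metis

lemma sat_numv [simp]: "x \<noteq> y \<Longrightarrow> sat t e (numv k x y) \<longleftrightarrow> e x = num k"
  by (induction k arbitrary: e) (auto simp: eq_emp_iff num_0 num_Suc)

lemma sat_num [simp]: "sat t e (num_fm k u) \<longleftrightarrow> val t e u = num k"
  by (auto simp: num_fm_def Let_def)

lemma sat_one_of [simp]: "sat t e (one_of_fm ks u) \<longleftrightarrow> val t e u \<in> num ` set ks"
  by (auto simp: one_of_fm_def)

lemma sat_add [simp]: "sat t e (add_fm d k m) \<longleftrightarrow> val t e m = (suc ^^ d) (val t e k)"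
  by (induction d arbitrary: e m) auto

lemma sat_entry [simp]: "sat t e (entry_fm f n y) \<longleftrightarrow> pair (num n) (val t e y) \<epsilon> val t e f"
  by (simp add: entry_fm_def)

lemma sat_length [simp]: "sat t e (length_fm f n) \<longleftrightarrow> is_seq (val t e f) (num n)"
  by (simp add: length_fm_def)

definition triple :: "'a \<Rightarrow> 'a \<Rightarrow> 'a \<Rightarrow> 'a" where
  "triple a q h = pair a (pair q h)"

lemma triple_eq_iff [simp]: "triple a q h = triple a' q' h' \<longleftrightarrow> a = a' \<and> q = q' \<and> h = h'"
  by (simp add: triple_def)

abbreviation tab :: "'a \<Rightarrow> 'a \<Rightarrow> 'a \<Rightarrow> 'a \<Rightarrow> bool" where
  "tab t i j v \<equiv> pair (pair i j) v \<epsilon> t"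

abbreviation cell :: "sym \<Rightarrow> nat \<Rightarrow> nat \<Rightarrow> 'a" where
  "cell a q h \<equiv> triple (num (sym_num a)) (num q) (num h)"

lemma sat_triple [simp]:
  "sat t e (triple_fm a q h v) \<longleftrightarrow> val t e v = triple (val t e a) (val t e q) (val t e h)"
  by (simp add: triple_fm_def triple_def)

lemma sat_tab [simp]:
  "sat t e (tab_fm f i j v) \<longleftrightarrow> tab (val t e f) (val t e i) (val t e j) (val t e v)"
  by (simp add: tab_fm_def)

lemma sat_cell [simp]:
  "sat t e (cell_fm f i j a q h) \<longleftrightarrow>
   tab (val t e f) (val t e i) (val t e j) (triple (val t e a) (val t e q) (val t e h))"
  by (simp add: cell_fm_def)

lemma sat_ncell [simp]:
  "sat t e (ncell_fm f i j a q h) \<longleftrightarrow> tab (val t e f) (val t e i) (val t e j) (cell a q h)"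
  by (simp add: ncell_fm_def iterated_quantifier_defs)

fun moves :: "move \<Rightarrow> 'a \<Rightarrow> 'a \<Rightarrow> bool" where
  "moves Lft j j' \<longleftrightarrow> j = suc j' \<or> j = emp \<and> j' = emp"
| "moves Stay j j' \<longleftrightarrow> j' = j"
| "moves Rgt j j' \<longleftrightarrow> j' = suc j"

lemma sat_move [simp]: "sat t e (move_fm d j j') \<longleftrightarrow> moves d (val t e j) (val t e j')"
  by (cases d) auto

lemma sat_init_cell [simp]:
  "sat t e (init_cell_fm M f j a h) \<longleftrightarrow> tab (val t e f) emp (val t e j) (cell a (init M) h)"
  by (simp add: init_cell_fm_def num_0)

lemma sat_blank [simp]:
  "sat t e (blank_fm M f l) \<longleftrightarrow>
   (\<forall>j. j \<epsilon> omega \<and> val t e l \<epsilon> j \<longrightarrow> tab (val t e f) emp j (cell Blank (init M) 0))"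
  by (simp add: blank_fm_def)

definition binary :: "'a \<Rightarrow> 'a \<Rightarrow> bool" where
  "binary s l \<longleftrightarrow> is_seq s l \<and> (\<forall>k y. pair k y \<epsilon> s \<longrightarrow> y = num 0 \<or> y = num 1)"

lemma sat_binary [simp]: "sat t e (binary_fm s l) \<longleftrightarrow> binary (val t e s) (val t e l)"
  by (simp add: binary_fm_def binary_def iterated_quantifier_defs)

end


section \<open>Codes of formulas in a model\<close>

fun stm_bounded :: "nat \<Rightarrow> nat \<Rightarrow> stm \<Rightarrow> bool" where
  "stm_bounded n k (TH i) \<longleftrightarrow> i < k"
| "stm_bounded n k (VH i) \<longleftrightarrow> i < n"

primrec scheme_bounded :: "nat \<Rightarrow> nat \<Rightarrow> nat \<Rightarrow> scheme \<Rightarrow> bool" where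
  "scheme_bounded m n k (FH i) \<longleftrightarrow> i < m"
| "scheme_bounded m n k (PFm a) \<longleftrightarrow> True"
| "scheme_bounded m n k (PEq s t) \<longleftrightarrow> stm_bounded n k s \<and> stm_bounded n k t"
| "scheme_bounded m n k (PMem s t) \<longleftrightarrow> stm_bounded n k s \<and> stm_bounded n k t"
| "scheme_bounded m n k (PNeg p) \<longleftrightarrow> scheme_bounded m n k p"
| "scheme_bounded m n k (PImp p q) \<longleftrightarrow> scheme_bounded m n k p \<and> scheme_bounded m n k q"
| "scheme_bounded m n k (PAll i p) \<longleftrightarrow> i < n \<and> scheme_bounded m n k p"

lemma scheme_bounded_connectives [simp]:
  "scheme_bounded m n k (PAnd p q) \<longleftrightarrow> scheme_bounded m n k p \<and> scheme_bounded m n k q"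
  "scheme_bounded m n k (PIff p q) \<longleftrightarrow> scheme_bounded m n k p \<and> scheme_bounded m n k q"
  "scheme_bounded m n k (PEx i p) \<longleftrightarrow> i < n \<and> scheme_bounded m n k p"
  by (auto simp: PAnd_def PIff_def PEx_def)

context zf
begin

primrec tm_code :: "tm \<Rightarrow> 'a" where
  "tm_code (Var n) = pair (num 0) (num n)"
| "tm_code Ct = pair (num 1) (num 0)"

definition eq_code :: "'a \<Rightarrow> 'a \<Rightarrow> 'a" where
  "eq_code x y = pair (num 0) (pair x y)"

definition mem_code :: "'a \<Rightarrow> 'a \<Rightarrow> 'a" where
  "mem_code x y = pair (num 1) (pair x y)"

definition neg_code :: "'a \<Rightarrow> 'a" where
  "neg_code x = pair (num 2) x"

definition imp_code :: "'a \<Rightarrow> 'a \<Rightarrow> 'a" where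
  "imp_code x y = pair (num 3) (pair x y)"

definition all_code :: "'a \<Rightarrow> 'a \<Rightarrow> 'a" where
  "all_code v x = pair (num 4) (pair v x)"

definition and_code :: "'a \<Rightarrow> 'a \<Rightarrow> 'a" where
  "and_code x y = neg_code (imp_code x (neg_code y))"

definition ex_code :: "'a \<Rightarrow> 'a \<Rightarrow> 'a" where
  "ex_code v x = neg_code (all_code v (neg_code x))"

lemmas code_defs = eq_code_def mem_code_def neg_code_def imp_code_def all_code_def

primrec fm_code :: "fm \<Rightarrow> 'a" where
  "fm_code (Eq s t) = eq_code (tm_code s) (tm_code t)"
| "fm_code (Mem s t) = mem_code (tm_code s) (tm_code t)"
| "fm_code (Neg a) = neg_code (fm_code a)"
| "fm_code (Imp a b) = imp_code (fm_code a) (fm_code b)"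
| "fm_code (All n a) = all_code (num n) (fm_code a)"

lemma tm_code_eq_iff [simp]: "tm_code s = tm_code t \<longleftrightarrow> s = t"
  by (cases s; cases t) simp_all

lemma constructor_code_eq_fm_code_iff:
  "eq_code x y = fm_code a \<longleftrightarrow> (\<exists>s t. a = Eq s t \<and> x = tm_code s \<and> y = tm_code t)"
  "mem_code x y = fm_code a \<longleftrightarrow> (\<exists>s t. a = Mem s t \<and> x = tm_code s \<and> y = tm_code t)"
  "neg_code x = fm_code a \<longleftrightarrow> (\<exists>b. a = Neg b \<and> x = fm_code b)"
  "imp_code x y = fm_code a \<longleftrightarrow> (\<exists>b c. a = Imp b c \<and> x = fm_code b \<and> y = fm_code c)"
  "all_code v x = fm_code a \<longleftrightarrow> (\<exists>n b. a = All n b \<and> v = num n \<and> x = fm_code b)"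
  by (cases a; simp add: code_defs)+

lemma fm_code_eq_iff [simp]: "fm_code a = fm_code b \<longleftrightarrow> a = b"
  by (induction a arbitrary: b) (auto simp: constructor_code_eq_fm_code_iff)

lemma and_code_eq_fm_code_iff:
  "and_code x y = fm_code a \<longleftrightarrow> (\<exists>b c. a = And b c \<and> x = fm_code b \<and> y = fm_code c)"
  by (auto simp: and_code_def And_def constructor_code_eq_fm_code_iff)

lemma ex_code_eq_fm_code_iff:
  "ex_code v x = fm_code a \<longleftrightarrow> (\<exists>n b. a = Ex n b \<and> v = num n \<and> x = fm_code b)"
  by (auto simp: ex_code_def Ex_def constructor_code_eq_fm_code_iff)

lemma sat_tag [simp]: "sat t e (tag_fm k a c) \<longleftrightarrow> val t e c = pair (num k) (val t e a)"
  by (simp add: tag_fm_def)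

lemma sat_tag2 [simp]:
  "sat t e (tag2_fm k a b c) \<longleftrightarrow> val t e c = pair (num k) (pair (val t e a) (val t e b))"
  by (simp add: tag2_fm_def)

lemma sat_constructor_codes [simp]:
  "sat t e (cVar n c) \<longleftrightarrow> val t e c = pair (num 0) (val t e n)"
  "sat t e (cCt c) \<longleftrightarrow> val t e c = tm_code Ct"
  "sat t e (cEq a b c) \<longleftrightarrow> val t e c = eq_code (val t e a) (val t e b)"
  "sat t e (cMem a b c) \<longleftrightarrow> val t e c = mem_code (val t e a) (val t e b)"
  "sat t e (cNeg a c) \<longleftrightarrow> val t e c = neg_code (val t e a)"
  "sat t e (cImp a b c) \<longleftrightarrow> val t e c = imp_code (val t e a) (val t e b)"
  "sat t e (cAll n a c) \<longleftrightarrow> val t e c = all_code (val t e n) (val t e a)"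
  by (simp_all add: cVar_def cCt_def cEq_def cMem_def cNeg_def cImp_def cAll_def code_defs)

lemma sat_code_tm [simp]: "sat t e (code_tm s c) \<longleftrightarrow> val t e c = tm_code s"
  by (cases s) simp_all

lemma sat_code [simp]: "sat t e (code_fm a c) \<longleftrightarrow> val t e c = fm_code a"
  by (induction a arbitrary: e c) (simp_all add: iterated_quantifier_defs)

fun stm_code :: "'a list \<Rightarrow> 'a list \<Rightarrow> stm \<Rightarrow> 'a" where
  "stm_code vs ts (TH k) = ts ! k"
| "stm_code vs ts (VH k) = pair (num 0) (vs ! k)"

primrec scheme_code :: "'a list \<Rightarrow> 'a list \<Rightarrow> 'a list \<Rightarrow> scheme \<Rightarrow> 'a" where
  "scheme_code fs vs ts (FH k) = fs ! k"
| "scheme_code fs vs ts (PFm a) = fm_code a"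
| "scheme_code fs vs ts (PEq s t) = eq_code (stm_code vs ts s) (stm_code vs ts t)"
| "scheme_code fs vs ts (PMem s t) = mem_code (stm_code vs ts s) (stm_code vs ts t)"
| "scheme_code fs vs ts (PNeg p) = neg_code (scheme_code fs vs ts p)"
| "scheme_code fs vs ts (PImp p q) = imp_code (scheme_code fs vs ts p) (scheme_code fs vs ts q)"
| "scheme_code fs vs ts (PAll k p) = all_code (vs ! k) (scheme_code fs vs ts p)"

lemma scheme_code_connectives [simp]:
  "scheme_code fs vs ts (PAnd p q) = and_code (scheme_code fs vs ts p) (scheme_code fs vs ts q)"
  "scheme_code fs vs ts (PEx k p) = ex_code (vs ! k) (scheme_code fs vs ts p)"
  by (simp_all add: PAnd_def PEx_def and_code_def ex_code_def)

lemma map_val_fresh [simp]: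
  "set us \<subseteq> set ps \<Longrightarrow> map (val t (e(fresh ps := d))) us = map (val t e) us"
  by (simp add: subset_iff)

lemma sat_scheme_tm [simp]:
  "stm_bounded (length Vs) (length Ts) s \<Longrightarrow> sat t e (scheme_tm Vs Ts s c) \<longleftrightarrow>
     val t e c = stm_code (map (val t e) Vs) (map (val t e) Ts) s"
  by (cases s) simp_all

lemma sat_scheme [simp]:
  "scheme_bounded (length Fs) (length Vs) (length Ts) p \<Longrightarrow> sat t e (scheme_fm Fs Vs Ts p c) \<longleftrightarrow>
     val t e c = scheme_code (map (val t e) Fs) (map (val t e) Vs) (map (val t e) Ts) p"
proof (induction p arbitrary: e c)
  case (PAll k p)
  then have "Vs ! k \<in> set Vs" by simp
  then show ?case using PAll by (simp add: subsetI)
qed (simp_all add: iterated_quantifier_defs subsetI)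

definition succ_numv_code :: "'a \<Rightarrow> 'a" where
  "succ_numv_code x = ex_code (num 1) (and_code (fm_code (succ_fm (Var 1) (Var 0)))
    (ex_code (num 0) (and_code (fm_code (Eq (Var 0) (Var 1))) x)))"

lemma succ_numv_code_eq_fm_code_iff:
  "succ_numv_code x = fm_code a \<longleftrightarrow> (\<exists>b. x = fm_code b \<and>
     a = Ex 1 (And (succ_fm (Var 1) (Var 0)) (Ex 0 (And (Eq (Var 0) (Var 1)) b))))"
  unfolding succ_numv_code_def and_code_eq_fm_code_iff ex_code_eq_fm_code_iff
  by (auto simp: And_def Ex_def simp del: fm_code.simps)

definition numv_code :: "'a \<Rightarrow> 'a \<Rightarrow> bool" where
  "numv_code k c \<longleftrightarrow> (\<exists>f. is_seq f (suc k) \<and> pair k c \<epsilon> f \<and>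
    (\<forall>i y. i \<epsilon> suc k \<and> pair i y \<epsilon> f \<longrightarrow> i = emp \<and> y = fm_code (numv 0 0 1) \<or>
       (\<exists>j x. i = suc j \<and> pair j x \<epsilon> f \<and> y = succ_numv_code x)))"

lemma sat_num_code_step:
  "sat t e (ex4 [m, f, i, y] (\<lambda>j a x0 x1. Conj
     [succ_fm j i, app_fm f j a, num_fm 0 x0, num_fm 1 x1,
      scheme_fm [a] [x0, x1] []
        (PEx 1 (PAnd (PFm (succ_fm (Var 1) (Var 0)))
           (PEx 0 (PAnd (PFm (Eq (Var 0) (Var 1))) (FH 0))))) y])) \<longleftrightarrow>
   (\<exists>j x. val t e i = suc j \<and> pair j x \<epsilon> val t e f \<and> val t e y = succ_numv_code x)"
  by (simp add: iterated_quantifier_defs succ_numv_code_def)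

lemma sat_num_code [simp]: "sat t e (num_code_fm k c) \<longleftrightarrow> numv_code (val t e k) (val t e c)"
  unfolding num_code_fm_def numv_code_def
  by (simp add: all2_def ex2_def sat_num_code_step del: One_nat_def mem_suc numv.simps)

text \<open>Here \<open>k\<close> may a priori be nonstandard, so that the induction runs on the size of \<open>a\<close>.\<close>

lemma numv_code_decode:
  assumes "numv_code k (fm_code a)"
  obtains j where "a = numv j 0 1" "k = num j"
proof -
  obtain f where f_seq: "is_seq f (suc k)" "pair k (fm_code a) \<epsilon> f" and
    entry: "\<And>i y. i \<epsilon> suc k \<Longrightarrow> pair i y \<epsilon> f \<Longrightarrow> i = emp \<and> y = fm_code (numv 0 0 1) \<or>
      (\<exists>j x. i = suc j \<and> pair j x \<epsilon> f \<and> y = succ_numv_code x)"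
    using assms unfolding numv_code_def by blast
  have "pair i (fm_code a) \<epsilon> f \<Longrightarrow> \<exists>j. a = numv j 0 1 \<and> i = num j" for i a
  proof (induction "size a" arbitrary: a i rule: less_induct)
    case less
    from entry[OF is_seq_dom[OF f_seq(1) less.prems] less.prems]
    consider (zero) "i = emp" "fm_code a = fm_code (numv 0 0 1)"
      | (succ) j x where "i = suc j" "pair j x \<epsilon> f" "succ_numv_code x = fm_code a" by metis
    then show ?case
    proof cases
      case zero
      then show ?thesis by (intro exI[of _ 0]) (simp add: num_0 del: numv.simps)
    next
      case (succ j x)
      then obtain b where b_code: "x = fm_code b"
        "a = Ex 1 (And (succ_fm (Var 1) (Var 0)) (Ex 0 (And (Eq (Var 0) (Var 1)) b)))"
        unfolding succ_numv_code_eq_fm_code_iff by blast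
      then have "size b < size a" by (simp add: Ex_def And_def)
      then obtain m where "b = numv m 0 1" "j = num m" using less.hyps succ(2) b_code(1) by blast
      then show ?thesis using b_code(2) succ(1) by (intro exI[of _ "Suc m"]) (simp add: num_Suc)
    qed
  qed
  then show thesis using f_seq(2) that by blast
qed

definition with_numv_code :: "'a \<Rightarrow> fm \<Rightarrow> 'a \<Rightarrow> bool" where
  "with_numv_code k a c \<longleftrightarrow>
     (\<exists>x. numv_code k x \<and> c = ex_code (num 0) (and_code x (fm_code a)))"

lemma sat_with_num_code [simp]:
  "sat t e (with_num_code_fm k a c) \<longleftrightarrow> with_numv_code (val t e k) a (val t e c)"
  by (simp add: with_num_code_fm_def with_numv_code_def iterated_quantifier_defs)

lemma sat_with_num [simp]: "sat t e (with_num k a) \<longleftrightarrow> sat t (e(0 := num k)) a"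
  by (auto simp: with_num_def)

lemma sat_decoded_with_num:
  assumes "with_numv_code k a (fm_code b)"
  shows "sat t e b \<longleftrightarrow> sat t (e(0 := k)) a"
proof -
  obtain x where "numv_code k x" "ex_code (num 0) (and_code x (fm_code a)) = fm_code b"
    using assms unfolding with_numv_code_def by metis
  then obtain d where d_code: "b = Ex 0 (And d a)" "numv_code k (fm_code d)"
    unfolding and_code_eq_fm_code_iff ex_code_eq_fm_code_iff by auto
  from d_code(2) obtain j where "d = numv j 0 1" "k = num j" by (rule numv_code_decode)
  then show ?thesis using sat_with_num[of t e j a] d_code(1) by (simp add: with_num_def)
qed

lemma sat_bool_val: "sat t e (bool_val_fm a v) \<Longrightarrow> val t e v = num 1 \<Longrightarrow> sat t e a"
  by (auto simp: bool_val_fm_def)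

abbreviation bit_num :: "bool \<Rightarrow> 'a" where
  "bit_num b \<equiv> num (of_bool b)"

lemma binary_bit:
  assumes "binary s l" "pair k y \<epsilon> s"
  obtains b where "y = bit_num b"
proof -
  have "y = bit_num False \<or> y = bit_num True" using assms by (auto simp: binary_def)
  then show thesis using that by blast
qed

abbreviation def_length :: "turing \<Rightarrow> nat" where
  "def_length M \<equiv> length (def_fms M Ct)"

definition coded_input_cell :: "turing \<Rightarrow> 'a \<Rightarrow> 'a \<Rightarrow> 'a \<Rightarrow> bool" where
  "coded_input_cell M s U k \<longleftrightarrow> (\<exists>b y. pair k (bit_num b) \<epsilon> s \<and>
    pair ((suc ^^ (def_length M + 2)) k) y \<epsilon> U \<and>
    with_numv_code (suc k) (init_cell_fm M Ct (Var 0) (bit_sym b) 0) y)"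

definition coded_theory :: "turing \<Rightarrow> 'a \<Rightarrow> 'a \<Rightarrow> 'a \<Rightarrow> bool" where
  "coded_theory M s l U \<longleftrightarrow>
    binary s l \<and> is_seq U ((suc ^^ (def_length M + 2)) l) \<and>
    (\<forall>i < def_length M. pair (num i) (fm_code (def_fms M Ct ! i)) \<epsilon> U) \<and>
    (\<exists>y. pair (num (def_length M)) y \<epsilon> U \<and> with_numv_code l (blank_fm M Ct (Var 0)) y) \<and>
    pair (num (def_length M + 1)) (fm_code (with_num 0 (init_cell_fm M Ct (Var 0) Start 1))) \<epsilon> U \<and>
    (\<forall>k. k \<epsilon> l \<longrightarrow> coded_input_cell M s U k)"

lemma sat_coded_input_cell:
  "sat t e (ex4 [s, U, l, k] (\<lambda>i y k' a. Conj
     [add_fm (def_length M + 2) k i, app_fm U i y, succ_fm k k', app_fm s k a,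
      Or (And (num_fm 0 a) (with_num_code_fm k' (init_cell_fm M Ct (Var 0) Zero 0) y))
         (And (num_fm 1 a) (with_num_code_fm k' (init_cell_fm M Ct (Var 0) One 0) y))])) \<longleftrightarrow>
   coded_input_cell M (val t e s) (val t e U) (val t e k)"
  unfolding coded_input_cell_def
  by (simp add: iterated_quantifier_defs ex_bool_eq bit_sym_def
      del: funpow.simps add_2_eq_Suc') auto

lemma sat_Thy [simp]:
  "sat t e (Thy_fm M s U) \<longleftrightarrow> (\<exists>l. coded_theory M (val t e s) l (val t e U))"
  unfolding Thy_fm_def coded_theory_def Let_def
  by (simp add: ex2_def sat_coded_input_cell
      del: One_nat_def funpow.simps add_2_eq_Suc' fm_code.simps add_fm.simps) auto

definition coded_sequence :: "fm list \<Rightarrow> 'a \<Rightarrow> bool" where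
  "coded_sequence \<pi> p \<longleftrightarrow> is_seq p (num (length \<pi>)) \<and>
    (\<forall>i < length \<pi>. pair (num i) (fm_code (\<pi> ! i)) \<epsilon> p)"

lemma sat_code_seq [simp]: "sat t e (code_seq_fm \<pi> p) \<longleftrightarrow> coded_sequence \<pi> (val t e p)"
  by (auto simp: code_seq_fm_def coded_sequence_def)

definition theory_steps_valid :: "justification list \<Rightarrow> 'a \<Rightarrow> 'a \<Rightarrow> bool" where
  "theory_steps_valid Js U p \<longleftrightarrow>
    (\<forall>i < length Js. Js ! i = Thy_J \<longrightarrow> (\<exists>y k. pair (num i) y \<epsilon> p \<and> pair k y \<epsilon> U))"

lemma sat_CK_theory_steps_valid:
  assumes "sat t e (CK_fm Js AL_fm U p v)" "val t e v = num 1"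
  shows "theory_steps_valid Js (val t e U) (val t e p)"
  unfolding theory_steps_valid_def
proof (intro allI impI)
  fix i assume "i < length Js" "Js ! i = Thy_J"
  moreover have "\<forall>a \<in> set (map (\<lambda>i. valid_fm AL_fm U p i (Js ! i)) [0..<length Js]). sat t e a"
    using sat_bool_val[OF assms(1)[unfolded CK_fm_def] assms(2)] by simp
  ultimately have "sat t e (valid_fm AL_fm U p i Thy_J)" by force
  then show "\<exists>y k. pair (num i) y \<epsilon> val t e p \<and> pair k y \<epsilon> val t e U"
    by (auto simp: valid_fm_def AL_fm_def bool_val_fm_def)
qed

end


section \<open>Computation tables in a model\<close>

lemma sym_num_eq_iff [simp]: "sym_num a = sym_num b \<longleftrightarrow> a = b"
  by (cases a; cases b) auto

lemma UNIV_sym: "UNIV = {Zero, One, Blank, Start}"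
  using sym.exhaust by blast

lemma range_sym_num: "range sym_num = {0, 1, 2, 3}"
  by (simp add: UNIV_sym)

lemma finite_sym: "finite (UNIV :: sym set)"
  by (simp add: UNIV_sym)

text \<open>The nested terms \<open>fresh ps\<close> grow exponentially with the number of quantifiers, so that the
  quantifier prefix of \<open>trans_fm\<close> is evaluated blockwise.\<close>

definition next_cell_fm ::
  "nat \<Rightarrow> nat \<Rightarrow> tm \<Rightarrow> tm \<Rightarrow> tm \<Rightarrow> tm \<Rightarrow> tm \<Rightarrow> tm \<Rightarrow> tm \<Rightarrow> tm \<Rightarrow> tm \<Rightarrow> fm" where
  "next_cell_fm n q' t i j i' j' k b p h = ex3 [t, i, j, i', j', k, b, p, h] (\<lambda>c r g. Conj
     [Or (And (Eq k j) (num_fm n c)) (And (Neg (Eq k j)) (Eq c b)),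
      num_fm q' r,
      Or (And (Eq k j') (num_fm 1 g)) (And (Neg (Eq k j')) (num_fm 0 g)),
      cell_fm t i' k c r g])"

definition next_position_fm ::
  "nat \<Rightarrow> nat \<Rightarrow> move \<Rightarrow> tm \<Rightarrow> tm \<Rightarrow> tm \<Rightarrow> tm \<Rightarrow> tm \<Rightarrow> tm \<Rightarrow> fm" where
  "next_position_fm n q' d t i j i' j' k = all3 [t, i, j, i', j', k] (\<lambda>b p h.
     Imp (Conj [succ_fm i i', move_fm d j j', cell_fm t i k b p h])
       (next_cell_fm n q' t i j i' j' k b p h))"

definition next_row_fm :: "nat \<Rightarrow> nat \<Rightarrow> move \<Rightarrow> tm \<Rightarrow> tm \<Rightarrow> tm \<Rightarrow> fm" where
  "next_row_fm n q' d t i j = all3 [t, i, j] (\<lambda>i' j' k. next_position_fm n q' d t i j i' j' k)"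

lemma trans_fm_eq:
  "trans_fm M t q a = (case delta M q a of (q', a', d) \<Rightarrow>
     all2 [t] (\<lambda>i j. Imp (ncell_fm t i j a q 1) (next_row_fm (sym_num a') q' d t i j)))"
  by (simp add: trans_fm_def next_row_fm_def next_position_fm_def next_cell_fm_def)

lemma set_drop_def_fms:
  assumes "finite (states M)"
  shows "set (drop 2 (def_fms M t)) =
    range (halt_fm M t) \<union> (\<Union>q \<in> states M - {halt M}. range (trans_fm M t q))"
  using assms by (simp add: def_fms_def UNIV_sym)

context zf
begin

definition cell_value :: "turing \<Rightarrow> 'a \<Rightarrow> bool" where
  "cell_value M v \<longleftrightarrow> (\<exists>a. \<exists>q \<in> states M. \<exists>b. v = cell a q (of_bool b))"

definition total_table :: "turing \<Rightarrow> 'a \<Rightarrow> bool" where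
  "total_table M t \<longleftrightarrow>
    (\<forall>x. x \<epsilon> t \<longrightarrow> (\<exists>i j v. i \<epsilon> omega \<and> j \<epsilon> omega \<and> cell_value M v \<and> x = pair (pair i j) v)) \<and>
    (\<forall>i j. i \<epsilon> omega \<and> j \<epsilon> omega \<longrightarrow> (\<exists>v. \<forall>w. tab t i j w \<longleftrightarrow> w = v))"

definition halt_yields :: "turing \<Rightarrow> 'a \<Rightarrow> 'a \<Rightarrow> 'a \<Rightarrow> 'a \<Rightarrow> bool" where
  "halt_yields M t i k v \<longleftrightarrow> (\<exists>a j. tab t i j (cell a (halt M) 1) \<and> tab t i k v)"

definition new_cell :: "nat \<Rightarrow> nat \<Rightarrow> 'a \<Rightarrow> 'a \<Rightarrow> 'a \<Rightarrow> 'a \<Rightarrow> 'a" where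
  "new_cell n q' j j' k b =
     triple (if k = j then num n else b) (num q') (num (of_bool (k = j')))"

definition trans_yields :: "turing \<Rightarrow> 'a \<Rightarrow> 'a \<Rightarrow> 'a \<Rightarrow> 'a \<Rightarrow> bool" where
  "trans_yields M t i k v \<longleftrightarrow> (\<exists>q \<in> states M - {halt M}. \<exists>a q' a' d j j' b p h.
    delta M q a = (q', a', d) \<and> tab t i j (cell a q 1) \<and> moves d j j' \<and> tab t i k (triple b p h) \<and>
    v = new_cell (sym_num a') q' j j' k b)"

lemma trans_yieldsI:
  assumes "q \<in> states M" "q \<noteq> halt M" "delta M q a = (q', a', d)" "tab t i j (cell a q 1)"
    "moves d j j'" "tab t i k (triple b p h)"
  shows "trans_yields M t i k (new_cell (sym_num a') q' j j' k b)"
  using assms unfolding trans_yields_def by blast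

abbreviation rules_yield :: "turing \<Rightarrow> 'a \<Rightarrow> 'a \<Rightarrow> 'a \<Rightarrow> 'a \<Rightarrow> bool" where
  "rules_yield M t i k v \<equiv> halt_yields M t i k v \<or> trans_yields M t i k v"

definition obeys_rules :: "turing \<Rightarrow> 'a \<Rightarrow> bool" where
  "obeys_rules M t \<longleftrightarrow> (\<forall>i k v. rules_yield M t i k v \<longrightarrow> tab t (suc i) k v)"

definition input_cell :: "turing \<Rightarrow> 'a \<Rightarrow> 'a \<Rightarrow> 'a \<Rightarrow> 'a \<Rightarrow> bool" where
  "input_cell M s l k v \<longleftrightarrow>
    k = emp \<and> v = cell Start (init M) 1 \<or>
    (\<exists>b m. m \<epsilon> l \<and> k = suc m \<and> pair m (bit_num b) \<epsilon> s \<and> v = cell (bit_sym b) (init M) 0) \<or>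
    k \<epsilon> omega \<and> l \<epsilon> k \<and> v = cell Blank (init M) 0"

definition starts_with :: "turing \<Rightarrow> 'a \<Rightarrow> 'a \<Rightarrow> 'a \<Rightarrow> bool" where
  "starts_with M s l t \<longleftrightarrow> (\<forall>k v. input_cell M s l k v \<longrightarrow> tab t emp k v)"

definition is_table :: "turing \<Rightarrow> 'a \<Rightarrow> 'a \<Rightarrow> 'a \<Rightarrow> bool" where
  "is_table M s l t \<longleftrightarrow> total_table M t \<and> obeys_rules M t \<and> starts_with M s l t"

lemma sat_value [simp]:
  assumes "finite (states M)"
  shows "sat t e (value_fm M v) \<longleftrightarrow> cell_value M (val t e v)"
proof -
  have "x \<in> num ` {0, 1, 2, 3} \<longleftrightarrow> (\<exists>a. x = num (sym_num a))" for x
    unfolding range_sym_num[symmetric] by auto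
  moreover have "x \<in> num ` {0, 1} \<longleftrightarrow> (\<exists>b. x = num (of_bool b))" for x
    by (auto simp: ex_bool_eq)
  ultimately show ?thesis
    using assms by (simp add: value_fm_def cell_value_def iterated_quantifier_defs) blast
qed

lemma sat_halt: "sat t e (halt_fm M f a) \<longleftrightarrow>
  (\<forall>i j. tab (val t e f) i j (cell a (halt M) 1) \<longrightarrow>
    (\<forall>k v. tab (val t e f) i k v \<longrightarrow> tab (val t e f) (suc i) k v))"
  by (simp add: halt_fm_def all2_def all3_def)

lemma sat_next_cell: "sat t e (next_cell_fm n q' f i j i' j' k b p h) \<longleftrightarrow>
  tab (val t e f) (val t e i') (val t e k)
    (new_cell n q' (val t e j) (val t e j') (val t e k) (val t e b))"
  by (simp add: next_cell_fm_def new_cell_def iterated_quantifier_defs)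

lemma sat_next_position: "sat t e (next_position_fm n q' d f i j i' j' k) \<longleftrightarrow>
  (\<forall>b p h. val t e i' = suc (val t e i) \<and> moves d (val t e j) (val t e j') \<and>
    tab (val t e f) (val t e i) (val t e k) (triple b p h) \<longrightarrow>
    tab (val t e f) (val t e i') (val t e k)
      (new_cell n q' (val t e j) (val t e j') (val t e k) b))"
  by (simp add: next_position_fm_def all2_def all3_def sat_next_cell)

lemma sat_next_row: "sat t e (next_row_fm n q' d f i j) \<longleftrightarrow>
  (\<forall>j' k b p h. moves d (val t e j) j' \<and> tab (val t e f) (val t e i) k (triple b p h) \<longrightarrow>
    tab (val t e f) (suc (val t e i)) k (new_cell n q' (val t e j) j' k b))"
  by (simp add: next_row_fm_def all2_def all3_def sat_next_position)

lemma sat_trans: "sat t e (trans_fm M f q a) \<longleftrightarrow>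
  (\<forall>q' a' d i j j' k b p h. delta M q a = (q', a', d) \<and> tab (val t e f) i j (cell a q 1) \<and>
    moves d j j' \<and> tab (val t e f) i k (triple b p h) \<longrightarrow>
    tab (val t e f) (suc i) k (new_cell (sym_num a') q' j j' k b))"
  by (cases "delta M q a") (simp add: trans_fm_eq all2_def sat_next_row, blast)

lemma sat_rule_fms:
  assumes "finite (states M)"
  shows "(\<forall>a \<in> set (drop 2 (def_fms M f)). sat t e a) \<longleftrightarrow> obeys_rules M (val t e f)"
  unfolding set_drop_def_fms[OF assms] obeys_rules_def halt_yields_def trans_yields_def
    ball_Un ball_UN ball_simps sat_halt sat_trans
  by blast

lemma sat_def_fms:
  assumes "finite (states M)"
  shows "(\<forall>a \<in> set (def_fms M f). sat t e a) \<longleftrightarrow>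
    total_table M (val t e f) \<and> obeys_rules M (val t e f)"
proof -
  have "set (def_fms M f) = set (take 2 (def_fms M f)) \<union> set (drop 2 (def_fms M f))"
    by (metis append_take_drop_id set_append)
  moreover have "(\<forall>a \<in> set (take 2 (def_fms M f)). sat t e a) \<longleftrightarrow> total_table M (val t e f)"
    using assms by (simp add: def_fms_def total_table_def iterated_quantifier_defs)
  ultimately show ?thesis by (simp add: ball_Un sat_rule_fms[OF assms])
qed

lemma sat_table:
  assumes "turing_machine M" "is_table M (val t e s) l (val t e f)" "binary (val t e s) l"
  shows "sat t e (table_fm M s f)"
proof -
  have "\<forall>a \<in> set (def_fms M f). sat t e a"
    using assms(1,2) by (simp add: sat_def_fms is_table_def turing_machine_def)
  moreover have start: "tab (val t e f) emp k v" if "input_cell M (val t e s) l k v" for k v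
    using that assms(2) by (simp add: is_table_def starts_with_def)
  moreover from start have "tab (val t e f) emp (num 0) (cell Start (init M) 1)"
    and "\<And>j. j \<epsilon> omega \<Longrightarrow> l \<epsilon> j \<Longrightarrow> tab (val t e f) emp j (cell Blank (init M) 0)"
    by (simp_all add: input_cell_def num_0)
  moreover have "a = num 0 \<and> tab (val t e f) emp (suc k) (cell Zero (init M) 0) \<or>
      a = num 1 \<and> tab (val t e f) emp (suc k) (cell One (init M) 0)"
    if in_input: "k \<epsilon> l" "pair k a \<epsilon> val t e s" for k a
  proof -
    obtain b where b_bit: "a = bit_num b" using binary_bit[OF assms(3) in_input(2)] by blast
    then have "input_cell M (val t e s) l (suc k) (cell (bit_sym b) (init M) 0)"
      using in_input unfolding input_cell_def by blast
    then have "tab (val t e f) emp (suc k) (cell (bit_sym b) (init M) 0)" by (rule start)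
    then show ?thesis using b_bit by (cases b) (simp_all add: bit_sym_def)
  qed
  ultimately show ?thesis
    using assms(3) by (simp add: table_fm_def all2_def all3_def) blast
qed

lemma definable_obeys_rules:
  assumes "finite (states M)"
  shows "definable (\<lambda>e. obeys_rules M (e 0))"
  using definable_sat[of "Conj (drop 2 (def_fms M (Var 0)))"] by (simp add: sat_rule_fms[OF assms])

lemma definable_starts_with: "definable (\<lambda>e. starts_with M s l (e 0))"
  unfolding starts_with_def input_cell_def ex_bool_eq by (intro definable_intros)

lemma omega_position:
  assumes "l \<epsilon> omega" "j \<epsilon> omega"
  obtains (emp) "j = emp" | (input) k where "k \<epsilon> l" "j = suc k" | (blank) "l \<epsilon> j"
proof -
  have "j = emp \<or> (\<exists>k. k \<epsilon> l \<and> j = suc k) \<or> l \<epsilon> j"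
    using assms(2)
  proof (induction rule: omega_induct)
    case definable
    show ?case by (intro definable_intros)
  next
    case (suc j)
    then show ?case using suc_mem_or_eq[OF assms(1)] emp_mem_or_eq[OF assms(1)] by auto
  qed simp
  then show thesis using that by blast
qed

lemma not_mem_suc_of_mem: "l \<epsilon> omega \<Longrightarrow> m \<epsilon> l \<Longrightarrow> \<not> l \<epsilon> suc m"
  using omega_trans omega_irrefl by (metis mem_suc)

lemma ex_moves: "j \<epsilon> omega \<Longrightarrow> \<exists>j'. j' \<epsilon> omega \<and> moves d j j'"
  using suc_omega by (cases d) (auto elim: omega_cases)

lemma moves_unique:
  assumes "j \<epsilon> omega" "moves d j j1" "moves d j j2"
  shows "j1 = j2"
proof (cases d)
  case Lft
  have "m \<epsilon> omega" if "suc m \<epsilon> omega" for m using omega_mem[OF that] by simp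
  then show ?thesis using assms Lft suc_inj by auto
qed (use assms in auto)

lemma rules_yield_mono:
  assumes "\<And>x. x \<epsilon> t \<Longrightarrow> x \<epsilon> t'" "rules_yield M t i k v"
  shows "rules_yield M t' i k v"
  using assms unfolding halt_yields_def trans_yields_def by blast

definition closed_table :: "turing \<Rightarrow> 'a \<Rightarrow> 'a \<Rightarrow> 'a \<Rightarrow> bool" where
  "closed_table M s l R \<longleftrightarrow> starts_with M s l R \<and> obeys_rules M R"

abbreviation cells :: "'a" where
  "cells \<equiv> cart (cart omega omega) (cart omega (cart omega omega))"

definition run_table :: "turing \<Rightarrow> 'a \<Rightarrow> 'a \<Rightarrow> 'a" where
  "run_table M s l = the_set (\<lambda>x. x \<epsilon> cells \<and> (\<forall>R. closed_table M s l R \<longrightarrow> x \<epsilon> R))"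

context
  fixes M :: turing and s l :: 'a
  assumes machine: "turing_machine M" and input: "binary s l"
begin

abbreviation run :: "'a" where
  "run \<equiv> run_table M s l"

lemma finite_states: "finite (states M)"
  using machine by (simp add: turing_machine_def)

lemma length_omega: "l \<epsilon> omega"
  using input is_seq_omega unfolding binary_def by blast

lemma mem_run_iff: "x \<epsilon> run \<longleftrightarrow> x \<epsilon> cells \<and> (\<forall>R. closed_table M s l R \<longrightarrow> x \<epsilon> R)"
  unfolding run_table_def
proof (rule mem_the_set)
  have "definable (\<lambda>e. \<forall>R. closed_table M s l R \<longrightarrow> e 0 \<epsilon> R)"
    unfolding closed_table_def
    by (intro definable_intros definable_starts_with definable_obeys_rules finite_states)
  then obtain y where "\<And>x. x \<epsilon> y \<longleftrightarrow> x \<epsilon> cells \<and> (\<forall>R. closed_table M s l R \<longrightarrow> x \<epsilon> R)"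
    by (rule separation) blast
  then show "\<exists>y. \<forall>x. x \<epsilon> y \<longleftrightarrow> x \<epsilon> cells \<and> (\<forall>R. closed_table M s l R \<longrightarrow> x \<epsilon> R)" by blast
qed

lemma tab_run_omega: "tab run i k v \<Longrightarrow> i \<epsilon> omega \<and> k \<epsilon> omega"
  by (simp add: mem_run_iff)

lemma run_start:
  assumes "input_cell M s l k v"
  shows "tab run emp k v"
proof -
  have "tab cells emp k v"
    using assms omega_mem[OF length_omega] by (auto simp: input_cell_def triple_def)
  then show ?thesis
    using assms by (simp add: mem_run_iff closed_table_def starts_with_def)
qed

lemma rules_yield_cells:
  assumes "rules_yield M run i k v"
  shows "tab cells (suc i) k v"
  using assms
proof
  assume "halt_yields M run i k v"
  then have "tab cells i k v" unfolding halt_yields_def mem_run_iff by blast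
  then show ?thesis by auto
next
  assume "trans_yields M run i k v"
  then obtain n q' j j' b p h where cell: "tab run i k (triple b p h)"
    and v_eq: "v = new_cell n q' j j' k b"
    unfolding trans_yields_def by blast
  have "tab cells i k (triple b p h)" using cell unfolding mem_run_iff by blast
  then show ?thesis unfolding v_eq by (auto simp: new_cell_def triple_def)
qed

lemma run_step:
  assumes "rules_yield M run i k v"
  shows "tab run (suc i) k v"
  unfolding mem_run_iff
proof (intro conjI allI impI rules_yield_cells[OF assms])
  fix R assume R_closed: "closed_table M s l R"
  then have "rules_yield M R i k v"
    using rules_yield_mono[OF _ assms] unfolding mem_run_iff by blast
  then show "tab R (suc i) k v" using R_closed unfolding closed_table_def obeys_rules_def by blast
qed

text \<open>A cell that is neither initial nor yielded by the rules could be removed from the least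
  closed relation.\<close>

lemma run_inversion:
  assumes "tab run i k v"
  shows "i = emp \<and> input_cell M s l k v \<or>
    (\<exists>i'. i' \<epsilon> omega \<and> i = suc i' \<and> rules_yield M run i' k v)"
proof (rule ccontr)
  let ?x = "pair (pair i k) v"
  assume not_yielded: "\<not> ?thesis"
  have "definable (\<lambda>e. e 0 \<noteq> ?x)" by (intro definable_intros)
  then obtain R where mem_R: "\<And>x. x \<epsilon> R \<longleftrightarrow> x \<epsilon> run \<and> x \<noteq> ?x" by (rule separation) blast
  have "starts_with M s l R"
    using mem_R run_start not_yielded unfolding starts_with_def by auto
  moreover have "tab R (suc i') k' v'" if "rules_yield M R i' k' v'" for i' k' v'
  proof -
    have yield: "rules_yield M run i' k' v'"
      using that mem_R by (intro rules_yield_mono[of R run]) blast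
    then have "i' \<epsilon> omega" using tab_run_omega unfolding halt_yields_def trans_yields_def by blast
    then have "pair (pair (suc i') k') v' \<noteq> ?x" using not_yielded yield by auto
    then show ?thesis using mem_R run_step[OF yield] by blast
  qed
  ultimately have "closed_table M s l R" unfolding closed_table_def obeys_rules_def by blast
  then have "?x \<epsilon> R" using assms unfolding mem_run_iff by blast
  then show False using mem_R by blast
qed

lemma tab_run_emp_iff: "tab run emp k v \<longleftrightarrow> input_cell M s l k v"
  using run_inversion[of emp k v] run_start by auto

lemma tab_run_suc_iff:
  assumes "i \<epsilon> omega"
  shows "tab run (suc i) k v \<longleftrightarrow> rules_yield M run i k v"
  using run_inversion[of "suc i" k v] run_step suc_inj[OF assms] by auto

definition row_cell :: "'a \<Rightarrow> nat \<Rightarrow> 'a \<Rightarrow> 'a \<Rightarrow> sym \<Rightarrow> bool" where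
  "row_cell i q h k a \<longleftrightarrow>
    (\<forall>v. tab run i k v \<longleftrightarrow> k = h \<and> v = cell a q 1 \<or> k \<noteq> h \<and> v = cell a q 0)"

lemma row_cell_iff: "row_cell i q h k a \<longleftrightarrow> (\<forall>v. tab run i k v \<longleftrightarrow> v = cell a q (of_bool (k = h)))"
  by (simp add: row_cell_def)

definition is_row :: "'a \<Rightarrow> nat \<Rightarrow> 'a \<Rightarrow> ('a \<Rightarrow> sym) \<Rightarrow> bool" where
  "is_row i q h F \<longleftrightarrow> q \<in> states M \<and> h \<epsilon> omega \<and>
    (\<forall>k v. tab run i k v \<longleftrightarrow> k \<epsilon> omega \<and> v = cell (F k) q (of_bool (k = h)))"

lemma is_row_iff_row_cell:
  "is_row i q h F \<longleftrightarrow> q \<in> states M \<and> h \<epsilon> omega \<and> (\<forall>k. k \<epsilon> omega \<longrightarrow> row_cell i q h k (F k))"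
  unfolding is_row_def row_cell_iff using tab_run_omega by blast

lemma ex_is_row_iff: "(\<exists>q h F. is_row i q h F) \<longleftrightarrow>
  (\<exists>q \<in> states M. \<exists>h. h \<epsilon> omega \<and> (\<forall>k. k \<epsilon> omega \<longrightarrow> (\<exists>a \<in> UNIV. row_cell i q h k a)))"
proof
  assume "\<exists>q \<in> states M. \<exists>h. h \<epsilon> omega \<and> (\<forall>k. k \<epsilon> omega \<longrightarrow> (\<exists>a \<in> UNIV. row_cell i q h k a))"
  then obtain q h where "q \<in> states M" "h \<epsilon> omega" "\<forall>k. \<exists>a. k \<epsilon> omega \<longrightarrow> row_cell i q h k a"
    by blast
  moreover from this(3) obtain F where "\<forall>k. k \<epsilon> omega \<longrightarrow> row_cell i q h k (F k)"
    by (rule choice[THEN exE])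
  ultimately show "\<exists>q h F. is_row i q h F" unfolding is_row_iff_row_cell by blast
qed (auto simp: is_row_iff_row_cell)

lemma definable_ex_is_row: "definable (\<lambda>e. \<exists>q h F. is_row (e 0) q h F)"
  unfolding ex_is_row_iff row_cell_def
  by (intro definable_finite_bex finite_states finite_sym definable_intros)

lemma input_cell_suc_iff:
  assumes "m \<epsilon> l"
  obtains b where "\<And>v. input_cell M s l (suc m) v \<longleftrightarrow> v = cell (bit_sym b) (init M) 0"
proof -
  obtain a where a_unique: "\<forall>z. pair m z \<epsilon> s \<longleftrightarrow> z = a"
    using input assms is_seq_ex unfolding binary_def by blast
  then obtain b where b_bit: "a = bit_num b" using binary_bit[OF input] by blast
  have "m' = m \<and> b' = b" if "m' \<epsilon> l" "suc m = suc m'" "pair m' (bit_num b') \<epsilon> s" for m' b'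
  proof -
    have "m' = m" using suc_inj that(1,2) omega_mem[OF length_omega] assms by metis
    then show ?thesis using that(3) a_unique b_bit by (simp add: of_bool_eq_iff)
  qed
  moreover have "pair m (bit_num b) \<epsilon> s" using a_unique b_bit by blast
  ultimately have "input_cell M s l (suc m) v \<longleftrightarrow> v = cell (bit_sym b) (init M) 0" for v
    unfolding input_cell_def
    using assms not_mem_suc_of_mem[OF length_omega assms] suc_neq_emp(1)[of m] by blast
  then show thesis using that by blast
qed

lemma ex_row_cell_emp:
  assumes "k \<epsilon> omega"
  shows "\<exists>a. row_cell emp (init M) emp k a"
  using length_omega assms
proof (cases rule: omega_position)
  case emp
  then have "row_cell emp (init M) emp k Start"
    unfolding row_cell_def tab_run_emp_iff input_cell_def by simp
  then show ?thesis ..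
next
  case (input m)
  then show ?thesis
    unfolding row_cell_iff tab_run_emp_iff using input_cell_suc_iff[of m] by simp metis
next
  case blank
  then have "row_cell emp (init M) emp k Blank"
    unfolding row_cell_def tab_run_emp_iff input_cell_def
    using assms not_mem_suc_of_mem[OF length_omega] by auto
  then show ?thesis ..
qed

lemma is_row_head:
  assumes "is_row i q h F"
  shows "tab run i j (cell a p 1) \<longleftrightarrow> j = h \<and> a = F h \<and> p = q"
  using assms unfolding is_row_def by (auto split: if_splits)

lemma is_row_halt:
  assumes "i \<epsilon> omega" "is_row i (halt M) h F"
  shows "is_row (suc i) (halt M) h F"
proof -
  have "rules_yield M run i k v \<longleftrightarrow> tab run i k v" for k v
    using is_row_head[OF assms(2)] unfolding halt_yields_def trans_yields_def by blast
  then show ?thesis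
    using assms(2) unfolding is_row_def tab_run_suc_iff[OF assms(1)] by blast
qed

lemma rules_yield_trans_iff:
  assumes row: "is_row i q h F" and "q \<noteq> halt M"
    and delta: "delta M q (F h) = (q', a', d)" and move: "moves d h j'"
  shows "rules_yield M run i k v \<longleftrightarrow>
    k \<epsilon> omega \<and> v = new_cell (sym_num a') q' h j' k (num (sym_num (F k)))"
proof
  assume "rules_yield M run i k v"
  then have "trans_yields M run i k v"
    using is_row_head[OF row] \<open>q \<noteq> halt M\<close> unfolding halt_yields_def by auto
  then obtain p a p' a1 d1 j j1 b r g where yield: "delta M p a = (p', a1, d1)"
    "tab run i j (cell a p 1)" "moves d1 j j1" "tab run i k (triple b r g)"
    "v = new_cell (sym_num a1) p' j j1 k b"
    unfolding trans_yields_def by blast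
  then have head: "j = h" "p' = q'" "a1 = a'" "d1 = d" using is_row_head[OF row] delta by auto
  then have "j1 = j'" using moves_unique yield(3) move row unfolding is_row_def by blast
  moreover have "k \<epsilon> omega" "b = num (sym_num (F k))"
    using yield(4) row by (simp_all add: is_row_def)
  ultimately show "k \<epsilon> omega \<and> v = new_cell (sym_num a') q' h j' k (num (sym_num (F k)))"
    using yield(5) head by simp
next
  assume v_eq: "k \<epsilon> omega \<and> v = new_cell (sym_num a') q' h j' k (num (sym_num (F k)))"
  have "q \<in> states M" "tab run i k (cell (F k) q (of_bool (k = h)))"
    using v_eq row by (simp_all add: is_row_def)
  moreover have "tab run i h (cell (F h) q 1)" using is_row_head[OF row] by blast
  ultimately have "trans_yields M run i k (new_cell (sym_num a') q' h j' k (num (sym_num (F k))))"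
    using \<open>q \<noteq> halt M\<close> delta move by (intro trans_yieldsI)
  then show "rules_yield M run i k v" using v_eq by simp
qed

lemma is_row_trans:
  assumes "i \<epsilon> omega" "is_row i q h F" "q \<noteq> halt M"
    and "delta M q (F h) = (q', a', d)" "moves d h j'" "j' \<epsilon> omega"
  shows "is_row (suc i) q' j' (F(h := a'))"
proof -
  have "q' \<in> states M"
    using machine assms(2,4) unfolding turing_machine_def is_row_def by (metis fst_conv)
  moreover have "new_cell (sym_num a') q' h j' k (num (sym_num (F k))) =
      cell ((F(h := a')) k) q' (of_bool (k = j'))" for k
    by (simp add: new_cell_def)
  ultimately show ?thesis
    using assms(6) rules_yield_trans_iff[OF assms(2-5)]
    unfolding is_row_def tab_run_suc_iff[OF assms(1)] by simp
qed

lemma ex_is_row: "i \<epsilon> omega \<Longrightarrow> \<exists>q h F. is_row i q h F"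
proof (induction rule: omega_induct)
  case definable
  show ?case by (rule definable_ex_is_row)
next
  case emp
  then show ?case
    unfolding ex_is_row_iff using machine ex_row_cell_emp emp_omega
    unfolding turing_machine_def by blast
next
  case (suc i)
  then obtain q h F where row: "is_row i q h F" by blast
  show ?case
  proof (cases "q = halt M")
    case True
    then show ?thesis using is_row_halt suc row by blast
  next
    case False
    moreover obtain q' a' d where "delta M q (F h) = (q', a', d)" by (cases "delta M q (F h)")
    moreover obtain j' where "j' \<epsilon> omega" "moves d h j'"
      using ex_moves row unfolding is_row_def by blast
    ultimately show ?thesis using is_row_trans suc row by blast
  qed
qed

lemma total_table_run: "total_table M run"
  unfolding total_table_def
proof (intro conjI allI impI)
  fix x assume x_mem: "x \<epsilon> run"
  then obtain i j v where ij_omega: "i \<epsilon> omega" "j \<epsilon> omega" and x_eq: "x = pair (pair i j) v"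
    unfolding mem_run_iff mem_cart_iff by blast
  obtain q h F where "is_row i q h F" using ex_is_row[OF ij_omega(1)] by blast
  then have "cell_value M v" using x_mem x_eq unfolding is_row_def cell_value_def by blast
  then show "\<exists>i j v. i \<epsilon> omega \<and> j \<epsilon> omega \<and> cell_value M v \<and> x = pair (pair i j) v"
    using ij_omega x_eq by blast
next
  fix i j assume "i \<epsilon> omega \<and> j \<epsilon> omega"
  then show "\<exists>v. \<forall>w. tab run i j w \<longleftrightarrow> w = v"
    using ex_is_row[of i] unfolding is_row_def by blast
qed

lemma is_table_run: "is_table M s l run"
  using total_table_run run_step run_start
  unfolding is_table_def obeys_rules_def starts_with_def by blast

end

end


section \<open>Soundness of the checker\<close>

context zf
begin

lemma theorem_true_any_constant: "{} \<turnstile> a \<Longrightarrow> sat t e a"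
  by (rule zfc_model.theorem_true[OF zfc_model_any_constant[OF zfc_model_axioms]])

lemma mem_funpow_suc_cases:
  assumes "l \<epsilon> omega" "k \<epsilon> (suc ^^ m) l"
  obtains (num) n where "n < m" "k = num n" | (shift) i where "i \<epsilon> l" "k = (suc ^^ m) i"
proof -
  have "(\<exists>n<m. k = num n) \<or> (\<exists>i. i \<epsilon> l \<and> k = (suc ^^ m) i)"
    using assms(2)
  proof (induction m arbitrary: k)
    case (Suc m)
    have "(suc ^^ m) l \<epsilon> omega" using assms(1) by (induction m) auto
    moreover have "k \<epsilon> suc ((suc ^^ m) l)" using Suc.prems by simp
    ultimately show ?case
    proof (cases rule: mem_suc_cases)
      case emp
      then show ?thesis using num_0 by auto
    next
      case (suc i)
      then show ?thesis using Suc.IH[of i] num_Suc by fastforce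
    qed
  qed simp
  then show thesis using that by blast
qed

lemma is_table_input: "is_table M s l t \<Longrightarrow> input_cell M s l k v \<Longrightarrow> tab t emp k v"
  by (simp add: is_table_def starts_with_def)

lemma coded_theory_cases:
  assumes coded: "coded_theory M s l U" and code_mem: "pair k (fm_code a) \<epsilon> U"
  obtains (machine) "a \<in> set (def_fms M Ct)"
  | (blank) "with_numv_code l (blank_fm M Ct (Var 0)) (fm_code a)"
  | (start) "a = with_num 0 (init_cell_fm M Ct (Var 0) Start 1)"
  | (bit) i b where "i \<epsilon> l" "pair i (bit_num b) \<epsilon> s"
      "with_numv_code (suc i) (init_cell_fm M Ct (Var 0) (bit_sym b) 0) (fm_code a)"
proof -
  have l_omega: "l \<epsilon> omega" and U_seq: "is_seq U ((suc ^^ (def_length M + 2)) l)"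
    using coded is_seq_omega unfolding coded_theory_def binary_def by blast+
  have entry: "x = fm_code a" if "pair k x \<epsilon> U" for x
    using is_seq_unique[OF U_seq] code_mem that by blast
  from mem_funpow_suc_cases[OF l_omega is_seq_dom[OF U_seq code_mem]]
  consider (machine_index) n where "n < def_length M" "k = num n"
    | (blank_index) "k = num (def_length M)" | (start_index) "k = num (def_length M + 1)"
    | (bit_index) i where "i \<epsilon> l" "k = (suc ^^ (def_length M + 2)) i"
    by (metis Suc_1 Suc_eq_plus1 add_Suc_right less_SucE)
  then show thesis
  proof cases
    case (machine_index n)
    then have "fm_code (def_fms M Ct ! n) = fm_code a"
      using coded entry unfolding coded_theory_def by blast
    then show thesis using machine_index(1) machine by auto
  next
    case blank_index
    then show thesis using coded entry blank unfolding coded_theory_def by blast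
  next
    case start_index
    then have "fm_code (with_num 0 (init_cell_fm M Ct (Var 0) Start 1)) = fm_code a"
      using coded entry unfolding coded_theory_def by blast
    then show thesis using start by simp
  next
    case (bit_index i)
    then show thesis using coded entry bit unfolding coded_theory_def coded_input_cell_def by blast
  qed
qed

lemma sat_coded_theory:
  assumes "turing_machine M" and coded: "coded_theory M s l U" and table: "is_table M s l t"
    and code_mem: "pair k (fm_code a) \<epsilon> U"
  shows "sat t e a"
  using coded code_mem
proof (cases rule: coded_theory_cases)
  case machine
  then show ?thesis
    using sat_def_fms[of M Ct t e] assms(1) table by (simp add: is_table_def turing_machine_def)
next
  case blank
  have "tab t emp j (cell Blank (init M) 0)" if "j \<epsilon> omega" "l \<epsilon> j" for j
    using that by (intro is_table_input[OF table]) (simp add: input_cell_def)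
  then show ?thesis by (simp add: sat_decoded_with_num[OF blank])
next
  case start
  have "tab t emp emp (cell Start (init M) 1)"
    by (intro is_table_input[OF table]) (simp add: input_cell_def)
  then show ?thesis by (simp add: start num_0)
next
  case (bit i b)
  then have "input_cell M s l (suc i) (cell (bit_sym b) (init M) 0)"
    unfolding input_cell_def by blast
  then have "tab t emp (suc i) (cell (bit_sym b) (init M) 0)" by (rule is_table_input[OF table])
  then show ?thesis by (simp add: sat_decoded_with_num[OF bit(3)])
qed

lemma sat_accepted_proof:
  assumes machine: "turing_machine M" and recorded: "recorded (Thy_AL M r) \<pi> Js"
    and coded: "coded_theory M s l U" and table: "is_table M s l t"
    and sequence: "coded_sequence \<pi> p" and valid: "theory_steps_valid Js U p"
  shows "i < length \<pi> \<Longrightarrow> sat t e (\<pi> ! i)"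
proof (induction i arbitrary: e rule: less_induct)
  case (less i)
  have justified: "justifies (Thy_AL M r) \<pi> i (Js ! i)"
    using recorded less.prems unfolding recorded_def by simp
  have IH: "sat t e (\<pi> ! j)" if "j < i" for j e using less.IH that less.prems by simp
  show ?case
  proof (cases "Js ! i")
    case Log_J
    then show ?thesis using justified logical_axiom_valid by (simp add: Thy_AL_def)
  next
    case ZFC_J
    then show ?thesis
      using justified by (simp add: Thy_AL_def theorem_true_any_constant entails.zfc)
  next
    case Thy_J
    then obtain y k where step: "pair (num i) y \<epsilon> p" "pair k y \<epsilon> U"
      using valid recorded less.prems unfolding theory_steps_valid_def recorded_def by auto
    have "y = fm_code (\<pi> ! i)"
      using sequence less.prems is_seq_unique step(1) unfolding coded_sequence_def by blast
    then show ?thesis using sat_coded_theory[OF machine coded table] step(2) by blast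
  next
    case (MP_J j k)
    then have "j < i" "k < i" "\<pi> ! j = Imp (\<pi> ! k) (\<pi> ! i)"
      using justified by (simp_all add: Thy_AL_def)
    then show ?thesis using IH[of j e] IH[of k e] by simp
  next
    case (Gen_J j k)
    then have "j < i" "\<pi> ! i = All k (\<pi> ! j)" using justified by (simp_all add: Thy_AL_def)
    then show ?thesis using IH[of j] by simp
  qed
qed

lemma sat_out: "sat t e (out_fm M f) \<longleftrightarrow>
  (\<exists>i. i \<epsilon> omega \<and> tab (val t e f) i (num 1) (cell One (halt M) 1))"
  by (simp add: out_fm_def iterated_quantifier_defs)

lemma sat_outputs_1:
  assumes machine: "turing_machine M" and "normal_proof M r \<pi>"
    and recorded: "recorded (Thy_AL M r) \<pi> Js" and coded: "coded_theory M (val c e s) l U"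
    and sequence: "coded_sequence \<pi> p" "theory_steps_valid Js U p"
  shows "sat c e (outputs_1_fm M s)"
proof -
  have binary: "binary (val c e s) l" using coded by (simp add: coded_theory_def)
  from is_table_run[OF machine this] obtain t where table: "is_table M (val c e s) l t" ..
  have "\<pi> \<noteq> []" "last \<pi> = out_fm M Ct"
    using assms(2) by (simp_all add: normal_proof_def proves_def)
  then have "sat t e (out_fm M Ct)"
    using sat_accepted_proof[OF machine recorded coded table sequence, of "length \<pi> - 1" e]
    by (simp add: last_conv_nth)
  then have "sat c (e(fresh [s] := t)) (out_fm M (Var (fresh [s])))" by (simp add: sat_out)
  moreover have "sat c (e(fresh [s] := t)) (table_fm M s (Var (fresh [s])))"
    by (rule sat_table[OF machine]) (use table binary in simp_all)
  ultimately show ?thesis by (auto simp: outputs_1_fm_def)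
qed

lemma sat_checker_accepts:
  assumes "sat c e (ex3 [s] (\<lambda>U p v. Conj
    [Thy_fm M s U, code_seq_fm \<pi> p, CK_fm Js AL_fm U p v, num_fm 1 v]))"
  shows "\<exists>U p l. coded_theory M (val c e s) l U \<and> coded_sequence \<pi> p \<and> theory_steps_valid Js U p"
proof -
  let ?U = "Var (fresh [s])"
  let ?p = "Var (fresh [?U, s])"
  let ?v = "Var (fresh [?p, ?U, s])"
  let ?e = "\<lambda>U p v. e(fresh [s] := U, fresh [?U, s] := p, fresh [?p, ?U, s] := v)"
  obtain U p v where sat: "sat c (?e U p v)
      (Conj [Thy_fm M s ?U, code_seq_fm \<pi> ?p, CK_fm Js AL_fm ?U ?p ?v, num_fm 1 ?v])"
    using assms unfolding ex3_def ex2_def eval_ex by blast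
  then have "\<exists>l. coded_theory M (val c e s) l U" "coded_sequence \<pi> p" by simp_all
  moreover have "theory_steps_valid Js (val c (?e U p v) ?U) (val c (?e U p v) ?p)"
  proof (rule sat_CK_theory_steps_valid)
    show "sat c (?e U p v) (CK_fm Js AL_fm ?U ?p ?v)"
      using sat unfolding sat_Conj by (meson list.set_intros)
    show "val c (?e U p v) ?v = num 1" using sat by simp
  qed
  then have "theory_steps_valid Js U p" by simp
  ultimately show ?thesis by blast
qed

theorem checker_formula_true:
  assumes "turing_machine M" "normal_proof M r \<pi>" "recorded (Thy_AL M r) \<pi> Js"
  shows "sat c e (checker_formula M \<pi> Js)"
  using sat_outputs_1[OF assms] sat_checker_accepts
  by (simp add: checker_formula_def) blast

end


section \<open>The checker formula does not contain the constant\<close>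

lemma t_free_all: "(\<And>x. x \<noteq> Ct \<Longrightarrow> t_free (F x)) \<Longrightarrow> t_free (all ps F)"
  by (simp add: all_def)

lemma t_free_ex: "(\<And>x. x \<noteq> Ct \<Longrightarrow> t_free (F x)) \<Longrightarrow> t_free (ex ps F)"
  by (simp add: ex_def)

lemma t_free_iterated_quantifiers:
  "(\<And>x y. x \<noteq> Ct \<Longrightarrow> y \<noteq> Ct \<Longrightarrow> t_free (F2 x y)) \<Longrightarrow> t_free (all2 ps F2)"
  "(\<And>x y. x \<noteq> Ct \<Longrightarrow> y \<noteq> Ct \<Longrightarrow> t_free (F2 x y)) \<Longrightarrow> t_free (ex2 ps F2)"
  "(\<And>x y z. x \<noteq> Ct \<Longrightarrow> y \<noteq> Ct \<Longrightarrow> z \<noteq> Ct \<Longrightarrow> t_free (F3 x y z)) \<Longrightarrow> t_free (all3 ps F3)"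
  "(\<And>x y z. x \<noteq> Ct \<Longrightarrow> y \<noteq> Ct \<Longrightarrow> z \<noteq> Ct \<Longrightarrow> t_free (F3 x y z)) \<Longrightarrow> t_free (ex3 ps F3)"
  "(\<And>x y z w. x \<noteq> Ct \<Longrightarrow> y \<noteq> Ct \<Longrightarrow> z \<noteq> Ct \<Longrightarrow> w \<noteq> Ct \<Longrightarrow> t_free (F4 x y z w)) \<Longrightarrow> t_free (ex4 ps F4)"
  "(\<And>x. x \<noteq> Ct \<Longrightarrow> t_free (F x)) \<Longrightarrow> t_free (ex1 ps F)"
  by (auto simp: iterated_quantifier_defs intro!: t_free_all t_free_ex)

lemmas t_free_quantifiers = t_free_all t_free_ex t_free_iterated_quantifiers

lemma t_free_Conj [simp]: "t_free (Conj as) \<longleftrightarrow> (\<forall>a \<in> set as. t_free a)"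
  unfolding Conj_def by (induction as) auto

lemma t_free_Disj [simp]: "t_free (Disj as) \<longleftrightarrow> (\<forall>a \<in> set as. t_free a)"
  unfolding Disj_def by (induction as) auto

lemma t_free_set_notions [simp]:
  "x \<noteq> Ct \<Longrightarrow> t_free (empty_fm x)"
  "x \<noteq> Ct \<Longrightarrow> y \<noteq> Ct \<Longrightarrow> t_free (succ_fm x y)"
  "x \<noteq> Ct \<Longrightarrow> y \<noteq> Ct \<Longrightarrow> p \<noteq> Ct \<Longrightarrow> t_free (pair_fm x y p)"
  "n \<noteq> Ct \<Longrightarrow> t_free (nat_fm n)"
  "f \<noteq> Ct \<Longrightarrow> x \<noteq> Ct \<Longrightarrow> y \<noteq> Ct \<Longrightarrow> t_free (app_fm f x y)"
  "f \<noteq> Ct \<Longrightarrow> n \<noteq> Ct \<Longrightarrow> t_free (seq_fm f n)"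
  by (auto simp: empty_fm_def succ_fm_def upair_fm_def pair_fm_def nat_fm_def inductive_fm_def
      app_fm_def seq_fm_def intro!: t_free_quantifiers)

lemma t_free_numv [simp]: "t_free (numv k x y)"
  by (induction k) auto

lemma t_free_num_fm [simp]: "u \<noteq> Ct \<Longrightarrow> t_free (num_fm k u)"
  by (simp add: num_fm_def Let_def)

lemma t_free_add_fm [simp]: "k \<noteq> Ct \<Longrightarrow> m \<noteq> Ct \<Longrightarrow> t_free (add_fm d k m)"
  by (induction d arbitrary: m) (auto intro!: t_free_quantifiers)

lemma t_free_numerals [simp]:
  "x \<noteq> Ct \<Longrightarrow> t_free (one_of_fm ks x)"
  "f \<noteq> Ct \<Longrightarrow> y \<noteq> Ct \<Longrightarrow> t_free (entry_fm f n y)"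
  "f \<noteq> Ct \<Longrightarrow> t_free (length_fm f n)"
  by (auto simp: one_of_fm_def entry_fm_def length_fm_def intro!: t_free_quantifiers)

lemma t_free_cells [simp]:
  "a \<noteq> Ct \<Longrightarrow> q \<noteq> Ct \<Longrightarrow> h \<noteq> Ct \<Longrightarrow> v \<noteq> Ct \<Longrightarrow> t_free (triple_fm a q h v)"
  "t \<noteq> Ct \<Longrightarrow> i \<noteq> Ct \<Longrightarrow> j \<noteq> Ct \<Longrightarrow> v \<noteq> Ct \<Longrightarrow> t_free (tab_fm t i j v)"
  "t \<noteq> Ct \<Longrightarrow> i \<noteq> Ct \<Longrightarrow> j \<noteq> Ct \<Longrightarrow> a \<noteq> Ct \<Longrightarrow> q \<noteq> Ct \<Longrightarrow> h \<noteq> Ct \<Longrightarrow> t_free (cell_fm t i j a q h)"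
  "t \<noteq> Ct \<Longrightarrow> i \<noteq> Ct \<Longrightarrow> j \<noteq> Ct \<Longrightarrow> t_free (ncell_fm t i j b n k)"
  "t \<noteq> Ct \<Longrightarrow> j \<noteq> Ct \<Longrightarrow> t_free (init_cell_fm M t j b k)"
  "t \<noteq> Ct \<Longrightarrow> l \<noteq> Ct \<Longrightarrow> t_free (blank_fm M t l)"
  by (auto simp: triple_fm_def tab_fm_def cell_fm_def ncell_fm_def init_cell_fm_def blank_fm_def
      intro!: t_free_quantifiers)

lemma t_free_move_fm [simp]: "j \<noteq> Ct \<Longrightarrow> j' \<noteq> Ct \<Longrightarrow> t_free (move_fm d j j')"
  by (cases d) auto

lemma t_free_transitions [simp]:
  "t \<noteq> Ct \<Longrightarrow> t_free (halt_fm M t a)"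
  "t \<noteq> Ct \<Longrightarrow> t_free (trans_fm M t q a)"
  by (auto simp: halt_fm_def trans_fm_def split: prod.split intro!: t_free_quantifiers)

lemma t_free_def_fms: "t \<noteq> Ct \<Longrightarrow> a \<in> set (def_fms M t) \<Longrightarrow> t_free a"
  by (auto simp: def_fms_def value_fm_def intro!: t_free_quantifiers)

lemma t_free_constructor_codes [simp]:
  "a \<noteq> Ct \<Longrightarrow> c \<noteq> Ct \<Longrightarrow> t_free (cVar a c)"
  "c \<noteq> Ct \<Longrightarrow> t_free (cCt c)"
  "a \<noteq> Ct \<Longrightarrow> b \<noteq> Ct \<Longrightarrow> c \<noteq> Ct \<Longrightarrow> t_free (cEq a b c)"
  "a \<noteq> Ct \<Longrightarrow> b \<noteq> Ct \<Longrightarrow> c \<noteq> Ct \<Longrightarrow> t_free (cMem a b c)"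
  "a \<noteq> Ct \<Longrightarrow> c \<noteq> Ct \<Longrightarrow> t_free (cNeg a c)"
  "a \<noteq> Ct \<Longrightarrow> b \<noteq> Ct \<Longrightarrow> c \<noteq> Ct \<Longrightarrow> t_free (cImp a b c)"
  "a \<noteq> Ct \<Longrightarrow> b \<noteq> Ct \<Longrightarrow> c \<noteq> Ct \<Longrightarrow> t_free (cAll a b c)"
  by (auto simp: tag_fm_def tag2_fm_def cVar_def cCt_def cEq_def cMem_def cNeg_def cImp_def
      cAll_def intro!: t_free_quantifiers)

lemma t_free_code_tm [simp]: "c \<noteq> Ct \<Longrightarrow> t_free (code_tm s c)"
  by (cases s) (auto intro!: t_free_quantifiers)

lemma t_free_code_fm [simp]: "c \<noteq> Ct \<Longrightarrow> t_free (code_fm a c)"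
  by (induction a arbitrary: c) (auto intro!: t_free_quantifiers)

lemma t_free_scheme_fm:
  assumes "Ct \<notin> set Fs \<union> set Vs \<union> set Ts"
  shows "c \<noteq> Ct \<Longrightarrow> scheme_bounded (length Fs) (length Vs) (length Ts) p \<Longrightarrow>
    t_free (scheme_fm Fs Vs Ts p c)"
proof (induction p arbitrary: c)
  have nth_neq_Ct: "us ! i \<noteq> Ct" if "i < length us" "us \<in> {Fs, Vs, Ts}" for i us
    using assms that nth_mem by fastforce
  have t_free_tm: "t_free (scheme_tm Vs Ts s c)"
    if "c \<noteq> Ct" "stm_bounded (length Vs) (length Ts) s" for s c
    using that nth_neq_Ct by (cases s) (auto dest: sym)
  {
    case (FH i)
    then show ?case using nth_neq_Ct by (auto dest: sym)
  next
    case (PEq s u)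
    then show ?case using t_free_tm by (auto intro!: t_free_quantifiers)
  next
    case (PMem s u)
    then show ?case using t_free_tm by (auto intro!: t_free_quantifiers)
  next
    case (PAll i p)
    then show ?case using nth_neq_Ct by (auto intro!: t_free_quantifiers)
  }
qed (auto intro!: t_free_quantifiers)

lemma t_free_deriv_fm:
  assumes "\<And>f i y. f \<noteq> Ct \<Longrightarrow> i \<noteq> Ct \<Longrightarrow> y \<noteq> Ct \<Longrightarrow> t_free (F f i y)"
  shows "x \<noteq> Ct \<Longrightarrow> t_free (deriv_fm ps F x)"
  using assms by (auto simp: deriv_fm_def intro!: t_free_quantifiers)

lemma t_free_prev_fm [simp]: "f \<noteq> Ct \<Longrightarrow> i \<noteq> Ct \<Longrightarrow> y \<noteq> Ct \<Longrightarrow> t_free (prev_fm f i y)"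
  by (auto simp: prev_fm_def intro!: t_free_quantifiers)

lemma t_free_syntax [simp]:
  "c \<noteq> Ct \<Longrightarrow> t_free (is_tm_fm c)"
  "c \<noteq> Ct \<Longrightarrow> t_free (is_fm_fm c)"
  "v \<noteq> Ct \<Longrightarrow> c \<noteq> Ct \<Longrightarrow> t_free (not_free_fm v c)"
  "v \<noteq> Ct \<Longrightarrow> u \<noteq> Ct \<Longrightarrow> a \<noteq> Ct \<Longrightarrow> b \<noteq> Ct \<Longrightarrow> t_free (subst_fm v u a b)"
proof -
  show is_tm: "c \<noteq> Ct \<Longrightarrow> t_free (is_tm_fm c)" for c
    by (auto simp: is_tm_fm_def intro!: t_free_quantifiers)
  show is_fm: "c \<noteq> Ct \<Longrightarrow> t_free (is_fm_fm c)" for c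
    using is_tm unfolding is_fm_fm_def by (auto intro!: t_free_deriv_fm t_free_quantifiers)
  show not_free: "v \<noteq> Ct \<Longrightarrow> c \<noteq> Ct \<Longrightarrow> t_free (not_free_fm v c)" for v c
    using is_tm is_fm unfolding not_free_fm_def by (auto intro!: t_free_deriv_fm t_free_quantifiers)
  show "v \<noteq> Ct \<Longrightarrow> u \<noteq> Ct \<Longrightarrow> a \<noteq> Ct \<Longrightarrow> b \<noteq> Ct \<Longrightarrow> t_free (subst_fm v u a b)"
    using is_tm not_free unfolding subst_fm_def subst_tm_fm_def
    by (auto intro!: t_free_deriv_fm t_free_quantifiers)
qed

lemma t_free_axioms [simp]:
  "x \<noteq> Ct \<Longrightarrow> t_free (logical_axiom_fm x)"
  "x \<noteq> Ct \<Longrightarrow> t_free (zfc_axiom_fm x)"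
  by (auto simp: logical_axiom_fm_def prop_schemes_def eq_schemes_def zfc_axiom_fm_def
      separation_scheme_def replacement_scheme_def intro!: t_free_quantifiers t_free_scheme_fm)

lemma t_free_valid_fm [simp]: "U \<noteq> Ct \<Longrightarrow> p \<noteq> Ct \<Longrightarrow> t_free (valid_fm AL_fm U p i J)"
  by (cases J) (auto simp: valid_fm_def AL_fm_def bool_val_fm_def intro!: t_free_quantifiers)

lemma t_free_checker [simp]:
  "U \<noteq> Ct \<Longrightarrow> p \<noteq> Ct \<Longrightarrow> v \<noteq> Ct \<Longrightarrow> t_free (CK_fm Js AL_fm U p v)"
  "p \<noteq> Ct \<Longrightarrow> t_free (code_seq_fm \<pi> p)"
  "s \<noteq> Ct \<Longrightarrow> l \<noteq> Ct \<Longrightarrow> t_free (binary_fm s l)"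
  by (auto simp: CK_fm_def bool_val_fm_def code_seq_fm_def binary_fm_def intro!: t_free_quantifiers)

lemma t_free_with_num_code_fm [simp]: "k \<noteq> Ct \<Longrightarrow> c \<noteq> Ct \<Longrightarrow> t_free (with_num_code_fm k a c)"
  by (auto simp: with_num_code_fm_def num_code_fm_def intro!: t_free_quantifiers t_free_scheme_fm)

lemma t_free_Thy_fm [simp]: "s \<noteq> Ct \<Longrightarrow> U \<noteq> Ct \<Longrightarrow> t_free (Thy_fm M s U)"
  by (auto simp: Thy_fm_def Let_def intro!: t_free_quantifiers)

lemma t_free_outputs_1_fm [simp]: "s \<noteq> Ct \<Longrightarrow> t_free (outputs_1_fm M s)"
  by (auto simp: outputs_1_fm_def out_fm_def table_fm_def t_free_def_fms intro!: t_free_quantifiers)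

lemma t_free_checker_formula: "t_free (checker_formula M \<pi> Js)"
  by (auto simp: checker_formula_def intro!: t_free_quantifiers)

theorem theorem3p19:
  fixes M :: turing and r :: "bool list" and \<pi> :: "fm list" and Js :: "justification list"
  assumes "turing_machine M"
    and "outputs_1 M r"
    and "normal_proof M r \<pi>"
    and "recorded (Thy_AL M r) \<pi> Js"
  shows "zfc_provable (checker_formula M \<pi> Js)"
proof (rule zfc_provable_if_entails[OF completeness t_free_checker_formula])
  fix E :: "nat \<Rightarrow> nat \<Rightarrow> bool" and c e
  assume "zfc_model (=) E c"
  then interpret zf E c unfolding zf_def .
  show "eval (=) E c e (checker_formula M \<pi> Js)"
    by (rule checker_formula_true[OF assms(1,3,4)])
qed

end
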